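(* Let $\mathcal{A}$ be an AB3 abelian category and $\mathcal{B}$ be an additive (full) subcategory of $\mathcal{A}$. The following assertions are equivalent: (1) $\mathcal{B}$ is a coreflective subcategory that is (equivalent to) the module category over a small preadditive category. (2) $\mathcal{B}$ is closed under taking cokernels in $\mathcal{A}$ and there is a self-small set $\mathcal{U}$ of objects that satisfies the following properties: (a) $\mathcal{B}=\operatorname{Pres}(\mathcal{U})$; (b) if $\tilde{U}\in\operatorname{Sum}(\mathcal{U})$ and $Y$ is a subobject of an object in $\operatorname{Pres}(\mathcal{U})$, then any epimorphism $p:\tilde{U}\twoheadrightarrow Y$ is a $\mathcal{U}$-epimorphism and $\mathcal{A}\left(U,\frac{\operatorname{Ker} p}{\operatorname{tr}_{\mathcal{U}}(\operatorname{Ker} p)}\right)=0$ for all $U\in\mathcal{U}$. In such situation $\mathcal{B}$ is (equivalent to) the module category over a ring if, and only if, the set $\mathcal{U}$ in assertion (2) may be chosen to contain just one object.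
   Context: AB3 means cocomplete. Subcategories are full and closed under isomorphisms; an additive subcategory contains $0$ and is closed under finite coproducts. $\mathcal{B}$ is coreflective if its inclusion has a right adjoint. The module category over a small preadditive category $\mathcal{C}$ is the category of additive functors $\mathcal{C}^{\mathrm{op}}\to\mathrm{Ab}$; rings are associative and unital. $\operatorname{Sum}(\mathcal{U})$ is the class of all (set-indexed) coproducts of objects from $\mathcal{U}$; $\operatorname{Pres}(\mathcal{U})$ is the class of objects isomorphic to cokernels of morphisms between objects of $\operatorname{Sum}(\mathcal{U})$. A set $\mathcal{U}$ of objects is self-small if for each family $\{U_i\mid i\in I\}\subseteq\mathcal{U}$ and each $U\in\mathcal{U}$, the canonical map $\coprod_{i\in I}\mathcal{A}(U,U_i)\to\mathcal{A}(U,\coprod_{i\in I}U_i)$ is an isomorphism. A morphism $p$ is a $\mathcal{U}$-epimorphism if $\mathcal{A}(U,p)$ is surjective for every $U\in\mathcal{U}$. The trace $\operatorname{tr}_{\mathcal{U}}(A)$ is the largest subobject of $A$ that is an epimorphic image of an object of $\operatorname{Sum}(\mathcal{U})$. *)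

theory Defs
  imports "HOL-Algebra.Free_Abelian_Groups" "HOL-Algebra.Ring"
begin

unbundle cardinal_syntax

text \<open>The distinction between sets and proper classes is made relative to a Grothendieck
  universe, represented by a type \<open>'u\<close> whose cardinality is an (uncountable) strongly
  inaccessible cardinal \<open>\<kappa>\<close>: the sets of the theory are the HOL sets of cardinality less than
  \<open>\<kappa>\<close>; arbitrary HOL sets play the part of classes. Every small set is in bijection with a
  subset of \<open>'u\<close>, so families indexed by small subsets of \<open>'u\<close> are all the small families up to
  reindexing.\<close>

definition small :: "'u itself \<Rightarrow> 'a set \<Rightarrow> bool" where
  "small (_ :: 'u itself) X \<longleftrightarrow> |X| <o |UNIV :: 'u set|"

definition universe :: "'u itself \<Rightarrow> bool" where
  "universe u \<longleftrightarrow>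
     uncountable (UNIV :: 'u set) \<and>
     regularCard |UNIV :: 'u set| \<and>
     (\<forall>X :: 'u set. small u X \<longrightarrow> small u (Pow X))"

record ('o, 'm) category =
  Obj :: "'o set"
  Hom :: "'o \<Rightarrow> 'o \<Rightarrow> 'm set"
  Ident :: "'o \<Rightarrow> 'm"
  Comp :: "'m \<Rightarrow> 'm \<Rightarrow> 'm" (infixr \<open>\<diamondop>\<index>\<close> 75)

locale category =
  fixes C :: "('o, 'm, 'x) category_scheme" (structure)
  assumes comp_in_Hom:
      "\<lbrakk>X \<in> Obj C; Y \<in> Obj C; Z \<in> Obj C; f \<in> Hom C X Y; g \<in> Hom C Y Z\<rbrakk> \<Longrightarrow> g \<diamondop> f \<in> Hom C X Z"
    and comp_assoc:
      "\<lbrakk>W \<in> Obj C; X \<in> Obj C; Y \<in> Obj C; Z \<in> Obj C;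
        f \<in> Hom C W X; g \<in> Hom C X Y; h \<in> Hom C Y Z\<rbrakk> \<Longrightarrow> (h \<diamondop> g) \<diamondop> f = h \<diamondop> (g \<diamondop> f)"
    and Ident_in_Hom: "X \<in> Obj C \<Longrightarrow> Ident C X \<in> Hom C X X"
    and comp_Ident: "\<lbrakk>X \<in> Obj C; Y \<in> Obj C; f \<in> Hom C X Y\<rbrakk> \<Longrightarrow> f \<diamondop> Ident C X = f"
    and Ident_comp: "\<lbrakk>X \<in> Obj C; Y \<in> Obj C; f \<in> Hom C X Y\<rbrakk> \<Longrightarrow> Ident C Y \<diamondop> f = f"
    and Hom_disjoint:
      "\<lbrakk>X \<in> Obj C; Y \<in> Obj C; X' \<in> Obj C; Y' \<in> Obj C; f \<in> Hom C X Y; f \<in> Hom C X' Y'\<rbrakk>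
       \<Longrightarrow> X = X' \<and> Y = Y'"

definition locally_small :: "'u itself \<Rightarrow> ('o, 'm, 'x) category_scheme \<Rightarrow> bool" where
  "locally_small u C \<longleftrightarrow> (\<forall>X\<in>Obj C. \<forall>Y\<in>Obj C. small u (Hom C X Y))"

definition small_category :: "'u itself \<Rightarrow> ('o, 'm, 'x) category_scheme \<Rightarrow> bool" where
  "small_category u C \<longleftrightarrow> category C \<and> small u (Obj C) \<and> locally_small u C"

definition is_isomorphism :: "('o, 'm, 'x) category_scheme \<Rightarrow> 'o \<Rightarrow> 'o \<Rightarrow> 'm \<Rightarrow> bool" where
  "is_isomorphism C X Y f \<longleftrightarrow> f \<in> Hom C X Y \<and>
     (\<exists>g\<in>Hom C Y X. g \<diamondop>\<^bsub>C\<^esub> f = Ident C X \<and> f \<diamondop>\<^bsub>C\<^esub> g = Ident C Y)"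

definition isomorphic :: "('o, 'm, 'x) category_scheme \<Rightarrow> 'o \<Rightarrow> 'o \<Rightarrow> bool" where
  "isomorphic C X Y \<longleftrightarrow> (\<exists>f. is_isomorphism C X Y f)"

definition is_mono :: "('o, 'm, 'x) category_scheme \<Rightarrow> 'o \<Rightarrow> 'o \<Rightarrow> 'm \<Rightarrow> bool" where
  "is_mono C X Y f \<longleftrightarrow> f \<in> Hom C X Y \<and>
     (\<forall>W\<in>Obj C. \<forall>g\<in>Hom C W X. \<forall>h\<in>Hom C W X. f \<diamondop>\<^bsub>C\<^esub> g = f \<diamondop>\<^bsub>C\<^esub> h \<longrightarrow> g = h)"

definition is_epi :: "('o, 'm, 'x) category_scheme \<Rightarrow> 'o \<Rightarrow> 'o \<Rightarrow> 'm \<Rightarrow> bool" where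
  "is_epi C X Y f \<longleftrightarrow> f \<in> Hom C X Y \<and>
     (\<forall>Z\<in>Obj C. \<forall>g\<in>Hom C Y Z. \<forall>h\<in>Hom C Y Z. g \<diamondop>\<^bsub>C\<^esub> f = h \<diamondop>\<^bsub>C\<^esub> f \<longrightarrow> g = h)"

definition is_zero_object :: "('o, 'm, 'x) category_scheme \<Rightarrow> 'o \<Rightarrow> bool" where
  "is_zero_object C Z \<longleftrightarrow> Z \<in> Obj C \<and>
     (\<forall>X\<in>Obj C. (\<exists>!f. f \<in> Hom C X Z) \<and> (\<exists>!f. f \<in> Hom C Z X))"

definition is_coproduct ::
    "('o, 'm, 'x) category_scheme \<Rightarrow> 'i set \<Rightarrow> ('i \<Rightarrow> 'o) \<Rightarrow> 'o \<Rightarrow> ('i \<Rightarrow> 'm) \<Rightarrow> bool" where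
  "is_coproduct C I D X \<iota> \<longleftrightarrow> X \<in> Obj C \<and> (\<forall>i\<in>I. \<iota> i \<in> Hom C (D i) X) \<and>
     (\<forall>Y\<in>Obj C. \<forall>f. (\<forall>i\<in>I. f i \<in> Hom C (D i) Y) \<longrightarrow>
        (\<exists>!h. h \<in> Hom C X Y \<and> (\<forall>i\<in>I. h \<diamondop>\<^bsub>C\<^esub> \<iota> i = f i)))"

record ('o, 'm, 'p, 'n) ftor =
  ObjMap :: "'o \<Rightarrow> 'p"
  ArrMap :: "'m \<Rightarrow> 'n"

definition is_functor ::
    "('o, 'm, 'x) category_scheme \<Rightarrow> ('p, 'n, 'y) category_scheme \<Rightarrow> ('o, 'm, 'p, 'n) ftor \<Rightarrow> bool"
  where
  "is_functor C D F \<longleftrightarrow>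
     (\<forall>X\<in>Obj C. ObjMap F X \<in> Obj D) \<and>
     (\<forall>X\<in>Obj C. \<forall>Y\<in>Obj C. \<forall>f\<in>Hom C X Y. ArrMap F f \<in> Hom D (ObjMap F X) (ObjMap F Y)) \<and>
     (\<forall>X\<in>Obj C. ArrMap F (Ident C X) = Ident D (ObjMap F X)) \<and>
     (\<forall>X\<in>Obj C. \<forall>Y\<in>Obj C. \<forall>Z\<in>Obj C. \<forall>f\<in>Hom C X Y. \<forall>g\<in>Hom C Y Z.
        ArrMap F (g \<diamondop>\<^bsub>C\<^esub> f) = ArrMap F g \<diamondop>\<^bsub>D\<^esub> ArrMap F f)"

definition id_functor :: "('o, 'm, 'o, 'm) ftor" where
  "id_functor = \<lparr>ObjMap = (\<lambda>X. X), ArrMap = (\<lambda>f. f)\<rparr>"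

definition comp_functor ::
    "('p, 'n, 'q, 'k) ftor \<Rightarrow> ('o, 'm, 'p, 'n) ftor \<Rightarrow> ('o, 'm, 'q, 'k) ftor" where
  "comp_functor G F = \<lparr>ObjMap = ObjMap G \<circ> ObjMap F, ArrMap = ArrMap G \<circ> ArrMap F\<rparr>"

definition is_natural ::
    "('o, 'm, 'x) category_scheme \<Rightarrow> ('p, 'n, 'y) category_scheme
     \<Rightarrow> ('o, 'm, 'p, 'n) ftor \<Rightarrow> ('o, 'm, 'p, 'n) ftor \<Rightarrow> ('o \<Rightarrow> 'n) \<Rightarrow> bool" where
  "is_natural C D F G \<eta> \<longleftrightarrow>
     (\<forall>X\<in>Obj C. \<eta> X \<in> Hom D (ObjMap F X) (ObjMap G X)) \<and>
     (\<forall>X\<in>Obj C. \<forall>Y\<in>Obj C. \<forall>f\<in>Hom C X Y.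
        \<eta> Y \<diamondop>\<^bsub>D\<^esub> ArrMap F f = ArrMap G f \<diamondop>\<^bsub>D\<^esub> \<eta> X)"

definition naturally_isomorphic ::
    "('o, 'm, 'x) category_scheme \<Rightarrow> ('p, 'n, 'y) category_scheme
     \<Rightarrow> ('o, 'm, 'p, 'n) ftor \<Rightarrow> ('o, 'm, 'p, 'n) ftor \<Rightarrow> bool" where
  "naturally_isomorphic C D F G \<longleftrightarrow>
     (\<exists>\<eta>. is_natural C D F G \<eta> \<and> (\<forall>X\<in>Obj C. is_isomorphism D (ObjMap F X) (ObjMap G X) (\<eta> X)))"

definition equivalent_categories ::
    "('o, 'm, 'x) category_scheme \<Rightarrow> ('p, 'n, 'y) category_scheme \<Rightarrow> bool" where
  "equivalent_categories C D \<longleftrightarrow>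
     (\<exists>F G. is_functor C D F \<and> is_functor D C G \<and>
        naturally_isomorphic C C (comp_functor G F) id_functor \<and>
        naturally_isomorphic D D (comp_functor F G) id_functor)"

definition is_right_adjoint ::
    "('o, 'm, 'x) category_scheme \<Rightarrow> ('p, 'n, 'y) category_scheme
     \<Rightarrow> ('o, 'm, 'p, 'n) ftor \<Rightarrow> ('p, 'n, 'o, 'm) ftor \<Rightarrow> bool" where
  "is_right_adjoint C D F G \<longleftrightarrow> is_functor C D F \<and> is_functor D C G \<and>
     (\<exists>\<phi>.
       (\<forall>X\<in>Obj C. \<forall>Y\<in>Obj D. bij_betw (\<phi> X Y) (Hom D (ObjMap F X) Y) (Hom C X (ObjMap G Y))) \<and>
       (\<forall>X\<in>Obj C. \<forall>X'\<in>Obj C. \<forall>Y\<in>Obj D. \<forall>Y'\<in>Obj D.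
         \<forall>a\<in>Hom C X' X. \<forall>b\<in>Hom D Y Y'. \<forall>g\<in>Hom D (ObjMap F X) Y.
           \<phi> X' Y' (b \<diamondop>\<^bsub>D\<^esub> g \<diamondop>\<^bsub>D\<^esub> ArrMap F a) = ArrMap G b \<diamondop>\<^bsub>C\<^esub> \<phi> X Y g \<diamondop>\<^bsub>C\<^esub> a))"

definition full_subcategory ::
    "('o, 'm, 'x) category_scheme \<Rightarrow> 'o set \<Rightarrow> ('o, 'm, 'x) category_scheme" where
  "full_subcategory C B = C\<lparr>Obj := B\<rparr>"

definition coreflective :: "('o, 'm, 'x) category_scheme \<Rightarrow> 'o set \<Rightarrow> bool" where
  "coreflective C B \<longleftrightarrow> (\<exists>G. is_right_adjoint (full_subcategory C B) C id_functor G)"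

definition is_cocone ::
    "('j, 'k, 'y) category_scheme \<Rightarrow> ('o, 'm, 'x) category_scheme
     \<Rightarrow> ('j, 'k, 'o, 'm) ftor \<Rightarrow> 'o \<Rightarrow> ('j \<Rightarrow> 'm) \<Rightarrow> bool" where
  "is_cocone J C D X \<iota> \<longleftrightarrow> X \<in> Obj C \<and>
     (\<forall>j\<in>Obj J. \<iota> j \<in> Hom C (ObjMap D j) X) \<and>
     (\<forall>i\<in>Obj J. \<forall>j\<in>Obj J. \<forall>f\<in>Hom J i j. \<iota> j \<diamondop>\<^bsub>C\<^esub> ArrMap D f = \<iota> i)"

definition is_colimit ::
    "('j, 'k, 'y) category_scheme \<Rightarrow> ('o, 'm, 'x) category_scheme
     \<Rightarrow> ('j, 'k, 'o, 'm) ftor \<Rightarrow> 'o \<Rightarrow> ('j \<Rightarrow> 'm) \<Rightarrow> bool" where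
  "is_colimit J C D X \<iota> \<longleftrightarrow> is_cocone J C D X \<iota> \<and>
     (\<forall>Y \<gamma>. is_cocone J C D Y \<gamma> \<longrightarrow>
        (\<exists>!h. h \<in> Hom C X Y \<and> (\<forall>j\<in>Obj J. h \<diamondop>\<^bsub>C\<^esub> \<iota> j = \<gamma> j)))"

definition cocomplete :: "'u itself \<Rightarrow> ('o, 'm, 'x) category_scheme \<Rightarrow> bool" where
  "cocomplete u C \<longleftrightarrow>
     (\<forall>(J :: ('u, 'u) category) D. small_category u J \<and> is_functor J C D \<longrightarrow>
        (\<exists>X \<iota>. is_colimit J C D X \<iota>))"

record ('o, 'm) preadd = "('o, 'm) category" +
  Add :: "'m \<Rightarrow> 'm \<Rightarrow> 'm"
  Zero :: "'o \<Rightarrow> 'o \<Rightarrow> 'm"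

text \<open>Additive abelian groups are presented by the multiplicatively written structures of
  \<open>HOL-Algebra\<close>, for which direct sums and finitely supported sums are available.\<close>

definition hom_group :: "('o, 'm, 'x) preadd_scheme \<Rightarrow> 'o \<Rightarrow> 'o \<Rightarrow> 'm monoid" where
  "hom_group C X Y = \<lparr>carrier = Hom C X Y, mult = Add C, one = Zero C X Y\<rparr>"

locale preadditive_category = category C
  for C :: "('o, 'm, 'x) preadd_scheme" (structure) +
  assumes hom_comm_group: "\<lbrakk>X \<in> Obj C; Y \<in> Obj C\<rbrakk> \<Longrightarrow> comm_group (hom_group C X Y)"
    and comp_Add:
      "\<lbrakk>X \<in> Obj C; Y \<in> Obj C; Z \<in> Obj C; f \<in> Hom C X Y; f' \<in> Hom C X Y; g \<in> Hom C Y Z\<rbrakk>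
       \<Longrightarrow> g \<diamondop> Add C f f' = Add C (g \<diamondop> f) (g \<diamondop> f')"
    and Add_comp:
      "\<lbrakk>X \<in> Obj C; Y \<in> Obj C; Z \<in> Obj C; f \<in> Hom C X Y; g \<in> Hom C Y Z; g' \<in> Hom C Y Z\<rbrakk>
       \<Longrightarrow> Add C g g' \<diamondop> f = Add C (g \<diamondop> f) (g' \<diamondop> f)"

definition small_preadditive :: "'u itself \<Rightarrow> ('o, 'm, 'x) preadd_scheme \<Rightarrow> bool" where
  "small_preadditive u C \<longleftrightarrow> preadditive_category C \<and> small_category u C"

definition is_kernel ::
    "('o, 'm, 'x) preadd_scheme \<Rightarrow> 'o \<Rightarrow> 'o \<Rightarrow> 'm \<Rightarrow> 'o \<Rightarrow> 'm \<Rightarrow> bool" where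
  "is_kernel C X Y f K k \<longleftrightarrow> K \<in> Obj C \<and> k \<in> Hom C K X \<and> f \<diamondop>\<^bsub>C\<^esub> k = Zero C K Y \<and>
     (\<forall>W\<in>Obj C. \<forall>g\<in>Hom C W X. f \<diamondop>\<^bsub>C\<^esub> g = Zero C W Y \<longrightarrow>
        (\<exists>!h. h \<in> Hom C W K \<and> k \<diamondop>\<^bsub>C\<^esub> h = g))"

definition is_cokernel ::
    "('o, 'm, 'x) preadd_scheme \<Rightarrow> 'o \<Rightarrow> 'o \<Rightarrow> 'm \<Rightarrow> 'o \<Rightarrow> 'm \<Rightarrow> bool" where
  "is_cokernel C X Y f Q q \<longleftrightarrow> Q \<in> Obj C \<and> q \<in> Hom C Y Q \<and> q \<diamondop>\<^bsub>C\<^esub> f = Zero C X Q \<and>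
     (\<forall>W\<in>Obj C. \<forall>g\<in>Hom C Y W. g \<diamondop>\<^bsub>C\<^esub> f = Zero C X W \<longrightarrow>
        (\<exists>!h. h \<in> Hom C Q W \<and> h \<diamondop>\<^bsub>C\<^esub> q = g))"

locale abelian_category = preadditive_category C
  for C :: "('o, 'm, 'x) preadd_scheme" (structure) +
  assumes ex_zero_object: "\<exists>Z. is_zero_object C Z"
    and ex_finite_coproduct:
      "\<lbrakk>finite (I :: nat set); \<And>i. i \<in> I \<Longrightarrow> D i \<in> Obj C\<rbrakk> \<Longrightarrow> \<exists>X \<iota>. is_coproduct C I D X \<iota>"
    and ex_kernel:
      "\<lbrakk>X \<in> Obj C; Y \<in> Obj C; f \<in> Hom C X Y\<rbrakk> \<Longrightarrow> \<exists>K k. is_kernel C X Y f K k"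
    and ex_cokernel:
      "\<lbrakk>X \<in> Obj C; Y \<in> Obj C; f \<in> Hom C X Y\<rbrakk> \<Longrightarrow> \<exists>Q q. is_cokernel C X Y f Q q"
    and mono_is_kernel:
      "\<lbrakk>X \<in> Obj C; Y \<in> Obj C; is_mono C X Y f\<rbrakk>
       \<Longrightarrow> \<exists>Z\<in>Obj C. \<exists>g\<in>Hom C Y Z. is_kernel C Y Z g X f"
    and epi_is_cokernel:
      "\<lbrakk>X \<in> Obj C; Y \<in> Obj C; is_epi C X Y f\<rbrakk>
       \<Longrightarrow> \<exists>W\<in>Obj C. \<exists>g\<in>Hom C W X. is_cokernel C W X g Y f"

definition additive_subcategory :: "('o, 'm, 'x) preadd_scheme \<Rightarrow> 'o set \<Rightarrow> bool" where
  "additive_subcategory C B \<longleftrightarrow> B \<subseteq> Obj C \<and>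
     (\<forall>X\<in>B. \<forall>Y\<in>Obj C. isomorphic C X Y \<longrightarrow> Y \<in> B) \<and>
     (\<forall>Z. is_zero_object C Z \<longrightarrow> Z \<in> B) \<and>
     (\<forall>(I :: nat set) D X \<iota>. finite I \<and> (\<forall>i\<in>I. D i \<in> B) \<and> is_coproduct C I D X \<iota> \<longrightarrow> X \<in> B)"

definition closed_under_cokernels :: "('o, 'm, 'x) preadd_scheme \<Rightarrow> 'o set \<Rightarrow> bool" where
  "closed_under_cokernels C B \<longleftrightarrow>
     (\<forall>X\<in>B. \<forall>Y\<in>B. \<forall>f\<in>Hom C X Y. \<forall>Q q. is_cokernel C X Y f Q q \<longrightarrow> Q \<in> B)"

text \<open>A morphism of abelian groups carries its domain and codomain, and its underlying map is
  \<open>undefined\<close> outside the domain.\<close>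

definition Ab :: "'u itself \<Rightarrow> ('u monoid, 'u monoid \<times> 'u monoid \<times> ('u \<Rightarrow> 'u)) preadd" where
  "Ab u = \<lparr>
     Obj = {G. comm_group G \<and> small u (carrier G)},
     Hom = (\<lambda>G H. {(G, H, f) | f. f \<in> hom G H \<and> f \<in> extensional (carrier G)}),
     Ident = (\<lambda>G. (G, G, restrict (\<lambda>x. x) (carrier G))),
     Comp = (\<lambda>(H, K, g) (G, _, f). (G, K, compose (carrier G) g f)),
     Add = (\<lambda>(G, H, f) (_, _, g). (G, H, \<lambda>x\<in>carrier G. f x \<otimes>\<^bsub>H\<^esub> g x)),
     Zero = (\<lambda>G H. (G, H, \<lambda>x\<in>carrier G. \<one>\<^bsub>H\<^esub>))\<rparr>"

definition opposite :: "('o, 'm) preadd \<Rightarrow> ('o, 'm) preadd" where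
  "opposite C = C\<lparr>
     Hom := (\<lambda>X Y. Hom C Y X),
     Comp := (\<lambda>g f. Comp C f g),
     Zero := (\<lambda>X Y. Zero C Y X)\<rparr>"

definition is_additive_functor ::
    "('o, 'm, 'x) preadd_scheme \<Rightarrow> ('p, 'n, 'y) preadd_scheme \<Rightarrow> ('o, 'm, 'p, 'n) ftor \<Rightarrow> bool"
  where
  "is_additive_functor C D F \<longleftrightarrow> is_functor C D F \<and>
     (\<forall>X\<in>Obj C. \<forall>Y\<in>Obj C. \<forall>f\<in>Hom C X Y. \<forall>g\<in>Hom C X Y.
        ArrMap F (Add C f g) = Add D (ArrMap F f) (ArrMap F g))"

type_synonym ('o, 'm, 'u) modl = "('o, 'm, 'u monoid, 'u monoid \<times> 'u monoid \<times> ('u \<Rightarrow> 'u)) ftor"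

type_synonym ('o, 'm, 'u) modl_hom =
  "('o, 'm, 'u) modl \<times> ('o, 'm, 'u) modl \<times> ('o \<Rightarrow> 'u monoid \<times> 'u monoid \<times> ('u \<Rightarrow> 'u))"

text \<open>The category of additive functors \<open>C\<^sup>o\<^sup>p \<rightarrow> Ab\<close> and natural transformations.
  Object maps, arrow maps and families of components are \<open>undefined\<close> off their proper domains, so
  that HOL equality is equality of functors and of natural transformations.\<close>

definition module_category ::
    "'u itself \<Rightarrow> ('o, 'm) preadd \<Rightarrow> (('o, 'm, 'u) modl, ('o, 'm, 'u) modl_hom) category" where
  "module_category u C = \<lparr>
     Obj = {F. is_additive_functor (opposite C) (Ab u) F \<and>
               ObjMap F \<in> extensional (Obj C) \<and>
               ArrMap F \<in> extensional (\<Union>X\<in>Obj C. \<Union>Y\<in>Obj C. Hom C X Y)},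
     Hom = (\<lambda>F G. {(F, G, \<eta>) | \<eta>. is_natural (opposite C) (Ab u) F G \<eta> \<and> \<eta> \<in> extensional (Obj C)}),
     Ident = (\<lambda>F. (F, F, \<lambda>X\<in>Obj C. Ident (Ab u) (ObjMap F X))),
     Comp = (\<lambda>(G, H, \<beta>) (F, _, \<alpha>). (F, H, \<lambda>X\<in>Obj C. \<beta> X \<diamondop>\<^bsub>Ab u\<^esub> \<alpha> X))\<rparr>"

text \<open>A ring is regarded as a preadditive category with one object; the modules over it are then
  the right modules over the ring.\<close>

definition ring_category :: "'r ring \<Rightarrow> (unit, 'r) preadd" where
  "ring_category R = \<lparr>
     Obj = {()}, Hom = (\<lambda>_ _. carrier R), Ident = (\<lambda>_. \<one>\<^bsub>R\<^esub>), Comp = mult R,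
     Add = add R, Zero = (\<lambda>_ _. \<zero>\<^bsub>R\<^esub>)\<rparr>"

definition Sum_class :: "'u itself \<Rightarrow> ('o, 'm, 'x) preadd_scheme \<Rightarrow> 'o set \<Rightarrow> 'o set" where
  "Sum_class u A \<U> =
     {X. \<exists>(I :: 'u set) D \<iota>. small u I \<and> (\<forall>i\<in>I. D i \<in> \<U>) \<and> is_coproduct A I D X \<iota>}"

definition Pres_class :: "'u itself \<Rightarrow> ('o, 'm, 'x) preadd_scheme \<Rightarrow> 'o set \<Rightarrow> 'o set" where
  "Pres_class u A \<U> =
     {X. \<exists>S\<in>Sum_class u A \<U>. \<exists>T\<in>Sum_class u A \<U>. \<exists>f\<in>Hom A S T. \<exists>c. is_cokernel A S T f X c}"

text \<open>The canonical map sends a finitely supported family \<open>(\<phi> i)\<close> to the sum of the composites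
  \<open>\<iota> i \<circ> \<phi> i\<close>; \<open>gfinprod\<close> is the (here additively understood) product over the support.\<close>

definition self_small :: "'u itself \<Rightarrow> ('o, 'm, 'x) preadd_scheme \<Rightarrow> 'o set \<Rightarrow> bool" where
  "self_small u A \<U> \<longleftrightarrow>
     (\<forall>(I :: 'u set) D X \<iota>. small u I \<and> (\<forall>i\<in>I. D i \<in> \<U>) \<and> is_coproduct A I D X \<iota> \<longrightarrow>
        (\<forall>U\<in>\<U>. (\<lambda>\<phi>. gfinprod (hom_group A U X) (\<lambda>i. \<iota> i \<diamondop>\<^bsub>A\<^esub> \<phi> i) I)
                  \<in> iso (sum_group I (\<lambda>i. hom_group A U (D i))) (hom_group A U X)))"

definition relative_epi ::
    "('o, 'm, 'x) preadd_scheme \<Rightarrow> 'o set \<Rightarrow> 'o \<Rightarrow> 'o \<Rightarrow> 'm \<Rightarrow> bool" where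
  "relative_epi A \<U> X Y p \<longleftrightarrow> p \<in> Hom A X Y \<and>
     (\<forall>U\<in>\<U>. (\<lambda>f. p \<diamondop>\<^bsub>A\<^esub> f) ` Hom A U X = Hom A U Y)"

definition generated_subobject ::
    "'u itself \<Rightarrow> ('o, 'm, 'x) preadd_scheme \<Rightarrow> 'o set \<Rightarrow> 'o \<Rightarrow> 'o \<Rightarrow> 'm \<Rightarrow> bool" where
  "generated_subobject u A \<U> X T t \<longleftrightarrow> T \<in> Obj A \<and> is_mono A T X t \<and>
     (\<exists>S\<in>Sum_class u A \<U>. \<exists>e. is_epi A S T e)"

definition is_trace ::
    "'u itself \<Rightarrow> ('o, 'm, 'x) preadd_scheme \<Rightarrow> 'o set \<Rightarrow> 'o \<Rightarrow> 'o \<Rightarrow> 'm \<Rightarrow> bool" where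
  "is_trace u A \<U> X T t \<longleftrightarrow> generated_subobject u A \<U> X T t \<and>
     (\<forall>T' t'. generated_subobject u A \<U> X T' t' \<longrightarrow> (\<exists>h\<in>Hom A T' T. t \<diamondop>\<^bsub>A\<^esub> h = t'))"

text \<open>Kernels, traces and quotients are unique up to isomorphism, so the vanishing condition does
  not depend on the chosen representatives \<open>K\<close>, \<open>T\<close> and \<open>Q = K/T\<close>.\<close>

definition trace_condition :: "'u itself \<Rightarrow> ('o, 'm, 'x) preadd_scheme \<Rightarrow> 'o set \<Rightarrow> bool" where
  "trace_condition u A \<U> \<longleftrightarrow>
     (\<forall>S\<in>Sum_class u A \<U>. \<forall>P\<in>Pres_class u A \<U>. \<forall>Y\<in>Obj A. \<forall>m p.
        is_mono A Y P m \<and> is_epi A S Y p \<longrightarrow>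
          relative_epi A \<U> S Y p \<and>
          (\<forall>K k T t Q q.
             is_kernel A S Y p K k \<and> is_trace u A \<U> K T t \<and> is_cokernel A T K t Q q \<longrightarrow>
               (\<forall>U\<in>\<U>. Hom A U Q = {Zero A U Q})))"

definition presenting_set ::
    "'u itself \<Rightarrow> ('o, 'm, 'x) preadd_scheme \<Rightarrow> 'o set \<Rightarrow> 'o set \<Rightarrow> bool" where
  "presenting_set u A B \<U> \<longleftrightarrow>
     \<U> \<subseteq> Obj A \<and> small u \<U> \<and> self_small u A \<U> \<and>
     B = Pres_class u A \<U> \<and> trace_condition u A \<U>"

end

theory Submission
  imports Defs
begin

text \<open>The representable modules have two properties that only refer to the category structure of
  \<open>Mod C\<close>: they detect isomorphisms, and a morphism \<open>x\<close> from one of them to \<open>X\<close> factors through a member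
  of a directed family \<open>W\<close> of morphisms to \<open>X\<close> as soon as any two morphisms that agree on \<open>W\<close> agree on
  \<open>x\<close> (pass to the quotient of \<open>X\<close> by the union of the images). An equivalence carries both
  properties to a set \<open>\<U>\<close> of objects of \<open>B\<close>. Since \<open>B\<close> is coreflective, it is closed under the colimits of
  \<open>A\<close>, and the two properties, applied to finite subcoproducts, to epimorphisms onto subobjects and
  to cokernels, show that \<open>\<U>\<close> is self-small, satisfies (b) and presents \<open>B\<close>.

  Conversely, self-smallness says that \<open>Hom(U, -)\<close> turns sums of objects of \<open>\<U>\<close> into direct sums, and (b)
  that it is exact on presentations. Hence, for \<open>P\<close> presented by \<open>\<U>\<close> and any \<open>X\<close> in \<open>A\<close>, natural maps
  \<open>Hom(-, P) \<rightarrow> Hom(-, X)\<close> over \<open>\<U>\<close> come from unique morphisms \<open>P \<rightarrow> X\<close>, and a presentation of a module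
  by representables lifts to a presentation in \<open>A\<close>, so that every module is \<open>Hom(-, P)\<close> for some such \<open>P\<close>. This
  gives the equivalence, and the coreflection of \<open>X\<close> is the \<open>P\<close> with \<open>Hom(-, P) \<cong> Hom(-, X)\<close>.\<close>

subsection \<open>Small sets\<close>

text \<open>Two obstacles shape the passage from modules to (b).
  \<open>equivalent_categories\<close> speaks of bare functors, so nothing about addition is carried
  along an equivalence directly. The two transported properties are therefore phrased with
  composition alone, and the condition that \<open>x\<close> lands in the union of the images of
  \<open>W\<close> becomes a test against pairs of parallel morphisms out of \<open>X\<close>.
  Secondly, the object \<open>Y\<close> in (b) is a subobject in the ambient category that may lie
  outside \<open>B\<close>, where the equivalence says nothing. The test only involves morphisms out
  of the presented object \<open>P\<close>, which does lie in \<open>B\<close>; the embedding of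
  \<open>Y\<close> into \<open>P\<close> is cancelled afterwards in the ambient category. A third
  difficulty is one of types: modules take values in groups on \<open>'u\<close>, whereas hom groups
  and quotients live elsewhere, so every module is built from small groups of arbitrary type and
  then encoded.\<close>

lemma small_imp_inj:
  assumes "small TYPE('u) X"
  obtains f :: "'a \<Rightarrow> 'u" where "inj_on f X"
  using assms unfolding small_def
  by (meson card_of_ordLeq ordLess_imp_ordLeq)

lemma small_image:
  assumes "small TYPE('u) X"
  shows "small TYPE('u) (f ` X)"
  using assms unfolding small_def
  by (meson card_of_image ordLeq_ordLess_trans)

lemma small_subset:
  assumes "small TYPE('u) X" "Y \<subseteq> X"
  shows "small TYPE('u) Y"
  using assms unfolding small_def
  by (meson card_of_mono1 ordLeq_ordLess_trans)

context
  assumes univ: "universe TYPE('u)"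
begin

lemma universe_infinite: "infinite (UNIV :: 'u set)"
  using univ unfolding universe_def by (metis countable_finite)

lemma small_finite:
  assumes "finite X"
  shows "small TYPE('u) X"
  unfolding small_def
  using assms universe_infinite by (simp add: finite_ordLess_infinite2)

text \<open>Regularity of the cardinal of \<open>'u\<close> makes it stable under small unions of
  small sets. The sums over all morphisms or all elements used below get their size bound from
  this.\<close>

lemma small_UN:
  assumes "small TYPE('u) I" "\<And>i. i \<in> I \<Longrightarrow> small TYPE('u) (F i)"
  shows "small TYPE('u) (\<Union>i\<in>I. F i)"
proof -
  have "stable |UNIV :: 'u set|"
    using univ universe_infinite unfolding universe_def
    by (intro regularCard_stable) (auto simp: Field_card_of)
  then show ?thesis
    using assms unfolding small_def by (intro stable_UNION) auto
qed

lemma small_Sigma: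
  assumes "small TYPE('u) I" "\<And>i. i \<in> I \<Longrightarrow> small TYPE('u) (F i)"
  shows "small TYPE('u) (Sigma I F)"
proof -
  have "Sigma I F = (\<Union>i\<in>I. Pair i ` F i)" by auto
  then show ?thesis using small_UN[OF assms(1), of "\<lambda>i. Pair i ` F i"] assms(2) small_image by metis
qed

end

text \<open>\<open>Sum_class\<close>, \<open>self_small\<close> and \<open>cocomplete\<close> only
  know index sets inside \<open>'u\<close>, whereas the natural index sets below consist of pairs,
  such as an object with a morphism; those are reindexed here.\<close>

lemma small_index:
  assumes "small TYPE('u) J"
  obtains I :: "'u set" and e where "small TYPE('u) I" "bij_betw e I J"
proof -
  obtain f :: "_ \<Rightarrow> 'u" where f: "inj_on f J" using small_imp_inj[OF assms] .
  show thesis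
  proof
    show "small TYPE('u) (f ` J)" by (rule small_image[OF assms])
    show "bij_betw (inv_into J f) (f ` J) J"
      using f by (simp add: bij_betw_inv_into inj_on_imp_bij_betw)
  qed
qed

subsection \<open>Transport of abelian groups\<close>

text \<open>The operation is read back through \<open>inv_into\<close>, so it matches that of
  \<open>G\<close> only for \<open>e\<close> injective on the carrier.\<close>

definition transport_group :: "('a \<Rightarrow> 'b) \<Rightarrow> 'a monoid \<Rightarrow> 'b monoid" where
  "transport_group e G = \<lparr>carrier = e ` carrier G,
     mult = (\<lambda>x y. e (inv_into (carrier G) e x \<otimes>\<^bsub>G\<^esub> inv_into (carrier G) e y)), one = e \<one>\<^bsub>G\<^esub>\<rparr>"

lemma carrier_transport_group [simp]: "carrier (transport_group e G) = e ` carrier G"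
  by (simp add: transport_group_def)

lemma
  assumes "comm_group G" "inj_on e (carrier G)"
  shows mult_transport_group: "\<lbrakk>x \<in> carrier G; y \<in> carrier G\<rbrakk> \<Longrightarrow>
            e x \<otimes>\<^bsub>transport_group e G\<^esub> e y = e (x \<otimes>\<^bsub>G\<^esub> y)"
    and one_transport_group: "\<one>\<^bsub>transport_group e G\<^esub> = e \<one>\<^bsub>G\<^esub>"
  using assms by (simp_all add: transport_group_def)

lemma comm_group_transport_group:
  assumes G: "comm_group G" and e: "inj_on e (carrier G)"
  shows "comm_group (transport_group e G)"
proof -
  interpret G: comm_group G by fact
  note m = mult_transport_group[OF assms] one_transport_group[OF assms]
  show ?thesis
  proof (rule comm_groupI)
    fix x assume "x \<in> carrier (transport_group e G)"
    then obtain a where a: "a \<in> carrier G" "x = e a" by auto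
    show "\<exists>y\<in>carrier (transport_group e G). y \<otimes>\<^bsub>transport_group e G\<^esub> x = \<one>\<^bsub>transport_group e G\<^esub>"
      using a by (intro bexI[of _ "e (inv\<^bsub>G\<^esub> a)"]) (auto simp: m)
  qed (auto simp: m G.m_ac)
qed

subsection \<open>Categories and abelian categories\<close>

text \<open>The axioms constrain \<open>Hom\<close> only between objects, so bare membership in
  \<open>Hom\<close> carries no typing. Bundling it with both objects lets composites be typed by
  chaining single facts.\<close>

definition arr :: "('o, 'm, 'x) category_scheme \<Rightarrow> 'o \<Rightarrow> 'o \<Rightarrow> 'm \<Rightarrow> bool" where
  "arr C X Y f \<longleftrightarrow> X \<in> Obj C \<and> Y \<in> Obj C \<and> f \<in> Hom C X Y"

lemma arrI: "\<lbrakk>X \<in> Obj C; Y \<in> Obj C; f \<in> Hom C X Y\<rbrakk> \<Longrightarrow> arr C X Y f"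
  by (simp add: arr_def)

lemma arrD: "arr C X Y f \<Longrightarrow> X \<in> Obj C" "arr C X Y f \<Longrightarrow> Y \<in> Obj C" "arr C X Y f \<Longrightarrow> f \<in> Hom C X Y"
  by (simp_all add: arr_def)

context category
begin

lemma arr_Ident [simp, intro]: "X \<in> Obj C \<Longrightarrow> arr C X X (Ident C X)"
  by (simp add: arr_def Ident_in_Hom)

lemma arr_comp [intro]: "\<lbrakk>arr C X Y f; arr C Y Z g\<rbrakk> \<Longrightarrow> arr C X Z (g \<diamondop> f)"
  by (auto simp: arr_def comp_in_Hom)

lemma assoc: "\<lbrakk>arr C W X f; arr C X Y g; arr C Y Z h\<rbrakk> \<Longrightarrow> (h \<diamondop> g) \<diamondop> f = h \<diamondop> (g \<diamondop> f)"
  by (auto simp: arr_def comp_assoc)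

lemma comp_id [simp]: "arr C X Y f \<Longrightarrow> f \<diamondop> Ident C X = f"
  by (auto simp: arr_def comp_Ident)

lemma id_comp [simp]: "arr C X Y f \<Longrightarrow> Ident C Y \<diamondop> f = f"
  by (auto simp: arr_def Ident_comp)

lemma arr_unique: "\<lbrakk>arr C X Y f; arr C X' Y' f\<rbrakk> \<Longrightarrow> X = X' \<and> Y = Y'"
  unfolding arr_def using Hom_disjoint by blast

lemma monoD: "\<lbrakk>is_mono C X Y m; arr C W X g; arr C W X h; m \<diamondop> g = m \<diamondop> h\<rbrakk> \<Longrightarrow> g = h"
  unfolding is_mono_def arr_def by blast

lemma epiD: "\<lbrakk>is_epi C X Y p; arr C Y Z g; arr C Y Z h; g \<diamondop> p = h \<diamondop> p\<rbrakk> \<Longrightarrow> g = h"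
  unfolding is_epi_def arr_def by blast

lemma isomorphismE:
  assumes "is_isomorphism C X Y f" "X \<in> Obj C" "Y \<in> Obj C"
  obtains g where "arr C X Y f" "arr C Y X g" "g \<diamondop> f = Ident C X" "f \<diamondop> g = Ident C Y"
  using assms unfolding is_isomorphism_def arr_def by blast

lemma isomorphismI:
  assumes "arr C X Y f" "arr C Y X g" "g \<diamondop> f = Ident C X" "f \<diamondop> g = Ident C Y"
  shows "is_isomorphism C X Y f"
  using assms unfolding is_isomorphism_def arr_def by blast

lemma coproduct_arr:
  assumes "is_coproduct C I D X \<iota>" "i \<in> I" "D i \<in> Obj C"
  shows "arr C (D i) X (\<iota> i)"
  using assms unfolding is_coproduct_def arr_def by auto

lemma coproduct_Obj: "is_coproduct C I D X \<iota> \<Longrightarrow> X \<in> Obj C"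
  unfolding is_coproduct_def by auto

lemma coproduct_ex1:
  assumes "is_coproduct C I D X \<iota>" "Y \<in> Obj C" "\<And>i. i \<in> I \<Longrightarrow> f i \<in> Hom C (D i) Y"
  shows "\<exists>!h. h \<in> Hom C X Y \<and> (\<forall>i\<in>I. h \<diamondop> \<iota> i = f i)"
  using assms unfolding is_coproduct_def by simp

lemma coproduct_desc:
  assumes "is_coproduct C I D X \<iota>" "Y \<in> Obj C" "\<And>i. i \<in> I \<Longrightarrow> arr C (D i) Y (f i)"
  obtains h where "arr C X Y h" "\<And>i. i \<in> I \<Longrightarrow> h \<diamondop> \<iota> i = f i"
  using assms unfolding is_coproduct_def arr_def by blast

lemma coproduct_ext:
  assumes "is_coproduct C I D X \<iota>" "arr C X Y g" "arr C X Y h" "\<And>i. i \<in> I \<Longrightarrow> D i \<in> Obj C"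
    "\<And>i. i \<in> I \<Longrightarrow> g \<diamondop> \<iota> i = h \<diamondop> \<iota> i"
  shows "g = h"
proof -
  have "\<forall>i\<in>I. g \<diamondop> \<iota> i \<in> Hom C (D i) Y"
    using assms(2,4) coproduct_arr[OF assms(1)] by (meson arrD(3) arr_comp)
  then have "\<exists>!k. k \<in> Hom C X Y \<and> (\<forall>i\<in>I. k \<diamondop> \<iota> i = g \<diamondop> \<iota> i)"
    using coproduct_ex1[OF assms(1) arrD(2)[OF assms(2)], of "\<lambda>i. g \<diamondop> \<iota> i"] by blast
  then show ?thesis using assms(2,3,5) by (metis arrD(3))
qed

lemma coproduct_singleton:
  assumes "X \<in> Obj C"
  shows "is_coproduct C {i} (\<lambda>_. X) X (\<lambda>_. Ident C X)"
  unfolding is_coproduct_def using assms comp_Ident by (auto simp: Ident_in_Hom)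

lemma coproduct_reindex:
  assumes cp: "is_coproduct C I (D \<circ> e) X \<iota>" and e: "bij_betw e I J" and D: "\<And>j. j \<in> J \<Longrightarrow> D j \<in> Obj C"
  shows "is_coproduct C J D X (\<iota> \<circ> inv_into I e)"
  unfolding is_coproduct_def
proof (intro conjI ballI allI impI)
  show "X \<in> Obj C" using cp by (rule coproduct_Obj)
  let ?e = "inv_into I e"
  have e': "?e j \<in> I" "e (?e j) = j" if "j \<in> J" for j
    using that e by (metis bij_betw_def inv_into_into, metis bij_betw_inv_into_right)
  have e'': "?e (e i) = i" "e i \<in> J" if "i \<in> I" for i
    using that e by (metis bij_betw_inv_into_left, metis bij_betwE)
  show \<iota>: "(\<iota> \<circ> ?e) j \<in> Hom C (D j) X" if "j \<in> J" for j
    using cp e'[OF that] unfolding is_coproduct_def by fastforce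
  fix Y f assume Y: "Y \<in> Obj C" and f: "\<forall>j\<in>J. f j \<in> Hom C (D j) Y"
  have "\<exists>!h. h \<in> Hom C X Y \<and> (\<forall>i\<in>I. h \<diamondop> \<iota> i = f (e i))"
  proof -
    show ?thesis using coproduct_ex1[OF cp Y, of "f \<circ> e"] f e'' by simp
  qed
  moreover have "(\<forall>i\<in>I. h \<diamondop> \<iota> i = f (e i)) \<longleftrightarrow> (\<forall>j\<in>J. h \<diamondop> (\<iota> \<circ> ?e) j = f j)" for h
    using e' e'' by (metis comp_apply)
  ultimately show "\<exists>!h. h \<in> Hom C X Y \<and> (\<forall>j\<in>J. h \<diamondop> (\<iota> \<circ> ?e) j = f j)" by simp
qed

end

section \<open>Small coproducts from small colimits\<close>

lemma (in category) ex_small_coproduct: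
  assumes univ: "universe TYPE('u)" and cc: "cocomplete TYPE('u) C"
    and I: "small TYPE('u) (I :: 'u set)" and D: "\<And>i. i \<in> I \<Longrightarrow> D i \<in> Obj C"
  shows "\<exists>X \<iota>. is_coproduct C I D X \<iota>"
proof -
  \<comment> \<open>A coproduct is a colimit over the discrete category on \<open>I\<close>. Objects
    and arrows must both have type \<open>'u\<close>, so \<open>i\<close> also serves as its own
    identity arrow.\<close>
  define J :: "('u, 'u) category" where
    "J = \<lparr>Obj = I, Hom = (\<lambda>i j. if i = j then {i} else {}), Ident = (\<lambda>i. i), Comp = (\<lambda>g f. f)\<rparr>"
  have J: "category J"
    by unfold_locales (auto simp: J_def split: if_splits)
  have "small TYPE('u) (Hom J i j)" for i j
    using small_finite[OF univ, of "Hom J i j"] by (simp add: J_def)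
  then have sJ: "small_category TYPE('u) J"
    using J I unfolding small_category_def locally_small_def by (simp add: J_def)
  define F where "F = \<lparr>ObjMap = D, ArrMap = (\<lambda>i. Ident C (D i))\<rparr>"
  have F: "is_functor J C F"
    unfolding is_functor_def using D Ident_in_Hom comp_Ident[OF _ _ Ident_in_Hom]
    by (auto simp: J_def F_def split: if_splits)
  obtain X \<iota> where X: "is_colimit J C F X \<iota>"
    using cc sJ F unfolding cocomplete_def by blast
  have co: "is_cocone J C F Y \<gamma> \<longleftrightarrow> Y \<in> Obj C \<and> (\<forall>i\<in>I. \<gamma> i \<in> Hom C (D i) Y)" for Y \<gamma>
    unfolding is_cocone_def using D comp_Ident by (auto simp: J_def F_def split: if_splits)
  have "is_coproduct C I D X \<iota>"
    unfolding is_coproduct_def using X unfolding is_colimit_def co by (simp add: J_def)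
  then show ?thesis by blast
qed

lemma (in category) ex_coproduct:
  assumes univ: "universe TYPE('u)" and cc: "cocomplete TYPE('u) C"
    and J: "small TYPE('u) J" and D: "\<And>j. j \<in> J \<Longrightarrow> D j \<in> Obj C"
  shows "\<exists>X \<iota>. is_coproduct C J D X \<iota>"
proof -
  obtain I :: "'u set" and e where I: "small TYPE('u) I" and e: "bij_betw e I J"
    using small_index[OF J] .
  have "(D \<circ> e) i \<in> Obj C" if "i \<in> I" for i using D bij_betwE[OF e] that by simp
  then obtain X \<iota> where X: "is_coproduct C I (D \<circ> e) X \<iota>"
    using ex_small_coproduct[OF univ cc I, of "D \<circ> e"] by blast
  then show ?thesis using coproduct_reindex[OF X e D] by blast
qed

text \<open>Hom groups are written multiplicatively, so this is the difference \<open>f - g\<close>.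
  The inverse depends on the group, hence on \<open>X\<close> and \<open>Y\<close>, unlike
  \<open>Add\<close>.\<close>

definition Sub :: "('o, 'm, 'x) preadd_scheme \<Rightarrow> 'o \<Rightarrow> 'o \<Rightarrow> 'm \<Rightarrow> 'm \<Rightarrow> 'm" where
  "Sub C X Y f g = f \<otimes>\<^bsub>hom_group C X Y\<^esub> inv\<^bsub>hom_group C X Y\<^esub> g"

lemma hom_group_simps [simp]:
  "carrier (hom_group C X Y) = Hom C X Y" "mult (hom_group C X Y) = Add C"
  "one (hom_group C X Y) = Zero C X Y"
  by (simp_all add: hom_group_def)

section \<open>Preadditive categories: differences, kernels, cokernels\<close>

context preadditive_category
begin

lemma arr_Zero [simp, intro]: "\<lbrakk>X \<in> Obj C; Y \<in> Obj C\<rbrakk> \<Longrightarrow> arr C X Y (Zero C X Y)"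
  using comm_group.axioms(2)[OF hom_comm_group, THEN group.is_monoid, THEN monoid.one_closed] by (simp add: arr_def)

lemma arr_Add: "\<lbrakk>arr C X Y f; arr C X Y g\<rbrakk> \<Longrightarrow> arr C X Y (Add C f g)"
  using comm_group.axioms(2)[OF hom_comm_group, THEN group.is_monoid, THEN monoid.m_closed] by (simp add: arr_def)

lemma comp_Add':
  "\<lbrakk>arr C X Y f; arr C X Y f'; arr C Y Z g\<rbrakk> \<Longrightarrow> g \<diamondop> Add C f f' = Add C (g \<diamondop> f) (g \<diamondop> f')"
  using comp_Add[of X Y Z f f' g] by (simp add: arr_def)

lemma Add_comp':
  "\<lbrakk>arr C X Y f; arr C Y Z g; arr C Y Z g'\<rbrakk> \<Longrightarrow> Add C g g' \<diamondop> f = Add C (g \<diamondop> f) (g' \<diamondop> f)"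
  using Add_comp[of X Y Z f g g'] by (simp add: arr_def)

lemma comp_hom: "\<lbrakk>arr C Y Z h; X \<in> Obj C\<rbrakk> \<Longrightarrow> (\<lambda>f. h \<diamondop> f) \<in> hom (hom_group C X Y) (hom_group C X Z)"
  by (auto simp: hom_def arr_def comp_in_Hom comp_Add)

lemma hom_comp: "\<lbrakk>arr C W X h; Y \<in> Obj C\<rbrakk> \<Longrightarrow> (\<lambda>f. f \<diamondop> h) \<in> hom (hom_group C X Y) (hom_group C W Y)"
  by (auto simp: hom_def arr_def comp_in_Hom Add_comp)

lemma comp_group_hom:
  "\<lbrakk>arr C Y Z h; X \<in> Obj C\<rbrakk> \<Longrightarrow> group_hom (hom_group C X Y) (hom_group C X Z) (\<lambda>f. h \<diamondop> f)"
  by (intro group_hom.intro group_hom_axioms.intro comp_hom comm_group.axioms(2) hom_comm_group)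
    (auto dest: arrD)

lemma group_hom_comp:
  "\<lbrakk>arr C W X h; Y \<in> Obj C\<rbrakk> \<Longrightarrow> group_hom (hom_group C X Y) (hom_group C W Y) (\<lambda>f. f \<diamondop> h)"
  by (intro group_hom.intro group_hom_axioms.intro hom_comp comm_group.axioms(2) hom_comm_group)
    (auto dest: arrD)

lemma comp_Zero [simp]: "\<lbrakk>arr C Y Z h; X \<in> Obj C\<rbrakk> \<Longrightarrow> h \<diamondop> Zero C X Y = Zero C X Z"
  using group_hom.hom_one[OF comp_group_hom] by simp

lemma Zero_comp [simp]: "\<lbrakk>arr C W X h; Y \<in> Obj C\<rbrakk> \<Longrightarrow> Zero C X Y \<diamondop> h = Zero C W Y"
  using group_hom.hom_one[OF group_hom_comp] by simp

lemma arr_Sub: "\<lbrakk>arr C X Y f; arr C X Y g\<rbrakk> \<Longrightarrow> arr C X Y (Sub C X Y f g)"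
  unfolding Sub_def arr_def
  using comm_group.axioms(2)[OF hom_comm_group]
  by (metis group.inv_closed group.is_monoid hom_group_simps(1) monoid.m_closed)

lemma Sub_eq_Zero_iff: "\<lbrakk>arr C X Y f; arr C X Y g\<rbrakk> \<Longrightarrow> Sub C X Y f g = Zero C X Y \<longleftrightarrow> f = g"
  unfolding Sub_def arr_def
  using comm_group.axioms(2)[OF hom_comm_group, of X Y]
  by (metis group.inv_equality group.inv_inv group.r_inv group.inv_closed hom_group_simps(1,3))

lemma Add_Sub: "\<lbrakk>arr C X Y f; arr C X Y g\<rbrakk> \<Longrightarrow> Add C (Sub C X Y f g) g = f"
proof -
  assume f: "arr C X Y f" "arr C X Y g"
  then interpret comm_group "hom_group C X Y" by (auto dest: arrD intro: hom_comm_group)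
  show ?thesis using f inv_solve_right' m_assoc unfolding Sub_def arr_def
    by (metis hom_group_simps(1,2) inv_closed l_inv r_one)
qed

lemma comp_Sub:
  "\<lbrakk>arr C X Y f; arr C X Y g; arr C Y Z h\<rbrakk> \<Longrightarrow> h \<diamondop> Sub C X Y f g = Sub C X Z (h \<diamondop> f) (h \<diamondop> g)"
  unfolding Sub_def
  using comp_group_hom[of Y Z h X] group_hom.hom_mult group_hom.hom_inv
  by (smt (verit) arr_def group.inv_closed group_hom.axioms(1) hom_group_simps(1))

lemma Sub_comp:
  "\<lbrakk>arr C X Y f; arr C X Y g; arr C W X h\<rbrakk> \<Longrightarrow> Sub C X Y f g \<diamondop> h = Sub C W Y (f \<diamondop> h) (g \<diamondop> h)"
  unfolding Sub_def
  using group_hom_comp[of W X h Y] group_hom.hom_mult group_hom.hom_inv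
  by (smt (verit) arr_def group.inv_closed group_hom.axioms(1) hom_group_simps(1))

text \<open>Two morphisms with equal composites differ by one that \<open>m\<close> kills, so
  cancelling zero suffices; \<open>epiI\<close> is the dual.\<close>

lemma monoI:
  assumes m: "arr C X Y m" and "\<And>W g. \<lbrakk>arr C W X g; m \<diamondop> g = Zero C W Y\<rbrakk> \<Longrightarrow> g = Zero C W X"
  shows "is_mono C X Y m"
  unfolding is_mono_def
proof (intro conjI ballI impI)
  show "m \<in> Hom C X Y" using m by (rule arrD)
  fix W g h assume "W \<in> Obj C" "g \<in> Hom C W X" "h \<in> Hom C W X" and eq: "m \<diamondop> g = m \<diamondop> h"
  then have gh: "arr C W X g" "arr C W X h" using m by (auto simp: arr_def)
  then have "m \<diamondop> Sub C W X g h = Zero C W Y"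
    using m eq by (metis Sub_eq_Zero_iff comp_Sub arr_comp)
  then show "g = h" using assms(2) gh arr_Sub Sub_eq_Zero_iff by metis
qed

lemma epiI:
  assumes p: "arr C X Y p" and "\<And>Z g. \<lbrakk>arr C Y Z g; g \<diamondop> p = Zero C X Z\<rbrakk> \<Longrightarrow> g = Zero C Y Z"
  shows "is_epi C X Y p"
  unfolding is_epi_def
proof (intro conjI ballI impI)
  show "p \<in> Hom C X Y" using p by (rule arrD)
  fix Z g h assume "Z \<in> Obj C" "g \<in> Hom C Y Z" "h \<in> Hom C Y Z" and eq: "g \<diamondop> p = h \<diamondop> p"
  then have gh: "arr C Y Z g" "arr C Y Z h" using p by (auto simp: arr_def)
  then have "Sub C Y Z g h \<diamondop> p = Zero C X Z"
    using p eq by (metis Sub_eq_Zero_iff Sub_comp arr_comp)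
  then show "g = h" using assms(2) gh arr_Sub Sub_eq_Zero_iff by metis
qed

lemma kernelD:
  assumes "is_kernel C X Y f K k" "arr C X Y f"
  shows "arr C K X k" "f \<diamondop> k = Zero C K Y"
  using assms unfolding is_kernel_def arr_def by auto

lemma kernel_lift:
  assumes "is_kernel C X Y f K k" "arr C W X g" "f \<diamondop> g = Zero C W Y"
  obtains h where "arr C W K h" "k \<diamondop> h = g"
  using assms unfolding is_kernel_def arr_def by blast

lemma kernel_mono:
  assumes "is_kernel C X Y f K k" "arr C X Y f"
  shows "is_mono C K X k"
proof (rule monoI)
  show k: "arr C K X k" using kernelD assms by blast
  fix W g assume g: "arr C W K g" "k \<diamondop> g = Zero C W X"
  then have obj: "W \<in> Obj C" "K \<in> Obj C" "X \<in> Obj C" using k by (auto dest: arrD)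
  then have "k \<diamondop> Zero C W K = Zero C W X" "f \<diamondop> Zero C W X = Zero C W Y" using k assms by auto
  then have "\<exists>!h. h \<in> Hom C W K \<and> k \<diamondop> h = Zero C W X"
    using assms(1) arr_Zero obj unfolding is_kernel_def arr_def by metis
  then show "g = Zero C W K" using g \<open>k \<diamondop> Zero C W K = _\<close> obj by (metis arrD(3) arr_Zero)
qed

lemma kernelI:
  assumes "arr C X Y f" "is_mono C K X k" "K \<in> Obj C" "f \<diamondop> k = Zero C K Y"
    "\<And>W g. \<lbrakk>arr C W X g; f \<diamondop> g = Zero C W Y\<rbrakk> \<Longrightarrow> \<exists>h. arr C W K h \<and> k \<diamondop> h = g"
  shows "is_kernel C X Y f K k"
proof -
  have "\<exists>!h. h \<in> Hom C W K \<and> k \<diamondop> h = g"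
    if "W \<in> Obj C" "g \<in> Hom C W X" "f \<diamondop> g = Zero C W Y" for W g
    using assms that unfolding arr_def is_mono_def by metis
  then show ?thesis using assms unfolding is_kernel_def is_mono_def by blast
qed

lemma cokernelD:
  assumes "is_cokernel C X Y f Q q" "arr C X Y f"
  shows "arr C Y Q q" "q \<diamondop> f = Zero C X Q"
  using assms unfolding is_cokernel_def arr_def by auto

lemma cokernel_desc:
  assumes "is_cokernel C X Y f Q q" "arr C Y W g" "g \<diamondop> f = Zero C X W"
  obtains h where "arr C Q W h" "h \<diamondop> q = g"
  using assms unfolding is_cokernel_def arr_def by blast

lemma cokernel_epi:
  assumes "is_cokernel C X Y f Q q" "arr C X Y f"
  shows "is_epi C Y Q q"
proof (rule epiI)
  show q: "arr C Y Q q" using cokernelD assms by blast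
  fix W g assume g: "arr C Q W g" "g \<diamondop> q = Zero C Y W"
  then have obj: "W \<in> Obj C" "Q \<in> Obj C" "Y \<in> Obj C" using q by (auto dest: arrD)
  then have "Zero C Q W \<diamondop> q = Zero C Y W" "Zero C Y W \<diamondop> f = Zero C X W" using q assms by auto
  then have "\<exists>!h. h \<in> Hom C Q W \<and> h \<diamondop> q = Zero C Y W"
    using assms(1) arr_Zero obj unfolding is_cokernel_def arr_def by metis
  then show "g = Zero C Q W" using g \<open>Zero C Q W \<diamondop> q = _\<close> obj by (metis arrD(3) arr_Zero)
qed

lemma cokernelI:
  assumes "arr C X Y f" "is_epi C Y Q q" "Q \<in> Obj C" "q \<diamondop> f = Zero C X Q"
    "\<And>W g. \<lbrakk>arr C Y W g; g \<diamondop> f = Zero C X W\<rbrakk> \<Longrightarrow> \<exists>h. arr C Q W h \<and> h \<diamondop> q = g"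
  shows "is_cokernel C X Y f Q q"
proof -
  have "\<exists>!h. h \<in> Hom C Q W \<and> h \<diamondop> q = g"
    if "W \<in> Obj C" "g \<in> Hom C Y W" "g \<diamondop> f = Zero C X W" for W g
    using assms that unfolding arr_def is_epi_def by metis
  then show ?thesis using assms unfolding is_cokernel_def is_epi_def by blast
qed

lemma epi_arr: "\<lbrakk>is_epi C X Y p; X \<in> Obj C; Y \<in> Obj C\<rbrakk> \<Longrightarrow> arr C X Y p"
  by (simp add: is_epi_def arr_def)

lemma mono_arr: "\<lbrakk>is_mono C X Y p; X \<in> Obj C; Y \<in> Obj C\<rbrakk> \<Longrightarrow> arr C X Y p"
  by (simp add: is_mono_def arr_def)

lemma coproduct_proj:
  assumes cp: "is_coproduct C I D X \<iota>" and D: "\<And>i. i \<in> I \<Longrightarrow> D i \<in> Obj C" and i: "i \<in> I"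
  obtains \<pi> where "arr C X (D i) \<pi>" "\<pi> \<diamondop> \<iota> i = Ident C (D i)"
    "\<And>j. \<lbrakk>j \<in> I; j \<noteq> i\<rbrakk> \<Longrightarrow> \<pi> \<diamondop> \<iota> j = Zero C (D j) (D i)"
proof -
  let ?f = "\<lambda>j. if j = i then Ident C (D i) else Zero C (D j) (D i)"
  have f: "arr C (D j) (D i) (?f j)" if "j \<in> I" for j using D i that by auto
  obtain \<pi> where "arr C X (D i) \<pi>" "\<And>j. j \<in> I \<Longrightarrow> \<pi> \<diamondop> \<iota> j = ?f j"
    using coproduct_desc[OF cp D[OF i] f] by blast
  then show thesis using that i by metis
qed

end

section \<open>Abelian categories: canonical kernels, images, quotients of subobjects\<close>

context abelian_category
begin

text \<open>\<open>m\<close> is the kernel of some \<open>g\<close>. As \<open>g\<close> kills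
  \<open>m\<close>, it factors through \<open>q\<close>; so whatever \<open>q\<close> kills is
  killed by \<open>g\<close> and factors through \<open>m\<close>.\<close>

lemma mono_is_kernel_of_cokernel:
  assumes m: "is_mono C X Y m" "X \<in> Obj C" "Y \<in> Obj C" and q: "is_cokernel C X Y m Q q"
  shows "is_kernel C Y Q q X m"
proof -
  have ma: "arr C X Y m" using m by (rule mono_arr)
  obtain Z g where g: "arr C Y Z g" "is_kernel C Y Z g X m"
    using mono_is_kernel[OF m(2,3,1)] m(3) unfolding arr_def by blast
  obtain h where h: "arr C Q Z h" "h \<diamondop> q = g"
    using cokernel_desc[OF q g(1)] kernelD[OF g(2,1)] by blast
  note qa = cokernelD[OF q ma]
  show ?thesis
  proof (rule kernelI[OF qa(1) m(1,2) qa(2)])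
    fix W a assume a: "arr C W Y a" "q \<diamondop> a = Zero C W Q"
    then have "g \<diamondop> a = Zero C W Z"
      using h qa(1) assoc[OF a(1) qa(1) h(1)] by (auto dest: arrD)
    then show "\<exists>h. arr C W X h \<and> m \<diamondop> h = a" using kernel_lift[OF g(2) a(1)] by blast
  qed
qed

lemma epi_is_cokernel_of_kernel:
  assumes p: "is_epi C X Y p" "X \<in> Obj C" "Y \<in> Obj C" and k: "is_kernel C X Y p K k"
  shows "is_cokernel C K X k Y p"
proof -
  have pa: "arr C X Y p" using p by (rule epi_arr)
  obtain Z g where g: "arr C Z X g" "is_cokernel C Z X g Y p"
    using epi_is_cokernel[OF p(2,3,1)] p(2) unfolding arr_def by blast
  obtain h where h: "arr C Z K h" "k \<diamondop> h = g"
    using kernel_lift[OF k g(1)] cokernelD[OF g(2,1)] by blast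
  note ka = kernelD[OF k pa]
  show ?thesis
  proof (rule cokernelI[OF ka(1) p(1,3) ka(2)])
    fix W a assume a: "arr C X W a" "a \<diamondop> k = Zero C K W"
    then have "a \<diamondop> g = Zero C Z W"
      using h ka(1) assoc[OF h(1) ka(1) a(1)] by (auto dest: arrD)
    then show "\<exists>h. arr C Y W h \<and> h \<diamondop> p = a" using cokernel_desc[OF g(2) a(1)] by blast
  qed
qed

text \<open>\<open>m\<close> is the kernel of the cokernel of \<open>f\<close>. If \<open>g\<close>
  kills \<open>e\<close>, then \<open>f\<close> factors through the smaller subobject
  \<open>m \<diamondop> l\<close>, where \<open>l\<close> is the kernel of \<open>g\<close>. That
  subobject is itself the kernel of some \<open>z\<close>; as \<open>z\<close> kills
  \<open>f\<close>, it factors through the cokernel of \<open>f\<close> and so kills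
  \<open>m\<close>. Hence the smaller subobject is everything and \<open>g\<close> is zero.\<close>

lemma image_factorization:
  assumes f: "arr C X Y f"
  obtains I e m where "I \<in> Obj C" "is_epi C X I e" "is_mono C I Y m" "m \<diamondop> e = f"
proof -
  obtain Q q where q: "is_cokernel C X Y f Q q" using ex_cokernel f unfolding arr_def by blast
  note qa = cokernelD[OF q f]
  obtain I m where m: "is_kernel C Y Q q I m" using ex_kernel qa(1) unfolding arr_def by blast
  note ma = kernelD[OF m qa(1)] and mm = kernel_mono[OF m qa(1)]
  obtain e where e: "arr C X I e" "m \<diamondop> e = f" using kernel_lift[OF m f qa(2)] .
  have "is_epi C X I e"
  proof (rule epiI[OF e(1)])
    fix Z g assume g: "arr C I Z g" "g \<diamondop> e = Zero C X Z"
    obtain L l where l: "is_kernel C I Z g L l" using ex_kernel g(1) unfolding arr_def by blast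
    note la = kernelD[OF l g(1)] and lm = kernel_mono[OF l g(1)]
    obtain e' where e': "arr C X L e'" "l \<diamondop> e' = e" using kernel_lift[OF l e(1) g(2)] .
    have ml: "arr C L Y (m \<diamondop> l)" using la ma by auto
    have "is_mono C L Y (m \<diamondop> l)"
    proof (rule monoI[OF ml])
      fix W a assume a: "arr C W L a" "(m \<diamondop> l) \<diamondop> a = Zero C W Y"
      have W: "W \<in> Obj C" "L \<in> Obj C" "I \<in> Obj C" using a la by (auto dest: arrD)
      have "m \<diamondop> (l \<diamondop> a) = m \<diamondop> Zero C W I" using a assoc[OF a(1) la(1) ma(1)] ma W by simp
      then have "l \<diamondop> a = Zero C W I" using monoD[OF mm] a la W by blast
      then have "l \<diamondop> a = l \<diamondop> Zero C W L" using la W by simp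
      then show "a = Zero C W L" using monoD[OF lm] a W by blast
    qed
    then obtain T z where z: "arr C Y T z" "is_kernel C Y T z L (m \<diamondop> l)"
      using mono_is_kernel ml unfolding arr_def by metis
    note zk = kernelD[OF z(2,1)]
    have obj: "X \<in> Obj C" "I \<in> Obj C" "T \<in> Obj C" "Z \<in> Obj C" using f ma z g by (auto dest: arrD)
    have "f = (m \<diamondop> l) \<diamondop> e'" using e e' assoc[OF e'(1) la(1) ma(1)] by simp
    then have "z \<diamondop> f = Zero C X T" using assoc[OF e'(1) zk(1) z(1)] zk e' obj by simp
    then obtain y where y: "arr C Q T y" "y \<diamondop> q = z" using cokernel_desc[OF q z(1)] by blast
    have "z \<diamondop> m = Zero C I T" using y assoc[OF ma(1) qa(1) y(1)] ma obj by simp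
    then obtain s where s: "arr C I L s" "(m \<diamondop> l) \<diamondop> s = m" using kernel_lift[OF z(2) ma(1)] by blast
    have "m \<diamondop> (l \<diamondop> s) = m \<diamondop> Ident C I" using s assoc[OF s(1) la(1) ma(1)] ma by simp
    then have ls: "l \<diamondop> s = Ident C I" using monoD[OF mm] s la obj by blast
    have "g = g \<diamondop> (l \<diamondop> s)" using ls g by simp
    also have "\<dots> = (g \<diamondop> l) \<diamondop> s" using assoc[OF s(1) la(1) g(1)] by simp
    also have "\<dots> = Zero C I Z" using la s obj by simp
    finally show "g = Zero C I Z" .
  qed
  then show thesis using that[OF arrD(1)[OF ma(1)] _ mm e(2)] by blast
qed

text \<open>The map \<open>K / T \<rightarrow> S / T\<close> is a monomorphism for subobjects \<open>T \<subseteq> K \<subseteq> S\<close>: its image receives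
  an epimorphism from \<open>K\<close> with kernel \<open>T\<close>.\<close>

lemma quotient_mono:
  assumes t: "is_mono C T K t" and k: "is_mono C K S k"
    and obj: "T \<in> Obj C" "K \<in> Obj C" "S \<in> Obj C"
    and q: "is_cokernel C T K t Q q" and r: "is_cokernel C T S (k \<diamondop> t) R r"
    and j: "arr C Q R j" "j \<diamondop> q = r \<diamondop> k"
  shows "is_mono C Q R j"
proof -
  have ta: "arr C T K t" and ka: "arr C K S k" using t k obj mono_arr by auto
  have kta: "arr C T S (k \<diamondop> t)" using ta ka by auto
  have kt: "is_mono C T S (k \<diamondop> t)"
  proof (rule monoI[OF kta])
    fix W a assume a: "arr C W T a" "(k \<diamondop> t) \<diamondop> a = Zero C W S"
    have W: "W \<in> Obj C" using a by (auto dest: arrD)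
    have "k \<diamondop> (t \<diamondop> a) = k \<diamondop> Zero C W K" using a assoc[OF a(1) ta ka] ka W by simp
    then have "t \<diamondop> a = t \<diamondop> Zero C W T" using monoD[OF k] a ta W obj by (metis arr_Zero arr_comp comp_Zero)
    then show "a = Zero C W T" using monoD[OF t] a W obj by blast
  qed
  note qa = cokernelD[OF q ta] and ra = cokernelD[OF r kta]
  note rk = mono_is_kernel_of_cokernel[OF kt obj(1,3) r]
  obtain J e m where J: "J \<in> Obj C" and e: "is_epi C Q J e" and m: "is_mono C J R m" and me: "m \<diamondop> e = j"
    using image_factorization[OF j(1)] .
  have obj': "Q \<in> Obj C" "R \<in> Obj C" using j by (auto dest: arrD)
  have ea: "arr C Q J e" and ma: "arr C J R m" using e m obj' J epi_arr mono_arr by auto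
  have eqa: "arr C K J (e \<diamondop> q)" using ea qa by auto
  have eq: "is_epi C K J (e \<diamondop> q)"
  proof (rule epiI[OF eqa])
    fix Z g assume g: "arr C J Z g" "g \<diamondop> (e \<diamondop> q) = Zero C K Z"
    have Z: "Z \<in> Obj C" using g by (auto dest: arrD)
    have "(g \<diamondop> e) \<diamondop> q = Zero C Q Z \<diamondop> q" using g assoc[OF qa(1) ea g(1)] qa Z by simp
    then have "g \<diamondop> e = Zero C J Z \<diamondop> e"
      using epiD[OF cokernel_epi[OF q ta]] g ea Z obj' by (metis Zero_comp arr_Zero arr_comp)
    then show "g = Zero C J Z" using epiD[OF e] g Z J by blast
  qed
  have "is_kernel C K J (e \<diamondop> q) T t"
  proof (rule kernelI[OF eqa t obj(1)])
    show "(e \<diamondop> q) \<diamondop> t = Zero C T J" using assoc[OF ta qa(1) ea] qa ea obj by simp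
    fix W a assume a: "arr C W K a" "(e \<diamondop> q) \<diamondop> a = Zero C W J"
    have W: "W \<in> Obj C" using a by (auto dest: arrD)
    have "r \<diamondop> (k \<diamondop> a) = (j \<diamondop> q) \<diamondop> a" using j(2) assoc[OF a(1) ka ra(1)] by simp
    also have "\<dots> = m \<diamondop> ((e \<diamondop> q) \<diamondop> a)"
      using me assoc[OF a(1) eqa ma] assoc[OF qa(1) ea ma] by simp
    also have "\<dots> = Zero C W R" using a ma W by simp
    finally obtain h where h: "arr C W T h" "(k \<diamondop> t) \<diamondop> h = k \<diamondop> a"
      using kernel_lift[OF rk arr_comp[OF a(1) ka]] by blast
    then have "k \<diamondop> (t \<diamondop> h) = k \<diamondop> a" using assoc[OF h(1) ta ka] by simp
    then have "t \<diamondop> h = a" using monoD[OF k] h ta a by blast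
    then show "\<exists>h. arr C W T h \<and> t \<diamondop> h = a" using h by blast
  qed
  then have "is_cokernel C T K t J (e \<diamondop> q)"
    using epi_is_cokernel_of_kernel eq obj J by blast
  \<comment> \<open>\<open>q\<close> and \<open>e \<diamondop> q\<close> are both cokernels of
    \<open>t\<close>, so \<open>e\<close> has a left inverse \<open>s\<close>; then \<open>j\<close>
    is a monomorphism, being the monomorphism \<open>m\<close> after the split monomorphism
    \<open>e\<close>.\<close>
  then obtain s where s: "arr C J Q s" "s \<diamondop> (e \<diamondop> q) = q"
    using cokernel_desc[OF _ qa] by blast
  then have "(s \<diamondop> e) \<diamondop> q = Ident C Q \<diamondop> q" using assoc[OF qa(1) ea s(1)] qa by simp
  then have se: "s \<diamondop> e = Ident C Q" using epiD[OF cokernel_epi[OF q ta]] s ea obj' by blast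
  show ?thesis
  proof (rule monoI[OF j(1)])
    fix W a assume a: "arr C W Q a" "j \<diamondop> a = Zero C W R"
    have W: "W \<in> Obj C" using a by (auto dest: arrD)
    have "m \<diamondop> (e \<diamondop> a) = m \<diamondop> Zero C W J" using a me assoc[OF a(1) ea ma] ma W by simp
    then have "e \<diamondop> a = Zero C W J" using monoD[OF m] a ea W J by blast
    then have "s \<diamondop> (e \<diamondop> a) = Zero C W Q" using s W by simp
    then show "a = Zero C W Q" using assoc[OF a(1) ea s(1)] se a by simp
  qed
qed

end

subsection \<open>Families of generators that behave like the representable modules\<close>

definition factors :: "('o, 'm, 'x) category_scheme \<Rightarrow> 'o \<Rightarrow> 'm \<Rightarrow> 'o \<Rightarrow> 'm \<Rightarrow> bool" where
  "factors C X x Y y \<longleftrightarrow> (\<exists>a. arr C X Y a \<and> y \<diamondop>\<^bsub>C\<^esub> a = x)"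

text \<open>A member is a pair of a source object and a morphism to \<open>X\<close>. Directedness
  is by factorization, so in a module category the images of the members form a directed family of
  submodules.\<close>

definition directed_sink :: "('o, 'm, 'x) category_scheme \<Rightarrow> 'o \<Rightarrow> ('o \<times> 'm) set \<Rightarrow> bool" where
  "directed_sink C X W \<longleftrightarrow> W \<noteq> {} \<and> (\<forall>(Y, w)\<in>W. arr C Y X w) \<and>
     (\<forall>(Y, w)\<in>W. \<forall>(Y', w')\<in>W. \<exists>(Z, z)\<in>W. factors C Y w Z z \<and> factors C Y' w' Z z)"

text \<open>Replaces the condition that the image of \<open>x\<close> lies in the union of the
  images of \<open>W\<close>: in a module category, testing with the projection and the zero map to
  the quotient by that union recovers it. Only composition occurs, so an equivalence preserves
  it.\<close>

definition dominated :: "('o, 'm, 'x) category_scheme \<Rightarrow> 'o \<Rightarrow> ('o \<times> 'm) set \<Rightarrow> 'm \<Rightarrow> bool" where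
  "dominated C X W x \<longleftrightarrow> (\<forall>L g g'. arr C X L g \<and> arr C X L g' \<and>
     (\<forall>(Y, w)\<in>W. g \<diamondop>\<^bsub>C\<^esub> w = g' \<diamondop>\<^bsub>C\<^esub> w) \<longrightarrow> g \<diamondop>\<^bsub>C\<^esub> x = g' \<diamondop>\<^bsub>C\<^esub> x)"

text \<open>The properties of the representable modules that are transported along an equivalence.\<close>

definition module_generators :: "('o, 'm, 'x) category_scheme \<Rightarrow> 'o set \<Rightarrow> bool" where
  "module_generators C \<U> \<longleftrightarrow> \<U> \<subseteq> Obj C \<and>
     (\<forall>X Y v. arr C X Y v \<and> (\<forall>U\<in>\<U>. bij_betw (\<lambda>s. v \<diamondop>\<^bsub>C\<^esub> s) (Hom C U X) (Hom C U Y)) \<longrightarrow>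
        is_isomorphism C X Y v) \<and>
     (\<forall>X W U x. directed_sink C X W \<and> U \<in> \<U> \<and> arr C U X x \<and> dominated C X W x \<longrightarrow>
        (\<exists>(Y, w)\<in>W. factors C U x Y w))"

lemma module_generatorsD:
  assumes "module_generators C \<U>"
  shows "\<U> \<subseteq> Obj C"
    and "\<lbrakk>arr C X Y v; \<And>U. U \<in> \<U> \<Longrightarrow> bij_betw (\<lambda>s. v \<diamondop>\<^bsub>C\<^esub> s) (Hom C U X) (Hom C U Y)\<rbrakk> \<Longrightarrow>
        is_isomorphism C X Y v"
    and "\<lbrakk>directed_sink C X W; U \<in> \<U>; arr C U X x; dominated C X W x\<rbrakk> \<Longrightarrow>
        \<exists>(Y, w)\<in>W. factors C U x Y w"
  using assms unfolding module_generators_def by blast+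

subsection \<open>The category of modules over a small preadditive category\<close>

abbreviation mgrp :: "('c, 'k, 'u) modl \<Rightarrow> 'c \<Rightarrow> 'u monoid" where
  "mgrp M c \<equiv> ObjMap M c"

definition mact :: "('c, 'k, 'u) modl \<Rightarrow> 'k \<Rightarrow> 'u \<Rightarrow> 'u" where
  "mact M f = snd (snd (ArrMap M f))"

definition mapp :: "('c, 'k, 'u) modl_hom \<Rightarrow> 'c \<Rightarrow> 'u \<Rightarrow> 'u" where
  "mapp \<eta> c = snd (snd (snd (snd \<eta>) c))"

definition mk_mhom ::
    "('c, 'k) preadd \<Rightarrow> ('c, 'k, 'u) modl \<Rightarrow> ('c, 'k, 'u) modl \<Rightarrow> ('c \<Rightarrow> 'u \<Rightarrow> 'u) \<Rightarrow> ('c, 'k, 'u) modl_hom" where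
  "mk_mhom C F G h = (F, G, \<lambda>c\<in>Obj C. (mgrp F c, mgrp G c, restrict (h c) (carrier (mgrp F c))))"

text \<open>Modules take values in groups on \<open>'u\<close>, so a small group on another type is first copied along a
  chosen injection (an arbitrary map if the group is not small).\<close>

definition enc :: "'u itself \<Rightarrow> 'g monoid \<Rightarrow> 'g \<Rightarrow> 'u" where
  "enc _ G = (SOME e. inj_on e (carrier G))"

text \<open>\<open>ArrMap\<close> receives a bare arrow without its source and target; these are
  recovered from it, uniquely by \<open>Hom_disjoint\<close>.\<close>

definition dom_of :: "('o, 'm, 'x) category_scheme \<Rightarrow> 'm \<Rightarrow> 'o" where
  "dom_of C f = (THE X. \<exists>Y. arr C X Y f)"

definition cod_of :: "('o, 'm, 'x) category_scheme \<Rightarrow> 'm \<Rightarrow> 'o" where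
  "cod_of C f = (THE Y. \<exists>X. arr C X Y f)"

text \<open>Modules are contravariant: for \<open>f\<close> from \<open>X\<close> to
  \<open>Y\<close>, \<open>act X Y f\<close> maps \<open>G Y\<close> to \<open>G X\<close>. The
  action is conjugated by the encodings of the two groups.\<close>

definition mk_module ::
    "'u itself \<Rightarrow> ('c, 'k) preadd \<Rightarrow> ('c \<Rightarrow> 'g monoid) \<Rightarrow> ('c \<Rightarrow> 'c \<Rightarrow> 'k \<Rightarrow> 'g \<Rightarrow> 'g) \<Rightarrow> ('c, 'k, 'u) modl"
  where
  "mk_module u C G act = \<lparr>
     ObjMap = (\<lambda>c\<in>Obj C. transport_group (enc u (G c)) (G c)),
     ArrMap = (\<lambda>f\<in>(\<Union>X\<in>Obj C. \<Union>Y\<in>Obj C. Hom C X Y).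
       let X = dom_of C f; Y = cod_of C f;
           GX = transport_group (enc u (G X)) (G X); GY = transport_group (enc u (G Y)) (G Y)
       in (GY, GX, \<lambda>x\<in>carrier GY.
             enc u (G X) (act X Y f (inv_into (carrier (G Y)) (enc u (G Y)) x))))\<rparr>"

lemma (in category) dom_cod_of:
  assumes "arr C X Y f"
  shows "dom_of C f = X" "cod_of C f = Y"
  unfolding dom_of_def cod_of_def using assms arr_unique by (blast intro: the_equality)+

lemma enc_inj:
  assumes "small TYPE('u) (carrier G)"
  shows "inj_on (enc TYPE('u) G) (carrier G)"
proof -
  obtain e :: "'a \<Rightarrow> 'u" where "inj_on e (carrier G)" using small_imp_inj assms .
  then show ?thesis unfolding enc_def by (rule someI[of "\<lambda>e. inj_on e (carrier G)"])
qed

lemma functor_Obj: "\<lbrakk>is_functor C D F; X \<in> Obj C\<rbrakk> \<Longrightarrow> ObjMap F X \<in> Obj D"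
  unfolding is_functor_def by blast

lemma functor_arr: "\<lbrakk>is_functor C D F; arr C X Y f\<rbrakk> \<Longrightarrow> arr D (ObjMap F X) (ObjMap F Y) (ArrMap F f)"
  unfolding is_functor_def arr_def by blast

lemma functor_Ident: "\<lbrakk>is_functor C D F; X \<in> Obj C\<rbrakk> \<Longrightarrow> ArrMap F (Ident C X) = Ident D (ObjMap F X)"
  unfolding is_functor_def by blast

lemma functor_comp:
  "\<lbrakk>is_functor C D F; arr C X Y f; arr C Y Z g\<rbrakk> \<Longrightarrow> ArrMap F (g \<diamondop>\<^bsub>C\<^esub> f) = ArrMap F g \<diamondop>\<^bsub>D\<^esub> ArrMap F f"
  unfolding is_functor_def arr_def by blast

lemma additive_functor_Add:
  "\<lbrakk>is_additive_functor C D F; arr C X Y f; arr C X Y g\<rbrakk> \<Longrightarrow>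
    ArrMap F (Add C f g) = Add D (ArrMap F f) (ArrMap F g)"
  unfolding is_additive_functor_def arr_def by blast

lemma Obj_opposite [simp]: "Obj (opposite C) = Obj C"
  and Hom_opposite [simp]: "Hom (opposite C) X Y = Hom C Y X"
  and Comp_opposite [simp]: "Comp (opposite C) g f = Comp C f g"
  and Ident_opposite [simp]: "Ident (opposite C) = Ident C"
  and Add_opposite [simp]: "Add (opposite C) = Add C"
  by (simp_all add: opposite_def)

lemma Obj_Ab [simp]: "Obj (Ab u) = {G. comm_group G \<and> small u (carrier G)}"
  and Hom_Ab [simp]: "Hom (Ab u) G H = {(G, H, f) | f. f \<in> hom G H \<and> f \<in> extensional (carrier G)}"
  and Ident_Ab [simp]: "Ident (Ab u) G = (G, G, restrict (\<lambda>x. x) (carrier G))"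
  and Comp_Ab [simp]: "Comp (Ab u) (H, K, g) (G, H', f) = (G, K, compose (carrier G) g f)"
  and Add_Ab [simp]: "Add (Ab u) (G, H, f) (G', H', f') = (G, H, \<lambda>x\<in>carrier G. f x \<otimes>\<^bsub>H\<^esub> f' x)"
  by (simp_all add: Ab_def)

definition rep :: "'u itself \<Rightarrow> ('c, 'k) preadd \<Rightarrow> 'c \<Rightarrow> ('c, 'k, 'u) modl" where
  "rep u C c = mk_module u C (\<lambda>d. hom_group C d c) (\<lambda>d d' f x. x \<diamondop>\<^bsub>C\<^esub> f)"

text \<open>The Yoneda element: the identity of \<open>c\<close>, seen in the encoded copy of Hom(c,
  c).\<close>

definition univ_elem :: "'u itself \<Rightarrow> ('c, 'k) preadd \<Rightarrow> 'c \<Rightarrow> 'u" where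
  "univ_elem u C c = enc u (hom_group C c c) (Ident C c)"

section \<open>Modules and their morphisms as natural families of group homomorphisms\<close>

context
  fixes C :: "('c, 'k) preadd" (structure)
  assumes univ: "universe TYPE('u)" and C: "small_preadditive TYPE('u) C"
begin

interpretation C: preadditive_category C
  using C by (simp add: small_preadditive_def)

abbreviation (input) Md :: "(('c, 'k, 'u) modl, ('c, 'k, 'u) modl_hom) category" where
  "Md \<equiv> module_category TYPE('u) C"

lemma small_Obj_C: "small TYPE('u) (Obj C)"
  using C by (simp add: small_preadditive_def small_category_def)

lemma small_Hom_C: "\<lbrakk>X \<in> Obj C; Y \<in> Obj C\<rbrakk> \<Longrightarrow> small TYPE('u) (Hom C X Y)"
  using C by (simp add: small_preadditive_def small_category_def locally_small_def)

lemma module_group: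
  assumes "M \<in> Obj Md" "c \<in> Obj C"
  shows "comm_group (mgrp M c)" "small TYPE('u) (carrier (mgrp M c))"
  using assms unfolding module_category_def is_additive_functor_def is_functor_def by auto

lemma module_arr:
  assumes "M \<in> Obj Md" "arr C c c' f"
  shows "ArrMap M f = (mgrp M c', mgrp M c, mact M f)"
    and "mact M f \<in> hom (mgrp M c') (mgrp M c)"
    and "mact M f \<in> extensional (carrier (mgrp M c'))"
proof -
  have "ArrMap M f \<in> Hom (Ab TYPE('u)) (mgrp M c') (mgrp M c)"
    using assms unfolding module_category_def is_additive_functor_def is_functor_def arr_def by simp
  then obtain g where g: "ArrMap M f = (mgrp M c', mgrp M c, g)"
    "g \<in> hom (mgrp M c') (mgrp M c)" "g \<in> extensional (carrier (mgrp M c'))" by auto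
  then show "ArrMap M f = (mgrp M c', mgrp M c, mact M f)"
    "mact M f \<in> hom (mgrp M c') (mgrp M c)" "mact M f \<in> extensional (carrier (mgrp M c'))"
    by (simp_all add: mact_def)
qed

lemma mact_closed:
  "\<lbrakk>M \<in> Obj Md; arr C c c' f; x \<in> carrier (mgrp M c')\<rbrakk> \<Longrightarrow> mact M f x \<in> carrier (mgrp M c)"
  by (rule hom_in_carrier[OF module_arr(2)])

lemma mact_comp:
  assumes M: "M \<in> Obj Md" and f: "arr C X Y f" and g: "arr C Y Z g" and x: "x \<in> carrier (mgrp M Z)"
  shows "mact M (g \<diamondop> f) x = mact M f (mact M g x)"
proof -
  have "is_functor (opposite C) (Ab TYPE('u)) M"
    using M unfolding module_category_def is_additive_functor_def by simp
  moreover have "arr (opposite C) Z Y g" "arr (opposite C) Y X f" using f g by (auto simp: arr_def)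
  ultimately have "ArrMap M (g \<diamondop> f) = ArrMap M f \<diamondop>\<^bsub>Ab TYPE('u)\<^esub> ArrMap M g"
    using functor_comp by fastforce
  then have "(mgrp M Z, mgrp M X, mact M (g \<diamondop> f)) =
      (mgrp M Z, mgrp M X, compose (carrier (mgrp M Z)) (mact M f) (mact M g))"
    unfolding module_arr(1)[OF M f] module_arr(1)[OF M g] module_arr(1)[OF M C.arr_comp[OF f g]]
      Comp_Ab .
  then show ?thesis using x by (simp add: compose_def)
qed

lemma mact_Ident:
  assumes M: "M \<in> Obj Md" and c: "c \<in> Obj C" and x: "x \<in> carrier (mgrp M c)"
  shows "mact M (Ident C c) x = x"
proof -
  have "ArrMap M (Ident C c) = Ident (Ab TYPE('u)) (mgrp M c)"
    using M c unfolding module_category_def is_additive_functor_def is_functor_def by simp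
  then show ?thesis using x by (simp add: mact_def)
qed

lemma mact_Add:
  assumes M: "M \<in> Obj Md" and f: "arr C X Y f" and g: "arr C X Y g" and x: "x \<in> carrier (mgrp M Y)"
  shows "mact M (Add C f g) x = mact M f x \<otimes>\<^bsub>mgrp M X\<^esub> mact M g x"
proof -
  have "ArrMap M (Add (opposite C) f g) = Add (Ab TYPE('u)) (ArrMap M f) (ArrMap M g)"
  proof (rule additive_functor_Add)
    show "is_additive_functor (opposite C) (Ab TYPE('u)) M" using M by (simp add: module_category_def)
    show "arr (opposite C) Y X f" "arr (opposite C) Y X g" using f g by (auto simp: arr_def)
  qed
  then show ?thesis using x unfolding module_arr(1)[OF M f] module_arr(1)[OF M g]
    by (simp add: mact_def)
qed

lemma mact_hom_arg:
  assumes M: "M \<in> Obj Md" and XY: "X \<in> Obj C" "Y \<in> Obj C" and x: "x \<in> carrier (mgrp M Y)"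
  shows "(\<lambda>f. mact M f x) \<in> hom (hom_group C X Y) (mgrp M X)"
  unfolding hom_def using assms mact_closed mact_Add by (auto simp: arr_def)

lemma Hom_Md: "Hom Md F G =
   {(F, G, \<eta>) | \<eta>. is_natural (opposite C) (Ab TYPE('u)) F G \<eta> \<and> \<eta> \<in> extensional (Obj C)}"
  by (simp add: module_category_def)

lemma mhom_comp_eq:
  assumes "arr Md F G \<eta>" "c \<in> Obj C"
  shows "snd (snd \<eta>) c = (mgrp F c, mgrp G c, mapp \<eta> c)"
    and "mapp \<eta> c \<in> hom (mgrp F c) (mgrp G c)"
    and "mapp \<eta> c \<in> extensional (carrier (mgrp F c))"
proof -
  have "snd (snd \<eta>) c \<in> Hom (Ab TYPE('u)) (mgrp F c) (mgrp G c)"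
    using assms unfolding arr_def Hom_Md is_natural_def by auto
  then show "snd (snd \<eta>) c = (mgrp F c, mgrp G c, mapp \<eta> c)"
    "mapp \<eta> c \<in> hom (mgrp F c) (mgrp G c)" "mapp \<eta> c \<in> extensional (carrier (mgrp F c))"
    by (auto simp: mapp_def)
qed

lemma mhom_eq:
  assumes "arr Md F G \<eta>"
  shows "\<eta> = (F, G, snd (snd \<eta>))" "snd (snd \<eta>) \<in> extensional (Obj C)"
  using assms unfolding arr_def Hom_Md by auto

lemma mapp_closed:
  "\<lbrakk>arr Md F G \<eta>; c \<in> Obj C; x \<in> carrier (mgrp F c)\<rbrakk> \<Longrightarrow> mapp \<eta> c x \<in> carrier (mgrp G c)"
  by (rule hom_in_carrier[OF mhom_comp_eq(2)])

lemma mapp_natural: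
  assumes \<eta>: "arr Md F G \<eta>" and f: "arr C c c' f" and x: "x \<in> carrier (mgrp F c')"
  shows "mapp \<eta> c (mact F f x) = mact G f (mapp \<eta> c' x)"
proof -
  have FG: "F \<in> Obj Md" "G \<in> Obj Md" and c: "c \<in> Obj C" "c' \<in> Obj C" using \<eta> f by (auto dest: arrD)
  have "snd (snd \<eta>) c \<diamondop>\<^bsub>Ab TYPE('u)\<^esub> ArrMap F f = ArrMap G f \<diamondop>\<^bsub>Ab TYPE('u)\<^esub> snd (snd \<eta>) c'"
    using \<eta> f unfolding arr_def Hom_Md is_natural_def by auto
  then have "compose (carrier (mgrp F c')) (mapp \<eta> c) (mact F f) =
      compose (carrier (mgrp F c')) (mact G f) (mapp \<eta> c')"
    unfolding module_arr(1)[OF FG(1) f] module_arr(1)[OF FG(2) f]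
      mhom_comp_eq(1)[OF \<eta> c(1)] mhom_comp_eq(1)[OF \<eta> c(2)] Comp_Ab by blast
  from fun_cong[OF this, of x] show ?thesis using x by (simp add: compose_def)
qed

lemma mhom_ext:
  assumes \<eta>: "arr Md F G \<eta>" and \<theta>: "arr Md F G \<theta>"
    and eq: "\<And>c x. \<lbrakk>c \<in> Obj C; x \<in> carrier (mgrp F c)\<rbrakk> \<Longrightarrow> mapp \<eta> c x = mapp \<theta> c x"
  shows "\<eta> = \<theta>"
proof -
  have "snd (snd \<eta>) = snd (snd \<theta>)"
  proof (rule extensionalityI)
    show "snd (snd \<eta>) \<in> extensional (Obj C)" "snd (snd \<theta>) \<in> extensional (Obj C)"
      using mhom_eq \<eta> \<theta> by auto
    fix c assume c: "c \<in> Obj C"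
    have "mapp \<eta> c = mapp \<theta> c"
      by (rule extensionalityI) (use mhom_comp_eq[OF \<eta> c] mhom_comp_eq[OF \<theta> c] eq c in auto)
    then show "snd (snd \<eta>) c = snd (snd \<theta>) c"
      using mhom_comp_eq(1)[OF \<eta> c] mhom_comp_eq(1)[OF \<theta> c] by simp
  qed
  then show ?thesis using mhom_eq \<eta> \<theta> by metis
qed

lemma arr_mk_mhom:
  assumes F: "F \<in> Obj Md" and G: "G \<in> Obj Md"
    and h: "\<And>c. c \<in> Obj C \<Longrightarrow> h c \<in> hom (mgrp F c) (mgrp G c)"
    and nat: "\<And>c c' f x. \<lbrakk>arr C c c' f; x \<in> carrier (mgrp F c')\<rbrakk> \<Longrightarrow>
       h c (mact F f x) = mact G f (h c' x)"
  shows "arr Md F G (mk_mhom C F G h)"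
proof -
  let ?\<eta> = "\<lambda>c\<in>Obj C. (mgrp F c, mgrp G c, restrict (h c) (carrier (mgrp F c)))"
  have "is_natural (opposite C) (Ab TYPE('u)) F G ?\<eta>"
    unfolding is_natural_def
  proof (intro conjI ballI)
    fix c assume c: "c \<in> Obj (opposite C)"
    then show "?\<eta> c \<in> Hom (Ab TYPE('u)) (mgrp F c) (mgrp G c)"
      using h[of c] module_group(1)[OF F, of c]
      by (auto simp: hom_def comm_group_def group_def monoid.m_closed)
  next
    fix X Y f assume "X \<in> Obj (opposite C)" "Y \<in> Obj (opposite C)" "f \<in> Hom (opposite C) X Y"
    then have f: "arr C Y X f" and XY: "X \<in> Obj C" "Y \<in> Obj C" by (auto simp: arr_def)
    show "?\<eta> Y \<diamondop>\<^bsub>Ab TYPE('u)\<^esub> ArrMap F f = ArrMap G f \<diamondop>\<^bsub>Ab TYPE('u)\<^esub> ?\<eta> X"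
      unfolding module_arr(1)[OF F f] module_arr(1)[OF G f]
      using XY nat[OF f] mact_closed[OF F f] by (auto simp: compose_def fun_eq_iff)
  qed
  then show ?thesis using F G unfolding arr_def Hom_Md mk_mhom_def by auto
qed

lemma mapp_mk_mhom:
  "\<lbrakk>c \<in> Obj C; x \<in> carrier (mgrp F c)\<rbrakk> \<Longrightarrow> mapp (mk_mhom C F G h) c x = h c x"
  by (simp add: mapp_def mk_mhom_def)

lemma Comp_Md: "(G', H, \<beta>) \<diamondop>\<^bsub>Md\<^esub> (F, G, \<alpha>) = (F, H, \<lambda>X\<in>Obj C. \<beta> X \<diamondop>\<^bsub>Ab TYPE('u)\<^esub> \<alpha> X)"
  by (simp add: module_category_def)

lemma Comp_Md_eq:
  assumes "arr Md F G \<alpha>" "arr Md G H \<beta>"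
  shows "\<beta> \<diamondop>\<^bsub>Md\<^esub> \<alpha> = mk_mhom C F H (\<lambda>c x. mapp \<beta> c (mapp \<alpha> c x))"
proof -
  have "\<beta> \<diamondop>\<^bsub>Md\<^esub> \<alpha> = (F, H, \<lambda>X\<in>Obj C. snd (snd \<beta>) X \<diamondop>\<^bsub>Ab TYPE('u)\<^esub> snd (snd \<alpha>) X)"
    by (subst mhom_eq(1)[OF assms(1)], subst mhom_eq(1)[OF assms(2)], rule Comp_Md)
  also have "\<dots> = mk_mhom C F H (\<lambda>c x. mapp \<beta> c (mapp \<alpha> c x))"
    unfolding mk_mhom_def using mhom_comp_eq(1)[OF assms(1)] mhom_comp_eq(1)[OF assms(2)]
    by (auto simp: compose_def fun_eq_iff)
  finally show ?thesis .
qed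

lemma arr_Comp_Md:
  assumes \<alpha>: "arr Md F G \<alpha>" and \<beta>: "arr Md G H \<beta>"
  shows "arr Md F H (\<beta> \<diamondop>\<^bsub>Md\<^esub> \<alpha>)"
  unfolding Comp_Md_eq[OF assms]
proof (rule arr_mk_mhom)
  show "F \<in> Obj Md" "H \<in> Obj Md" using assms by (auto dest: arrD)
  fix c assume c: "c \<in> Obj C"
  show "(\<lambda>x. mapp \<beta> c (mapp \<alpha> c x)) \<in> hom (mgrp F c) (mgrp H c)"
    using mhom_comp_eq(2)[OF \<alpha> c] mhom_comp_eq(2)[OF \<beta> c] by (auto simp: hom_def Pi_iff)
next
  fix c c' f x assume f: "arr C c c' f" and x: "x \<in> carrier (mgrp F c')"
  then show "mapp \<beta> c (mapp \<alpha> c (mact F f x)) = mact H f (mapp \<beta> c' (mapp \<alpha> c' x))"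
    using mapp_natural[OF \<alpha> f x] mapp_natural[OF \<beta> f] mapp_closed[OF \<alpha> _ x] by (auto dest: arrD)
qed

lemma mapp_Comp:
  assumes "arr Md F G \<alpha>" "arr Md G H \<beta>" "c \<in> Obj C" "x \<in> carrier (mgrp F c)"
  shows "mapp (\<beta> \<diamondop>\<^bsub>Md\<^esub> \<alpha>) c x = mapp \<beta> c (mapp \<alpha> c x)"
  unfolding Comp_Md_eq[OF assms(1,2)] by (rule mapp_mk_mhom[OF assms(3,4)])

lemma Ident_Md_eq: "Ident Md F = mk_mhom C F F (\<lambda>c x. x)"
  by (simp add: module_category_def mk_mhom_def Ab_def)

lemma mapp_Ident: "\<lbrakk>c \<in> Obj C; x \<in> carrier (mgrp F c)\<rbrakk> \<Longrightarrow> mapp (Ident Md F) c x = x"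
  by (simp add: Ident_Md_eq mapp_mk_mhom)

lemma arr_Ident_Md: "F \<in> Obj Md \<Longrightarrow> arr Md F F (Ident Md F)"
  unfolding Ident_Md_eq by (rule arr_mk_mhom) (auto simp: hom_def)

lemma category_Md: "category Md"
proof
  fix X Y Z f g assume "X \<in> Obj Md" "Y \<in> Obj Md" "Z \<in> Obj Md" "f \<in> Hom Md X Y" "g \<in> Hom Md Y Z"
  then show "g \<diamondop>\<^bsub>Md\<^esub> f \<in> Hom Md X Z" by (meson arr_Comp_Md arr_def)
next
  fix W X Y Z f g h assume "W \<in> Obj Md" "X \<in> Obj Md" "Y \<in> Obj Md" "Z \<in> Obj Md"
    "f \<in> Hom Md W X" "g \<in> Hom Md X Y" "h \<in> Hom Md Y Z"
  then have a: "arr Md W X f" "arr Md X Y g" "arr Md Y Z h" by (simp_all add: arr_def)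
  show "(h \<diamondop>\<^bsub>Md\<^esub> g) \<diamondop>\<^bsub>Md\<^esub> f = h \<diamondop>\<^bsub>Md\<^esub> g \<diamondop>\<^bsub>Md\<^esub> f"
  proof (rule mhom_ext)
    show "arr Md W Z ((h \<diamondop>\<^bsub>Md\<^esub> g) \<diamondop>\<^bsub>Md\<^esub> f)" "arr Md W Z (h \<diamondop>\<^bsub>Md\<^esub> g \<diamondop>\<^bsub>Md\<^esub> f)"
      using a arr_Comp_Md by meson+
    fix c x assume c: "c \<in> Obj C" "x \<in> carrier (mgrp W c)"
    have "mapp f c x \<in> carrier (mgrp X c)" using mapp_closed a(1) c by blast
    then show "mapp ((h \<diamondop>\<^bsub>Md\<^esub> g) \<diamondop>\<^bsub>Md\<^esub> f) c x = mapp (h \<diamondop>\<^bsub>Md\<^esub> g \<diamondop>\<^bsub>Md\<^esub> f) c x"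
      using mapp_Comp[OF a(1) arr_Comp_Md[OF a(2,3)] c] mapp_Comp[OF arr_Comp_Md[OF a(1,2)] a(3) c]
        mapp_Comp[OF a(1,2) c] mapp_Comp[OF a(2,3) c(1)] by simp
  qed
next
  fix X assume "X \<in> Obj Md"
  then show "Ident Md X \<in> Hom Md X X" using arr_Ident_Md by (simp add: arr_def)
next
  fix X Y f assume "X \<in> Obj Md" "Y \<in> Obj Md" "f \<in> Hom Md X Y"
  then have f: "arr Md X Y f" and i: "arr Md X X (Ident Md X)" "arr Md Y Y (Ident Md Y)"
    using arr_Ident_Md by (auto simp: arr_def)
  show "f \<diamondop>\<^bsub>Md\<^esub> Ident Md X = f"
    by (rule mhom_ext[OF arr_Comp_Md[OF i(1) f] f]) (simp add: mapp_Comp[OF i(1) f] mapp_Ident)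
  show "Ident Md Y \<diamondop>\<^bsub>Md\<^esub> f = f"
    by (rule mhom_ext[OF arr_Comp_Md[OF f i(2)] f])
      (simp add: mapp_Comp[OF f i(2)] mapp_Ident mapp_closed[OF f])
next
  fix X Y X' Y' f assume "f \<in> Hom Md X Y" "f \<in> Hom Md X' Y'"
  then show "X = X' \<and> Y = Y'" by (auto simp: Hom_Md)
qed

interpretation Md: category Md
  by (rule category_Md)

text \<open>Pointwise inverses of bijective components are automatically additive and
  natural.\<close>

lemma mhom_isoI:
  assumes v: "arr Md F G v" and bij: "\<And>c. c \<in> Obj C \<Longrightarrow> bij_betw (mapp v c) (carrier (mgrp F c)) (carrier (mgrp G c))"
  shows "is_isomorphism Md F G v"
proof -
  define w where "w c = inv_into (carrier (mgrp F c)) (mapp v c)" for c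
  have FG: "F \<in> Obj Md" "G \<in> Obj Md" using v by (auto dest: arrD)
  have w: "w c y \<in> carrier (mgrp F c)" "mapp v c (w c y) = y"
    if "c \<in> Obj C" "y \<in> carrier (mgrp G c)" for c y
    using bij[OF that(1)] that(2) unfolding w_def
    by (metis bij_betw_def inv_into_into, metis bij_betw_inv_into_right)
  have wv: "w c (mapp v c x) = x" if "c \<in> Obj C" "x \<in> carrier (mgrp F c)" for c x
    using bij_betw_inv_into_left[OF bij[OF that(1)] that(2)] by (simp add: w_def)
  have w_arr: "arr Md G F (mk_mhom C G F w)"
  proof (rule arr_mk_mhom[OF FG(2,1)])
    fix c assume c: "c \<in> Obj C"
    have "mapp v c \<in> iso (mgrp F c) (mgrp G c)"
      using mhom_comp_eq(2)[OF v c] bij[OF c] by (simp add: iso_def)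
    then show "w c \<in> hom (mgrp G c) (mgrp F c)"
      unfolding w_def using group.iso_set_sym module_group(1)[OF FG(1) c]
      by (metis comm_group.axioms(2) iso_imp_homomorphism)
  next
    fix c c' f x assume f: "arr C c c' f" and x: "x \<in> carrier (mgrp G c')"
    have c: "c \<in> Obj C" "c' \<in> Obj C" using f by (auto dest: arrD)
    have "mapp v c (mact F f (w c' x)) = mact G f x"
      using mapp_natural[OF v f] w[OF c(2) x] by simp
    then show "w c (mact G f x) = mact F f (w c' x)"
      using wv[OF c(1)] mact_closed[OF FG(1) f w(1)[OF c(2) x]] by metis
  qed
  show ?thesis
  proof (rule Md.isomorphismI[OF v w_arr])
    show "mk_mhom C G F w \<diamondop>\<^bsub>Md\<^esub> v = Ident Md F"
      by (rule mhom_ext[OF arr_Comp_Md[OF v w_arr] arr_Ident_Md[OF FG(1)]])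
        (simp add: mapp_Comp[OF v w_arr] mapp_mk_mhom mapp_closed[OF v] mapp_Ident wv)
    show "v \<diamondop>\<^bsub>Md\<^esub> mk_mhom C G F w = Ident Md G"
      by (rule mhom_ext[OF arr_Comp_Md[OF w_arr v] arr_Ident_Md[OF FG(2)]])
        (simp add: mapp_Comp[OF w_arr v] mapp_mk_mhom mapp_Ident w)
  qed
qed

text \<open>All that is used later about modules built from groups of an arbitrary type: the
  encoding \<open>e\<close> is an isomorphism at each object and intertwines the given action with
  \<open>mact\<close>.\<close>

lemma mk_module:
  fixes G :: "'c \<Rightarrow> 'g monoid"
  assumes G: "\<And>c. c \<in> Obj C \<Longrightarrow> comm_group (G c)"
    and sm: "\<And>c. c \<in> Obj C \<Longrightarrow> small TYPE('u) (carrier (G c))"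
    and act: "\<And>c c' f. arr C c c' f \<Longrightarrow> act c c' f \<in> hom (G c') (G c)"
    and act_comp: "\<And>X Y Z f g x. \<lbrakk>arr C X Y f; arr C Y Z g; x \<in> carrier (G Z)\<rbrakk> \<Longrightarrow>
        act X Z (g \<diamondop> f) x = act X Y f (act Y Z g x)"
    and act_Ident: "\<And>X x. \<lbrakk>X \<in> Obj C; x \<in> carrier (G X)\<rbrakk> \<Longrightarrow> act X X (Ident C X) x = x"
    and act_Add: "\<And>X Y f g x. \<lbrakk>arr C X Y f; arr C X Y g; x \<in> carrier (G Y)\<rbrakk> \<Longrightarrow>
        act X Y (Add C f g) x = act X Y f x \<otimes>\<^bsub>G X\<^esub> act X Y g x"
  defines "M \<equiv> mk_module TYPE('u) C G act" and "e \<equiv> \<lambda>c. enc TYPE('u) (G c)"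
  shows "M \<in> Obj Md"
    and "\<And>c. c \<in> Obj C \<Longrightarrow> e c \<in> iso (G c) (mgrp M c)"
    and "\<And>c c' f x. \<lbrakk>arr C c c' f; x \<in> carrier (G c')\<rbrakk> \<Longrightarrow> mact M f (e c' x) = e c (act c c' f x)"
proof -
  have e: "inj_on (e c) (carrier (G c))" if "c \<in> Obj C" for c
    unfolding e_def using enc_inj sm that by blast
  have M: "mgrp M c = transport_group (e c) (G c)" if "c \<in> Obj C" for c
    using that by (simp add: M_def mk_module_def e_def)
  have MA: "ArrMap M f = (mgrp M c', mgrp M c, \<lambda>x\<in>carrier (mgrp M c').
      e c (act c c' f (inv_into (carrier (G c')) (e c') x)))" if f: "arr C c c' f" for c c' f
  proof -
    have "f \<in> (\<Union>X\<in>Obj C. \<Union>Y\<in>Obj C. Hom C X Y)" using f by (auto simp: arr_def)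
    then show ?thesis using C.dom_cod_of[OF f] M f by (auto simp: M_def mk_module_def Let_def e_def arr_def)
  qed
  have car: "carrier (mgrp M c) = e c ` carrier (G c)" if "c \<in> Obj C" for c using M[OF that] by simp
  have inv_e: "inv_into (carrier (G c)) (e c) (e c x) = x" if "c \<in> Obj C" "x \<in> carrier (G c)" for c x
    using e that by (simp add: inv_into_f_f)
  have mult: "e c x \<otimes>\<^bsub>mgrp M c\<^esub> e c y = e c (x \<otimes>\<^bsub>G c\<^esub> y)"
    if "c \<in> Obj C" "x \<in> carrier (G c)" "y \<in> carrier (G c)" for c x y
    using mult_transport_group[OF G e] M that by metis
  show act_M: "mact M f (e c' x) = e c (act c c' f x)"
    if f: "arr C c c' f" and x: "x \<in> carrier (G c')" for c c' f x
    using x MA[OF f] car inv_e arrD(2)[OF f] by (simp add: mact_def)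
  show iso: "e c \<in> iso (G c) (mgrp M c)" if "c \<in> Obj C" for c
    unfolding iso_def hom_def bij_betw_def using that e car mult by auto
  note actc = hom_in_carrier[OF act] and actm = hom_mult[OF act]
  have gM: "comm_group (mgrp M c)" if "c \<in> Obj C" for c
    using comm_group_transport_group[OF G e] M that by metis
  have gc: "x \<otimes>\<^bsub>G c\<^esub> y \<in> carrier (G c)" if "c \<in> Obj C" "x \<in> carrier (G c)" "y \<in> carrier (G c)" for c x y
    using G[OF that(1)] that by (meson comm_group.axioms(2) group.is_monoid monoid.m_closed)
  have "is_functor (opposite C) (Ab TYPE('u)) M"
    unfolding is_functor_def
  proof (intro conjI ballI)
    fix c assume "c \<in> Obj (opposite C)"
    then have c: "c \<in> Obj C" by simp
    show "mgrp M c \<in> Obj (Ab TYPE('u))" using gM c car small_image[OF sm] by simp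
    show "ArrMap M (Ident (opposite C) c) = Ident (Ab TYPE('u)) (mgrp M c)"
      using MA[OF C.arr_Ident[OF c]] car[OF c] inv_e[OF c] act_Ident[OF c] by (auto simp: fun_eq_iff)
  next
    fix X Y f assume "X \<in> Obj (opposite C)" "Y \<in> Obj (opposite C)" "f \<in> Hom (opposite C) X Y"
    then have f: "arr C Y X f" and XY: "X \<in> Obj C" "Y \<in> Obj C" by (auto simp: arr_def)
    show "ArrMap M f \<in> Hom (Ab TYPE('u)) (mgrp M X) (mgrp M Y)"
      unfolding MA[OF f] using XY inv_e mult actc[OF f] actm[OF f] gc
      by (auto simp: hom_def car)
  next
    fix X Y Z f g assume "X \<in> Obj (opposite C)" "Y \<in> Obj (opposite C)" "Z \<in> Obj (opposite C)"
      "f \<in> Hom (opposite C) X Y" "g \<in> Hom (opposite C) Y Z"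
    then have f: "arr C Y X f" and g: "arr C Z Y g" and XYZ: "X \<in> Obj C" "Y \<in> Obj C" "Z \<in> Obj C"
      by (auto simp: arr_def)
    show "ArrMap M (g \<diamondop>\<^bsub>opposite C\<^esub> f) = ArrMap M g \<diamondop>\<^bsub>Ab TYPE('u)\<^esub> ArrMap M f"
      unfolding Comp_opposite MA[OF f] MA[OF g] MA[OF C.arr_comp[OF g f]]
      using XYZ inv_e actc[OF f] act_comp[OF g f]
      by (auto simp: car compose_def fun_eq_iff) (metis inv_e)
  qed
  moreover have "ArrMap M (Add C f g) = Add (Ab TYPE('u)) (ArrMap M f) (ArrMap M g)"
    if f: "arr C Y X f" and g: "arr C Y X g" for X Y f g
  proof -
    have XY: "X \<in> Obj C" "Y \<in> Obj C" using f by (auto dest: arrD)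
    show ?thesis
    unfolding MA[OF f] MA[OF g] MA[OF C.arr_Add[OF f g]]
    using XY inv_e mult actc[OF f] actc[OF g] act_Add[OF f g] by (auto simp: car fun_eq_iff)
  qed
  ultimately have "is_additive_functor (opposite C) (Ab TYPE('u)) M"
    unfolding is_additive_functor_def by (auto simp: arr_def)
  then show "M \<in> Obj Md"
    by (simp add: module_category_def) (simp add: M_def mk_module_def)
qed

section \<open>Representable modules and the Yoneda lemma\<close>

abbreviation (input) un :: "'c \<Rightarrow> 'u" where
  "un \<equiv> univ_elem TYPE('u) C"

text \<open>The Yoneda arguments need Hom(-, c) only as the module free on \<open>un c\<close>, and
  in this form the encoding is hidden from them. The reason is that an arrow \<open>f\<close> is
  what results when \<open>f\<close> acts on the identity of \<open>c\<close>.\<close>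

lemma rep:
  assumes c: "c \<in> Obj C"
  shows "rep TYPE('u) C c \<in> Obj Md"
    and "un c \<in> carrier (mgrp (rep TYPE('u) C c) c)"
    and "\<And>d x. \<lbrakk>d \<in> Obj C; x \<in> carrier (mgrp (rep TYPE('u) C c) d)\<rbrakk> \<Longrightarrow>
       \<exists>f. arr C d c f \<and> mact (rep TYPE('u) C c) f (un c) = x"
    and "\<And>d f g. \<lbrakk>arr C d c f; arr C d c g; mact (rep TYPE('u) C c) f (un c) = mact (rep TYPE('u) C c) g (un c)\<rbrakk> \<Longrightarrow>
       f = g"
proof -
  let ?G = "\<lambda>d. hom_group C d c" and ?act = "\<lambda>d d' f x. x \<diamondop> f"
  let ?M = "rep TYPE('u) C c"
  let ?e = "\<lambda>d. enc TYPE('u) (?G d)"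
  have sm: "small TYPE('u) (carrier (?G d))" if "d \<in> Obj C" for d
    using small_Hom_C[OF that c] by simp
  have grp: "comm_group (?G d)" if "d \<in> Obj C" for d by (rule C.hom_comm_group[OF that c])
  have ac: "x \<diamondop> (g \<diamondop> f) = (x \<diamondop> g) \<diamondop> f"
    if "arr C X Y f" "arr C Y Z g" "x \<in> carrier (?G Z)" for X Y Z f g x
    using C.assoc[OF that(1,2), of c x] that c by (simp add: arr_def)
  have ai: "x \<diamondop> Ident C X = x" if "X \<in> Obj C" "x \<in> carrier (?G X)" for X x
    using C.comp_Ident that c by simp
  have aa: "x \<diamondop> Add C f g = (x \<diamondop> f) \<otimes>\<^bsub>?G X\<^esub> (x \<diamondop> g)"
    if "arr C X Y f" "arr C X Y g" "x \<in> carrier (?G Y)" for X Y f g x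
    using C.comp_Add[of X Y c f g x] that c by (simp add: arr_def)
  have ah: "?act d d' f \<in> hom (?G d') (?G d)" if "arr C d d' f" for d d' f
    by (rule C.hom_comp[OF that c])
  note mk = mk_module[where G = ?G and act = ?act, OF grp sm ah ac ai aa, folded rep_def]
  have M1: "?M \<in> Obj Md" by (rule mk(1))
  have M2: "?e d \<in> iso (?G d) (mgrp ?M d)" if "d \<in> Obj C" for d by (rule mk(2); (assumption | rule that))
  have M3: "mact ?M f (?e d' x) = ?e d (x \<diamondop> f)" if "arr C d d' f" "x \<in> carrier (?G d')" for d d' f x
    by (rule mk(3); (assumption | rule that))
  have M: "?M \<in> Obj Md \<and> (\<forall>d\<in>Obj C. ?e d \<in> iso (?G d) (mgrp ?M d)) \<and>
      (\<forall>d d' f x. arr C d d' f \<longrightarrow> x \<in> carrier (?G d') \<longrightarrow> mact ?M f (?e d' x) = ?e d (x \<diamondop> f))"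
    using M1 M2 M3 by blast
  then show "?M \<in> Obj Md" by blast
  have iso: "?e d \<in> iso (?G d) (mgrp ?M d)" if "d \<in> Obj C" for d using M that by blast
  have bij: "bij_betw (?e d) (Hom C d c) (carrier (mgrp ?M d))" if "d \<in> Obj C" for d
    using iso[OF that] by (simp add: iso_def)
  show "un c \<in> carrier (mgrp ?M c)"
    using bij_betwE[OF bij[OF c]] C.Ident_in_Hom[OF c] by (simp add: univ_elem_def)
  have act: "mact ?M f (un c) = ?e d f" if "arr C d c f" for d f
    using M that C.Ident_in_Hom[OF c] by (simp add: univ_elem_def)
  show "\<exists>f. arr C d c f \<and> mact ?M f (un c) = x" if d: "d \<in> Obj C" and x: "x \<in> carrier (mgrp ?M d)" for d x
  proof -
    obtain f where "f \<in> Hom C d c" "x = ?e d f" using bij[OF d] x by (auto simp: bij_betw_def)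
    then show ?thesis using act d c by (metis arrI)
  qed
  show "f = g" if "arr C d c f" "arr C d c g" "mact ?M f (un c) = mact ?M g (un c)" for d f g
    using bij act that by (metis arr_def bij_betw_def inj_onD)
qed

text \<open>Uniqueness half of the Yoneda lemma: by naturality the value at \<open>un c\<close>
  determines the value at every translate of it.\<close>

lemma rep_hom_ext:
  assumes c: "c \<in> Obj C" and s: "arr Md (rep TYPE('u) C c) M s" and t: "arr Md (rep TYPE('u) C c) M t"
    and eq: "mapp s c (un c) = mapp t c (un c)"
  shows "s = t"
proof (rule mhom_ext[OF s t])
  fix d x assume d: "d \<in> Obj C" and x: "x \<in> carrier (mgrp (rep TYPE('u) C c) d)"
  then obtain f where f: "arr C d c f" "mact (rep TYPE('u) C c) f (un c) = x" using rep(3)[OF c] by blast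
  then show "mapp s d x = mapp t d x"
    using mapp_natural[OF s f(1) rep(2)[OF c]] mapp_natural[OF t f(1) rep(2)[OF c]] eq by simp
qed

lemma rep_hom_ex:
  assumes c: "c \<in> Obj C" and M: "M \<in> Obj Md" and x: "x \<in> carrier (mgrp M c)"
  obtains s where "arr Md (rep TYPE('u) C c) M s" "mapp s c (un c) = x"
proof -
  let ?R = "rep TYPE('u) C c"
  \<comment> \<open>The arrow chosen by \<open>SOME\<close> is the only one that carries
    \<open>un c\<close> to \<open>y\<close>; so \<open>h\<close> sends the translate of
    \<open>un c\<close> by an arrow to the translate of \<open>x\<close> by the same arrow.\<close>
  define h where "h d y = mact M (SOME f. arr C d c f \<and> mact ?R f (un c) = y) x" for d y
  have h: "h d (mact ?R f (un c)) = mact M f x" if f: "arr C d c f" for d f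
  proof -
    have "(SOME g. arr C d c g \<and> mact ?R g (un c) = mact ?R f (un c)) = f"
      using f rep(4)[OF c] by (metis (mono_tags, lifting) someI_ex)
    then show ?thesis by (simp add: h_def)
  qed
  note R = rep(1,2)[OF c]
  have "arr Md ?R M (mk_mhom C ?R M h)"
  proof (rule arr_mk_mhom[OF R(1) M])
    fix d assume d: "d \<in> Obj C"
    show "h d \<in> hom (mgrp ?R d) (mgrp M d)"
    proof (rule homI)
      fix y assume "y \<in> carrier (mgrp ?R d)"
      then obtain f where f: "arr C d c f" "mact ?R f (un c) = y" using rep(3)[OF c d] by blast
      then show "h d y \<in> carrier (mgrp M d)" using h mact_closed[OF M f(1) x] by metis
      fix z assume "z \<in> carrier (mgrp ?R d)"
      then obtain g where g: "arr C d c g" "mact ?R g (un c) = z" using rep(3)[OF c d] by blast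
      have "mact ?R (Add C f g) (un c) = y \<otimes>\<^bsub>mgrp ?R d\<^esub> z"
        using mact_Add[OF R(1) f(1) g(1) R(2)] f g by simp
      then show "h d (y \<otimes>\<^bsub>mgrp ?R d\<^esub> z) = h d y \<otimes>\<^bsub>mgrp M d\<^esub> h d z"
        using h[OF C.arr_Add[OF f(1) g(1)]] mact_Add[OF M f(1) g(1) x] h[OF f(1)] h[OF g(1)] f(2) g(2)
        by simp
    qed
  next
    fix d d' f y assume f: "arr C d d' f" and "y \<in> carrier (mgrp ?R d')"
    then obtain g where g: "arr C d' c g" "mact ?R g (un c) = y" using rep(3)[OF c] arrD(2) by metis
    have "mact ?R f y = mact ?R (g \<diamondop> f) (un c)" using mact_comp[OF R(1) f g(1) R(2)] g by simp
    then show "h d (mact ?R f y) = mact M f (h d' y)"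
      using h[OF C.arr_comp[OF f g(1)]] h[OF g(1)] mact_comp[OF M f g(1) x] g by simp
  qed
  moreover have "mapp (mk_mhom C ?R M h) c (un c) = x"
  proof -
    have "mapp (mk_mhom C ?R M h) c (un c) = h c (mact ?R (Ident C c) (un c))"
      using mapp_mk_mhom[OF c R(2)] mact_Ident[OF R(1) c R(2)] by simp
    then show ?thesis using h[OF C.arr_Ident[OF c]] mact_Ident[OF M c x] by simp
  qed
  ultimately show thesis using that by blast
qed

text \<open>Supplies the parallel pair against which domination is tested: \<open>q\<close> is the
  projection to \<open>N/S\<close> and \<open>z\<close> is the zero morphism to the same
  module.\<close>

lemma quotient_module:
  assumes N: "N \<in> Obj Md" and S: "\<And>d. d \<in> Obj C \<Longrightarrow> subgroup (S d) (mgrp N d)"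
    and act: "\<And>d d' f x. \<lbrakk>arr C d d' f; x \<in> S d'\<rbrakk> \<Longrightarrow> mact N f x \<in> S d"
  obtains L q z where "arr Md N L q" "arr Md N L z"
    "\<And>d x. \<lbrakk>d \<in> Obj C; x \<in> carrier (mgrp N d)\<rbrakk> \<Longrightarrow> mapp q d x = mapp z d x \<longleftrightarrow> x \<in> S d"
proof -
  define G where "G d = mgrp N d Mod S d" for d
  define co where "co d x = S d #>\<^bsub>mgrp N d\<^esub> x" for d x
  \<comment> \<open>A coset is acted on through an arbitrary representative. As \<open>S\<close> is
    stable under the action, the resulting coset does not depend on the choice.\<close>
  define a where "a d d' f K = co d (mact N f (SOME x. x \<in> K \<and> x \<in> carrier (mgrp N d')))"
    for d :: 'c and d' f K
  note gr = module_group[OF N]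
  have grp: "group (mgrp N d)" if "d \<in> Obj C" for d using gr[OF that] by (simp add: comm_group_def)
  have nrm: "S d \<lhd> mgrp N d" if "d \<in> Obj C" for d
    using comm_group.subgroup_imp_normal gr S that by blast
  have car: "carrier (G d) = co d ` carrier (mgrp N d)" for d
    by (simp add: G_def co_def carrier_FactGroup)
  have mul: "co d x \<otimes>\<^bsub>G d\<^esub> co d y = co d (x \<otimes>\<^bsub>mgrp N d\<^esub> y)"
    if "d \<in> Obj C" "x \<in> carrier (mgrp N d)" "y \<in> carrier (mgrp N d)" for d x y
    using normal.rcos_sum[OF nrm] that by (simp add: G_def co_def)
  have a: "a d d' f (co d' x) = co d (mact N f x)" if f: "arr C d d' f" and x: "x \<in> carrier (mgrp N d')" for d d' f x
  proof -
    have d: "d \<in> Obj C" "d' \<in> Obj C" using f by (auto dest: arrD)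
    define y where "y = (SOME y. y \<in> co d' x \<and> y \<in> carrier (mgrp N d'))"
    have "y \<in> co d' x \<and> y \<in> carrier (mgrp N d')"
      unfolding y_def using group.rcos_self[OF grp[OF d(2)] x S[OF d(2)]] x
      by (intro someI[of "\<lambda>y. y \<in> co d' x \<and> y \<in> carrier (mgrp N d')" x]) (simp add: co_def)
    then obtain h where h: "h \<in> S d'" "y = h \<otimes>\<^bsub>mgrp N d'\<^esub> x"
      by (auto simp: co_def r_coset_def)
    have hc: "h \<in> carrier (mgrp N d')" using h S[OF d(2)] subgroup.mem_carrier by metis
    have "mact N f y = mact N f h \<otimes>\<^bsub>mgrp N d\<^esub> mact N f x"
      using hom_mult[OF module_arr(2)[OF N f] hc x] h by simp
    then have "mact N f y \<in> co d (mact N f x)"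
      using act[OF f h(1)] by (auto simp: co_def r_coset_def)
    then have "co d (mact N f x) = co d (mact N f y)"
      using group.repr_independence[OF grp[OF d(1)] _ mact_closed[OF N f x] S[OF d(1)]]
      by (simp add: co_def)
    then show ?thesis by (simp add: a_def y_def)
  qed
  define L where "L = mk_module TYPE('u) C G a"
  define e where "e d = enc TYPE('u) (G d)" for d
  note cl = mact_closed[OF N]
  have Gc: "comm_group (G d)" if "d \<in> Obj C" for d
    unfolding G_def using comm_group.abelian_FactGroup gr S that by blast
  have Gs: "small TYPE('u) (carrier (G d))" if "d \<in> Obj C" for d
    unfolding car using gr(2) small_image that by blast
  have ah: "a d d' f \<in> hom (G d') (G d)" if f: "arr C d d' f" for d d' f
    using arrD(1,2)[OF f] cl[OF f] hom_mult[OF module_arr(2)[OF N f]]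
      subgroup.m_closed[OF group.subgroup_self[OF grp[OF arrD(2)[OF f]]]]
    by (auto simp: hom_def car a[OF f] mul)
  have ac: "a X Z (g \<diamondop> f) K = a X Y f (a Y Z g K)"
    if f: "arr C X Y f" and g: "arr C Y Z g" and K: "K \<in> carrier (G Z)" for X Y Z f g K
    using K a[OF f] a[OF g] a[OF C.arr_comp[OF f g]] cl[OF g] mact_comp[OF N f g] by (auto simp: car)
  have ai: "a X X (Ident C X) K = K" if X: "X \<in> Obj C" and K: "K \<in> carrier (G X)" for X K
    using K a[OF C.arr_Ident[OF X]] mact_Ident[OF N X] by (auto simp: car)
  have aa: "a X Y (Add C f g) K = a X Y f K \<otimes>\<^bsub>G X\<^esub> a X Y g K"
    if f: "arr C X Y f" and g: "arr C X Y g" and K: "K \<in> carrier (G Y)" for X Y f g K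
    using K a[OF f] a[OF g] a[OF C.arr_Add[OF f g]] cl[OF f] cl[OF g] mact_Add[OF N f g] arrD(1)[OF f]
    by (auto simp: car mul)
  note mk = mk_module[of G a, OF Gc Gs ah ac ai aa, folded L_def, folded e_def]
  have L: "L \<in> Obj Md" using mk(1) by blast
  have eiso: "e d \<in> iso (G d) (mgrp L d)" if "d \<in> Obj C" for d using mk(2) that by blast
  have eact: "mact L f (e d' x) = e d (a d d' f x)" if "arr C d d' f" "x \<in> carrier (G d')" for d d' f x
    using mk(3) that by blast
  have hc: "(\<lambda>x. e d (co d x)) \<in> hom (mgrp N d) (mgrp L d)" if d: "d \<in> Obj C" for d
    using eiso[OF d] mul[OF d] unfolding iso_def hom_def by (auto simp: car Pi_iff)
  have q: "arr Md N L (mk_mhom C N L (\<lambda>d x. e d (co d x)))"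
  proof (rule arr_mk_mhom[OF N L hc])
    show "e c (co c (mact N f x)) = mact L f (e c' (co c' x))"
      if "arr C c c' f" "x \<in> carrier (mgrp N c')" for c c' f x
      using eact[OF that(1), of "co c' x"] a[OF that] that(2) by (simp add: car)
  qed
  note Lg = module_group(1)[OF L]
  have Lgr: "group (mgrp L d)" if "d \<in> Obj C" for d using Lg[OF that] by (simp add: comm_group_def)
  have z: "arr Md N L (mk_mhom C N L (\<lambda>d x. \<one>\<^bsub>mgrp L d\<^esub>))"
  proof (rule arr_mk_mhom[OF N L])
    show "(\<lambda>x. \<one>\<^bsub>mgrp L d\<^esub>) \<in> hom (mgrp N d) (mgrp L d)" if "d \<in> Obj C" for d
      using Lgr[OF that] by (auto simp: hom_def group.is_monoid)
    show "\<one>\<^bsub>mgrp L c\<^esub> = mact L f \<one>\<^bsub>mgrp L c'\<^esub>" if "arr C c c' f" for c c' f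
      using hom_one[OF module_arr(2)[OF L that]] Lgr arrD[OF that] by simp
  qed
  have key: "e d (co d x) = \<one>\<^bsub>mgrp L d\<^esub> \<longleftrightarrow> x \<in> S d" if d: "d \<in> Obj C" and x: "x \<in> carrier (mgrp N d)" for d x
  proof -
    have gG: "group (G d)" using Gc[OF d] by (simp add: comm_group_def)
    have e1: "\<one>\<^bsub>mgrp L d\<^esub> = e d \<one>\<^bsub>G d\<^esub>"
      using hom_one[of "e d", OF _ gG Lgr[OF d]] eiso[OF d] by (simp add: iso_def)
    have "inj_on (e d) (carrier (G d))" using eiso[OF d] by (simp add: iso_def bij_betw_def)
    moreover have "\<one>\<^bsub>G d\<^esub> \<in> carrier (G d)" using gG by (simp add: group.is_monoid)
    ultimately have "e d (co d x) = \<one>\<^bsub>mgrp L d\<^esub> \<longleftrightarrow> co d x = \<one>\<^bsub>G d\<^esub>"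
      unfolding e1 using x by (auto simp: car inj_on_eq_iff)
    also have "\<dots> \<longleftrightarrow> x \<in> S d"
      using group.coset_join1[OF grp[OF d] _ x S[OF d]] group.coset_join2[OF grp[OF d] x S[OF d]]
      by (auto simp: co_def G_def)
    finally show ?thesis .
  qed
  show thesis by (rule that[OF q z]) (simp add: mapp_mk_mhom key)
qed

text \<open>The elements of a module that lie in one of the images of a directed family of morphisms form
  a submodule; the projection and the zero map to the quotient agree on all these images.\<close>

lemma rep_dominated:
  assumes W: "directed_sink Md N W" and c: "c \<in> Obj C" and x: "arr Md (rep TYPE('u) C c) N x"
    and dom: "dominated Md N W x"
  shows "\<exists>(Y, w)\<in>W. factors Md (rep TYPE('u) C c) x Y w"
proof -
  have N: "N \<in> Obj Md" using x by (rule arrD)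
  define S where "S d = (\<Union>(Y, w)\<in>W. mapp w d ` carrier (mgrp Y d))" for d
  have Wa: "arr Md Y N w" if "(Y, w) \<in> W" for Y w using W that unfolding directed_sink_def by auto
  have push: "mapp w d y \<in> mapp z d ` carrier (mgrp Z d)"
    if f: "factors Md Y w Z z" and z: "arr Md Z N z" and y: "y \<in> carrier (mgrp Y d)" and d: "d \<in> Obj C"
    for Y w Z z y d
  proof -
    obtain b where b: "arr Md Y Z b" "z \<diamondop>\<^bsub>Md\<^esub> b = w" using f by (auto simp: factors_def)
    then show ?thesis using mapp_Comp[OF b(1) z d y] mapp_closed[OF b(1) d y] by auto
  qed
  have sub: "subgroup (S d) (mgrp N d)" if d: "d \<in> Obj C" for d
  proof -
    have gN: "group (mgrp N d)" using module_group(1)[OF N d] by (simp add: comm_group_def)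
    have im: "subgroup (mapp w d ` carrier (mgrp Y d)) (mgrp N d)" if "(Y, w) \<in> W" for Y w
    proof -
      have "group_hom (mgrp Y d) (mgrp N d) (mapp w d)"
        using gN mhom_comp_eq(2)[OF Wa[OF that] d] module_group(1)[OF arrD(1)[OF Wa[OF that]] d]
        by (simp add: group_hom_def group_hom_axioms_def comm_group_def)
      then show ?thesis by (rule group_hom.img_is_subgroup)
    qed
    show ?thesis
    proof (rule group.subgroupI[OF gN])
      show "S d \<subseteq> carrier (mgrp N d)"
        unfolding S_def using im subgroup.subset by fastforce
      obtain Y w where "(Y, w) \<in> W" using W unfolding directed_sink_def by auto
      then have "\<one>\<^bsub>mgrp N d\<^esub> \<in> S d" unfolding S_def using subgroup.one_closed[OF im] by blast
      then show "S d \<noteq> {}" by blast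
    next
      fix u assume "u \<in> S d"
      then obtain Y w where w: "(Y, w) \<in> W" "u \<in> mapp w d ` carrier (mgrp Y d)" unfolding S_def by blast
      have "inv\<^bsub>mgrp N d\<^esub> u \<in> mapp w d ` carrier (mgrp Y d)" by (rule subgroup.m_inv_closed[OF im[OF w(1)] w(2)])
      then show "inv\<^bsub>mgrp N d\<^esub> u \<in> S d" unfolding S_def using w(1) by blast
    next
      fix u v assume "u \<in> S d" "v \<in> S d"
      then obtain Y w y Y' w' y' where u: "(Y, w) \<in> W" "u = mapp w d y" "y \<in> carrier (mgrp Y d)"
        and v: "(Y', w') \<in> W" "v = mapp w' d y'" "y' \<in> carrier (mgrp Y' d)" unfolding S_def by blast
      \<comment> \<open>Directedness moves both elements into the image of one member, which is a
        subgroup.\<close>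
      obtain Z z where z: "(Z, z) \<in> W" "factors Md Y w Z z" "factors Md Y' w' Z z"
        using W u(1) v(1) unfolding directed_sink_def by blast
      have "u \<in> mapp z d ` carrier (mgrp Z d)" "v \<in> mapp z d ` carrier (mgrp Z d)"
        using push[OF z(2) Wa[OF z(1)] u(3) d] push[OF z(3) Wa[OF z(1)] v(3) d] u v by simp_all
      then have "u \<otimes>\<^bsub>mgrp N d\<^esub> v \<in> mapp z d ` carrier (mgrp Z d)"
        by (rule subgroup.m_closed[OF im[OF z(1)]])
      then show "u \<otimes>\<^bsub>mgrp N d\<^esub> v \<in> S d"
        unfolding S_def using z(1) by blast
    qed
  qed
  have act: "mact N f y \<in> S d" if f: "arr C d d' f" and y: "y \<in> S d'" for d d' f y
  proof -
    obtain Y w y0 where w: "(Y, w) \<in> W" "y = mapp w d' y0" "y0 \<in> carrier (mgrp Y d')"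
      using y unfolding S_def by blast
    have "mact N f y = mapp w d (mact Y f y0)" using mapp_natural[OF Wa[OF w(1)] f w(3)] w(2) by simp
    moreover have "mact Y f y0 \<in> carrier (mgrp Y d)"
      using mact_closed[OF arrD(1)[OF Wa[OF w(1)]] f w(3)] .
    ultimately show ?thesis unfolding S_def using w(1) by blast
  qed
  obtain L q z where q: "arr Md N L q" and z: "arr Md N L z"
    and qz: "\<And>d x. \<lbrakk>d \<in> Obj C; x \<in> carrier (mgrp N d)\<rbrakk> \<Longrightarrow> mapp q d x = mapp z d x \<longleftrightarrow> x \<in> S d"
    by (rule quotient_module[OF N sub act]; (assumption | (rule that; assumption)))
  have "q \<diamondop>\<^bsub>Md\<^esub> w = z \<diamondop>\<^bsub>Md\<^esub> w" if w: "(Y, w) \<in> W" for Y w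
  proof (rule mhom_ext[OF Md.arr_comp[OF Wa[OF w] q] Md.arr_comp[OF Wa[OF w] z]])
    fix d y assume d: "d \<in> Obj C" and y: "y \<in> carrier (mgrp Y d)"
    have "mapp w d y \<in> S d" unfolding S_def using w y by blast
    then show "mapp (q \<diamondop>\<^bsub>Md\<^esub> w) d y = mapp (z \<diamondop>\<^bsub>Md\<^esub> w) d y"
      using mapp_Comp[OF Wa[OF w] q d y] mapp_Comp[OF Wa[OF w] z d y]
        qz[OF d mapp_closed[OF Wa[OF w] d y]] by simp
  qed
  \<comment> \<open>Domination puts the universal element of \<open>x\<close> into the union
    \<open>S\<close>, hence into the image of a single \<open>w\<close>; a preimage of it gives the
    factorization by the Yoneda lemma.\<close>
  then have "q \<diamondop>\<^bsub>Md\<^esub> x = z \<diamondop>\<^bsub>Md\<^esub> x" using dom q z unfolding dominated_def by blast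
  then have "mapp x c (un c) \<in> S c"
    using mapp_Comp[OF x q c rep(2)[OF c]] mapp_Comp[OF x z c rep(2)[OF c]]
      qz[OF c mapp_closed[OF x c rep(2)[OF c]]] by simp
  then obtain Y w y where w: "(Y, w) \<in> W" and y: "mapp x c (un c) = mapp w c y" "y \<in> carrier (mgrp Y c)"
    unfolding S_def by blast
  obtain s where s: "arr Md (rep TYPE('u) C c) Y s" "mapp s c (un c) = y"
    using rep_hom_ex[OF c arrD(1)[OF Wa[OF w]] y(2)] .
  have "w \<diamondop>\<^bsub>Md\<^esub> s = x"
    by (rule rep_hom_ext[OF c Md.arr_comp[OF s(1) Wa[OF w]] x])
      (use mapp_Comp[OF s(1) Wa[OF w] c rep(2)[OF c]] s y in simp)
  then show ?thesis using w s(1) unfolding factors_def by blast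
qed

text \<open>By the Yoneda lemma, composition with \<open>v\<close> on morphisms out of the
  representable at \<open>c\<close> is the component of \<open>v\<close> at \<open>c\<close>; so all
  components are bijective.\<close>

lemma rep_detects_iso:
  assumes v: "arr Md F G v"
    and bij: "\<And>c. c \<in> Obj C \<Longrightarrow>
      bij_betw (\<lambda>s. v \<diamondop>\<^bsub>Md\<^esub> s) (Hom Md (rep TYPE('u) C c) F) (Hom Md (rep TYPE('u) C c) G)"
  shows "is_isomorphism Md F G v"
proof (rule mhom_isoI[OF v])
  fix c assume c: "c \<in> Obj C"
  let ?R = "rep TYPE('u) C c"
  have FG: "F \<in> Obj Md" "G \<in> Obj Md" using v by (auto dest: arrD)
  note ev = mapp_Comp[OF _ v c rep(2)[OF c]]
  show "bij_betw (mapp v c) (carrier (mgrp F c)) (carrier (mgrp G c))"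
    unfolding bij_betw_def
  proof
    show "inj_on (mapp v c) (carrier (mgrp F c))"
    proof (rule inj_onI)
      fix x y assume x: "x \<in> carrier (mgrp F c)" and y: "y \<in> carrier (mgrp F c)" and eq: "mapp v c x = mapp v c y"
      obtain s where s: "arr Md ?R F s" "mapp s c (un c) = x" using rep_hom_ex[OF c FG(1) x] .
      obtain t where t: "arr Md ?R F t" "mapp t c (un c) = y" using rep_hom_ex[OF c FG(1) y] .
      have "v \<diamondop>\<^bsub>Md\<^esub> s = v \<diamondop>\<^bsub>Md\<^esub> t"
        by (rule rep_hom_ext[OF c Md.arr_comp[OF s(1) v] Md.arr_comp[OF t(1) v]])
          (use ev[OF s(1)] ev[OF t(1)] s t eq in simp)
      then have "s = t" using bij[OF c] s(1) t(1) unfolding bij_betw_def inj_on_def arr_def by blast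
      then show "x = y" using s t by simp
    qed
    show "mapp v c ` carrier (mgrp F c) = carrier (mgrp G c)"
    proof
      show "mapp v c ` carrier (mgrp F c) \<subseteq> carrier (mgrp G c)" using mapp_closed[OF v c] by blast
      show "carrier (mgrp G c) \<subseteq> mapp v c ` carrier (mgrp F c)"
      proof
        fix y assume y: "y \<in> carrier (mgrp G c)"
        obtain t where t: "arr Md ?R G t" "mapp t c (un c) = y" using rep_hom_ex[OF c FG(2) y] .
        then have "t \<in> (\<lambda>s. v \<diamondop>\<^bsub>Md\<^esub> s) ` Hom Md ?R F"
          using bij[OF c] unfolding bij_betw_def by (simp add: arrD(3))
        then obtain s where s: "arr Md ?R F s" "t = v \<diamondop>\<^bsub>Md\<^esub> s"
          using rep(1)[OF c] FG(1) unfolding arr_def by blast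
        then have "y = mapp v c (mapp s c (un c))" using ev[OF s(1)] t by simp
        then show "y \<in> mapp v c ` carrier (mgrp F c)"
          using mapp_closed[OF s(1) c rep(2)[OF c]] by (rule image_eqI)
      qed
    qed
  qed
qed

lemma module_generators_rep: "module_generators Md (rep TYPE('u) C ` Obj C)"
  unfolding module_generators_def
proof (intro conjI allI impI)
  show "rep TYPE('u) C ` Obj C \<subseteq> Obj Md" using rep(1) by blast
  fix F G v
  assume "arr Md F G v \<and> (\<forall>U\<in>rep TYPE('u) C ` Obj C. bij_betw (\<lambda>s. v \<diamondop>\<^bsub>Md\<^esub> s) (Hom Md U F) (Hom Md U G))"
  then show "is_isomorphism Md F G v" using rep_detects_iso[of F G v] by simp
next
  fix N W U x
  assume *: "directed_sink Md N W \<and> U \<in> rep TYPE('u) C ` Obj C \<and> arr Md U N x \<and> dominated Md N W x"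
  then obtain c where c: "c \<in> Obj C" "U = rep TYPE('u) C c" by blast
  show "\<exists>(Y, w)\<in>W. factors Md U x Y w"
    unfolding c(2) by (rule rep_dominated[of N]) (use * c in simp_all)
qed

end

subsection \<open>Equivalences and coreflections\<close>

definition fully_faithful ::
    "('o, 'm, 'x) category_scheme \<Rightarrow> ('p, 'n, 'y) category_scheme \<Rightarrow> ('o, 'm, 'p, 'n) ftor \<Rightarrow> bool" where
  "fully_faithful C D F \<longleftrightarrow> is_functor C D F \<and>
     (\<forall>X\<in>Obj C. \<forall>Y\<in>Obj C. bij_betw (ArrMap F) (Hom C X Y) (Hom D (ObjMap F X) (ObjMap F Y)))"

definition ess_surj ::
    "('o, 'm, 'x) category_scheme \<Rightarrow> ('p, 'n, 'y) category_scheme \<Rightarrow> ('o, 'm, 'p, 'n) ftor \<Rightarrow> bool" where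
  "ess_surj C D F \<longleftrightarrow> (\<forall>Y\<in>Obj D. \<exists>X\<in>Obj C. isomorphic D (ObjMap F X) Y)"

lemma ff_inj:
  "\<lbrakk>fully_faithful C D F; arr C X Y f; arr C X Y g; ArrMap F f = ArrMap F g\<rbrakk> \<Longrightarrow> f = g"
  unfolding fully_faithful_def arr_def bij_betw_def inj_on_def by blast

lemma ff_full:
  assumes "fully_faithful C D F" "X \<in> Obj C" "Y \<in> Obj C" "arr D (ObjMap F X) (ObjMap F Y) h"
  obtains f where "arr C X Y f" "ArrMap F f = h"
proof -
  have "ArrMap F ` Hom C X Y = Hom D (ObjMap F X) (ObjMap F Y)"
    using assms unfolding fully_faithful_def by (simp add: bij_betw_def)
  then have "h \<in> ArrMap F ` Hom C X Y" using arrD(3)[OF assms(4)] by simp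
  then obtain f where "f \<in> Hom C X Y" "ArrMap F f = h" by blast
  then show thesis using that assms by (simp add: arr_def)
qed

lemma ff_functor: "fully_faithful C D F \<Longrightarrow> is_functor C D F"
  by (simp add: fully_faithful_def)

lemma naturally_isomorphicE:
  assumes "naturally_isomorphic C D F G"
  obtains \<eta> where "\<And>X. X \<in> Obj C \<Longrightarrow> is_isomorphism D (ObjMap F X) (ObjMap G X) (\<eta> X)"
    "\<And>X Y f. arr C X Y f \<Longrightarrow> \<eta> Y \<diamondop>\<^bsub>D\<^esub> ArrMap F f = ArrMap G f \<diamondop>\<^bsub>D\<^esub> \<eta> X"
  using assms unfolding naturally_isomorphic_def is_natural_def arr_def by blast

lemma (in category) iso_cancel_right:
  assumes e: "is_isomorphism C X Y e" and f: "arr C Y Z f" and g: "arr C Y Z g" and X: "X \<in> Obj C"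
    and eq: "f \<diamondop> e = g \<diamondop> e"
  shows "f = g"
proof -
  obtain e' where e': "arr C X Y e" "arr C Y X e'" "e' \<diamondop> e = Ident C X" "e \<diamondop> e' = Ident C Y"
    using isomorphismE[OF e X arrD(1)[OF f]] by blast
  have "(f \<diamondop> e) \<diamondop> e' = (g \<diamondop> e) \<diamondop> e'" using eq by simp
  then show ?thesis using assoc[OF e'(2,1) f] assoc[OF e'(2,1) g] e' f g by simp
qed

lemma (in category) iso_cancel_left:
  assumes e: "is_isomorphism C Y Z e" and f: "arr C X Y f" and g: "arr C X Y g" and Z: "Z \<in> Obj C"
    and eq: "e \<diamondop> f = e \<diamondop> g"
  shows "f = g"
proof -
  obtain e' where e': "arr C Y Z e" "arr C Z Y e'" "e' \<diamondop> e = Ident C Y" "e \<diamondop> e' = Ident C Z"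
    using isomorphismE[OF e arrD(2)[OF f] Z] by blast
  have "e' \<diamondop> (e \<diamondop> f) = e' \<diamondop> (e \<diamondop> g)" using eq by simp
  then show ?thesis using assoc[OF f e'(1,2)] assoc[OF g e'(1,2)] e' f g by simp
qed

text \<open>Naturality of \<eta> and \<epsilon> makes \<open>F\<close> and \<open>G\<close>
  faithful, as isomorphisms can be cancelled. For fullness, \<open>h\<close> is sent through
  \<open>G\<close> and conjugated by \<eta>; the resulting \<open>f\<close> satisfies G(F f) = G h,
  and faithfulness of \<open>G\<close> concludes.\<close>

lemma equivalence_imp_ff:
  assumes C: "category C" and D: "category D" and eq: "equivalent_categories C D"
  obtains F where "fully_faithful C D F" "ess_surj C D F"
proof -
  interpret C: category C by fact
  interpret D: category D by fact
  obtain F G where F: "is_functor C D F" and G: "is_functor D C G"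
    and GF: "naturally_isomorphic C C (comp_functor G F) id_functor"
    and FG: "naturally_isomorphic D D (comp_functor F G) id_functor"
    using eq unfolding equivalent_categories_def by blast
  note defs = comp_functor_def id_functor_def
  obtain \<eta> where \<eta>: "\<And>X. X \<in> Obj C \<Longrightarrow> is_isomorphism C (ObjMap G (ObjMap F X)) X (\<eta> X)"
    and \<eta>n: "\<And>X Y f. arr C X Y f \<Longrightarrow> \<eta> Y \<diamondop>\<^bsub>C\<^esub> ArrMap G (ArrMap F f) = f \<diamondop>\<^bsub>C\<^esub> \<eta> X"
    using naturally_isomorphicE[OF GF] unfolding defs by (metis comp_apply ftor.select_convs)
  obtain \<epsilon> where \<epsilon>: "\<And>Y. Y \<in> Obj D \<Longrightarrow> is_isomorphism D (ObjMap F (ObjMap G Y)) Y (\<epsilon> Y)"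
    and \<epsilon>n: "\<And>X Y f. arr D X Y f \<Longrightarrow> \<epsilon> Y \<diamondop>\<^bsub>D\<^esub> ArrMap F (ArrMap G f) = f \<diamondop>\<^bsub>D\<^esub> \<epsilon> X"
    using naturally_isomorphicE[OF FG] unfolding defs by (metis comp_apply ftor.select_convs)
  have GFO: "ObjMap G (ObjMap F X) \<in> Obj C" if "X \<in> Obj C" for X
    using functor_Obj F G that by metis
  have FGO: "ObjMap F (ObjMap G Y) \<in> Obj D" if "Y \<in> Obj D" for Y
    using functor_Obj F G that by metis
  have F_inj: "f = g" if f: "arr C X Y f" and g: "arr C X Y g" and eq: "ArrMap F f = ArrMap F g" for X Y f g
    using C.iso_cancel_right[OF \<eta> f g GFO] \<eta>n[OF f] \<eta>n[OF g] eq arrD(1)[OF f] by simp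
  have G_inj: "f = g" if f: "arr D X Y f" and g: "arr D X Y g" and eq: "ArrMap G f = ArrMap G g" for X Y f g
    using D.iso_cancel_right[OF \<epsilon> f g FGO] \<epsilon>n[OF f] \<epsilon>n[OF g] eq arrD(1)[OF f] by simp
  have full: "\<exists>f. arr C X Y f \<and> ArrMap F f = h"
    if X: "X \<in> Obj C" and Y: "Y \<in> Obj C" and h: "arr D (ObjMap F X) (ObjMap F Y) h" for X Y h
  proof -
    obtain i where i: "arr C (ObjMap G (ObjMap F X)) X (\<eta> X)" "arr C X (ObjMap G (ObjMap F X)) i"
      "i \<diamondop>\<^bsub>C\<^esub> \<eta> X = Ident C (ObjMap G (ObjMap F X))" "\<eta> X \<diamondop>\<^bsub>C\<^esub> i = Ident C X"
      using C.isomorphismE[OF \<eta>[OF X] GFO[OF X] X] by blast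
    have eY: "arr C (ObjMap G (ObjMap F Y)) Y (\<eta> Y)"
      using C.isomorphismE[OF \<eta>[OF Y] GFO[OF Y] Y] by blast
    have Gh: "arr C (ObjMap G (ObjMap F X)) (ObjMap G (ObjMap F Y)) (ArrMap G h)"
      by (rule functor_arr[OF G h])
    note k = C.arr_comp[OF Gh eY]
    define f where "f = (\<eta> Y \<diamondop>\<^bsub>C\<^esub> ArrMap G h) \<diamondop>\<^bsub>C\<^esub> i"
    have f: "arr C X Y f" unfolding f_def by (rule C.arr_comp[OF i(2) k])
    have "\<eta> Y \<diamondop>\<^bsub>C\<^esub> ArrMap G (ArrMap F f) = f \<diamondop>\<^bsub>C\<^esub> \<eta> X" by (rule \<eta>n[OF f])
    also have "\<dots> = \<eta> Y \<diamondop>\<^bsub>C\<^esub> ArrMap G h" unfolding f_def C.assoc[OF i(1,2) k] i(3) using k by simp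
    finally have "ArrMap G (ArrMap F f) = ArrMap G h"
      using C.iso_cancel_left[OF \<eta>[OF Y] functor_arr[OF G functor_arr[OF F f]] Gh Y] by simp
    then have "ArrMap F f = h" using G_inj[OF functor_arr[OF F f] h] by simp
    then show ?thesis using f by blast
  qed
  have "fully_faithful C D F"
    unfolding fully_faithful_def bij_betw_def
  proof (intro conjI ballI F)
    fix X Y assume XY: "X \<in> Obj C" "Y \<in> Obj C"
    show "inj_on (ArrMap F) (Hom C X Y)" using F_inj XY unfolding inj_on_def arr_def by blast
    show "ArrMap F ` Hom C X Y = Hom D (ObjMap F X) (ObjMap F Y)"
    proof (intro equalityI subsetI)
      fix h assume "h \<in> ArrMap F ` Hom C X Y"
      then show "h \<in> Hom D (ObjMap F X) (ObjMap F Y)" using functor_arr[OF F] XY by (auto simp: arr_def)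
    next
      fix h assume "h \<in> Hom D (ObjMap F X) (ObjMap F Y)"
      then have "arr D (ObjMap F X) (ObjMap F Y) h" using functor_Obj[OF F] XY by (simp add: arr_def)
      then show "h \<in> ArrMap F ` Hom C X Y" using full[OF XY] by (auto simp: arr_def)
    qed
  qed
  moreover have "ess_surj C D F"
    unfolding ess_surj_def isomorphic_def using functor_Obj[OF G] \<epsilon> by blast
  ultimately show thesis using that by blast
qed

lemma ff_imp_equivalence:
  assumes C: "category C" and D: "category D" and F: "fully_faithful C D F" and es: "ess_surj C D F"
  shows "equivalent_categories C D"
proof -
  interpret C: category C by fact
  interpret D: category D by fact
  note Ff = ff_functor[OF F]
  define gob where "gob Y = (SOME X. X \<in> Obj C \<and> isomorphic D (ObjMap F X) Y)" for Y
  have gob: "gob Y \<in> Obj C" "isomorphic D (ObjMap F (gob Y)) Y" if "Y \<in> Obj D" for Y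
    using someI_ex[of "\<lambda>X. X \<in> Obj C \<and> isomorphic D (ObjMap F X) Y"] es that
    unfolding gob_def ess_surj_def by blast+
  have "\<forall>Y. \<exists>e e'. Y \<in> Obj D \<longrightarrow> arr D (ObjMap F (gob Y)) Y e \<and> arr D Y (ObjMap F (gob Y)) e' \<and>
     e' \<diamondop>\<^bsub>D\<^esub> e = Ident D (ObjMap F (gob Y)) \<and> e \<diamondop>\<^bsub>D\<^esub> e' = Ident D Y"
    using gob functor_Obj[OF Ff] D.isomorphismE unfolding isomorphic_def by metis
  then obtain \<epsilon> \<epsilon>' where \<epsilon>: "\<And>Y. Y \<in> Obj D \<Longrightarrow> arr D (ObjMap F (gob Y)) Y (\<epsilon> Y)"
    and \<epsilon>': "\<And>Y. Y \<in> Obj D \<Longrightarrow> arr D Y (ObjMap F (gob Y)) (\<epsilon>' Y)"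
    and \<epsilon>\<epsilon>: "\<And>Y. Y \<in> Obj D \<Longrightarrow> \<epsilon>' Y \<diamondop>\<^bsub>D\<^esub> \<epsilon> Y = Ident D (ObjMap F (gob Y))"
      "\<And>Y. Y \<in> Obj D \<Longrightarrow> \<epsilon> Y \<diamondop>\<^bsub>D\<^esub> \<epsilon>' Y = Ident D Y" by metis
  have \<epsilon>iso: "is_isomorphism D (ObjMap F (gob Y)) Y (\<epsilon> Y)" if "Y \<in> Obj D" for Y
    using D.isomorphismI \<epsilon> \<epsilon>' \<epsilon>\<epsilon> that by metis
  \<comment> \<open>The arrow map sees only \<open>g\<close>, so the choice ranges over its
    endpoints as well; they are unique because hom sets are disjoint.\<close>
  define garr where "garr g = (SOME f. \<exists>Y Y'. arr D Y Y' g \<and> arr C (gob Y) (gob Y') f \<and>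
     \<epsilon> Y' \<diamondop>\<^bsub>D\<^esub> ArrMap F f = g \<diamondop>\<^bsub>D\<^esub> \<epsilon> Y)" for g
  have garr: "arr C (gob Y) (gob Y') (garr g)" "\<epsilon> Y' \<diamondop>\<^bsub>D\<^esub> ArrMap F (garr g) = g \<diamondop>\<^bsub>D\<^esub> \<epsilon> Y"
    if g: "arr D Y Y' g" for Y Y' g
  proof -
    have Y: "Y \<in> Obj D" "Y' \<in> Obj D" using g by (auto dest: arrD)
    have h: "arr D (ObjMap F (gob Y)) Y' (g \<diamondop>\<^bsub>D\<^esub> \<epsilon> Y)" using g \<epsilon>[OF Y(1)] by auto
    have h': "arr D (ObjMap F (gob Y)) (ObjMap F (gob Y')) (\<epsilon>' Y' \<diamondop>\<^bsub>D\<^esub> g \<diamondop>\<^bsub>D\<^esub> \<epsilon> Y)"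
      using h \<epsilon>'[OF Y(2)] by auto
    obtain f where f: "arr C (gob Y) (gob Y') f" "ArrMap F f = \<epsilon>' Y' \<diamondop>\<^bsub>D\<^esub> g \<diamondop>\<^bsub>D\<^esub> \<epsilon> Y"
      using ff_full[OF F gob(1)[OF Y(1)] gob(1)[OF Y(2)] h'] .
    have "\<epsilon> Y' \<diamondop>\<^bsub>D\<^esub> ArrMap F f = g \<diamondop>\<^bsub>D\<^esub> \<epsilon> Y"
      using f(2) D.assoc[OF h \<epsilon>'[OF Y(2)] \<epsilon>[OF Y(2)]] \<epsilon>\<epsilon>(2)[OF Y(2)] h by simp
    then have "\<exists>f Y Y'. arr D Y Y' g \<and> arr C (gob Y) (gob Y') f \<and> \<epsilon> Y' \<diamondop>\<^bsub>D\<^esub> ArrMap F f = g \<diamondop>\<^bsub>D\<^esub> \<epsilon> Y"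
      using g f by blast
    from someI_ex[OF this] obtain Z Z' where Z: "arr D Z Z' g" "arr C (gob Z) (gob Z') (garr g)"
      "\<epsilon> Z' \<diamondop>\<^bsub>D\<^esub> ArrMap F (garr g) = g \<diamondop>\<^bsub>D\<^esub> \<epsilon> Z" unfolding garr_def by blast
    moreover have "Z = Y" "Z' = Y'" using D.arr_unique Z(1) g by blast+
    ultimately show "arr C (gob Y) (gob Y') (garr g)" "\<epsilon> Y' \<diamondop>\<^bsub>D\<^esub> ArrMap F (garr g) = g \<diamondop>\<^bsub>D\<^esub> \<epsilon> Y"
      by simp_all
  qed
  have garr_eq: "garr g = f" if g: "arr D Y Y' g" and f: "arr C (gob Y) (gob Y') f"
    and eq: "\<epsilon> Y' \<diamondop>\<^bsub>D\<^esub> ArrMap F f = g \<diamondop>\<^bsub>D\<^esub> \<epsilon> Y" for Y Y' g f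
  proof -
    have Y: "Y' \<in> Obj D" using g by (rule arrD)
    have "ArrMap F (garr g) = ArrMap F f"
      using D.iso_cancel_left[OF \<epsilon>iso[OF Y] functor_arr[OF Ff garr(1)[OF g]] functor_arr[OF Ff f] Y]
        garr(2)[OF g] eq by simp
    then show ?thesis using ff_inj[OF F garr(1)[OF g] f] by simp
  qed
  define G where "G = \<lparr>ObjMap = gob, ArrMap = garr\<rparr>"
  have G: "is_functor D C G"
    unfolding is_functor_def G_def
  proof (intro conjI ballI; simp)
    fix Y assume Y: "Y \<in> Obj D"
    show "gob Y \<in> Obj C" by (rule gob(1)[OF Y])
    show "garr (Ident D Y) = Ident C (gob Y)"
      by (rule garr_eq[of Y Y]) (use Y gob(1)[OF Y] \<epsilon>[OF Y] functor_Ident[OF Ff gob(1)[OF Y]] in auto)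
  next
    fix X Y f assume "X \<in> Obj D" "Y \<in> Obj D" "f \<in> Hom D X Y"
    then show "garr f \<in> Hom C (gob X) (gob Y)" using garr(1) by (simp add: arr_def)
  next
    fix X Y Z f g assume "X \<in> Obj D" "Y \<in> Obj D" "Z \<in> Obj D" "f \<in> Hom D X Y" "g \<in> Hom D Y Z"
    then have f: "arr D X Y f" and g: "arr D Y Z g" and o: "X \<in> Obj D" "Y \<in> Obj D" "Z \<in> Obj D"
      by (auto simp: arr_def)
    note f' = garr[OF f] and g' = garr[OF g]
    note Ff' = functor_arr[OF Ff f'(1)] and Fg' = functor_arr[OF Ff g'(1)]
    show "garr (g \<diamondop>\<^bsub>D\<^esub> f) = garr g \<diamondop>\<^bsub>C\<^esub> garr f"
    proof (rule garr_eq[OF D.arr_comp[OF f g] C.arr_comp[OF f'(1) g'(1)]])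
      have "\<epsilon> Z \<diamondop>\<^bsub>D\<^esub> ArrMap F (garr g \<diamondop>\<^bsub>C\<^esub> garr f) = (g \<diamondop>\<^bsub>D\<^esub> \<epsilon> Y) \<diamondop>\<^bsub>D\<^esub> ArrMap F (garr f)"
        using functor_comp[OF Ff f'(1) g'(1)] D.assoc[OF Ff' Fg' \<epsilon>[OF o(3)]] g'(2) by simp
      also have "\<dots> = (g \<diamondop>\<^bsub>D\<^esub> f) \<diamondop>\<^bsub>D\<^esub> \<epsilon> X"
        using D.assoc[OF Ff' \<epsilon>[OF o(2)] g] D.assoc[OF \<epsilon>[OF o(1)] f g] f'(2) by simp
      finally show "\<epsilon> Z \<diamondop>\<^bsub>D\<^esub> ArrMap F (garr g \<diamondop>\<^bsub>C\<^esub> garr f) = (g \<diamondop>\<^bsub>D\<^esub> f) \<diamondop>\<^bsub>D\<^esub> \<epsilon> X" .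
    qed
  qed
  have FG: "naturally_isomorphic D D (comp_functor F G) id_functor"
    unfolding naturally_isomorphic_def is_natural_def comp_functor_def id_functor_def G_def
    using \<epsilon> \<epsilon>iso garr(2) by (intro exI[of _ \<epsilon>]) (auto simp: arr_def)
  \<comment> \<open>The isomorphism from G(F X) to \<open>X\<close> is the preimage under
    \<open>F\<close> of \<epsilon> at \<open>F X\<close>.\<close>
  have "\<forall>X. \<exists>h. X \<in> Obj C \<longrightarrow> arr C (gob (ObjMap F X)) X h \<and> ArrMap F h = \<epsilon> (ObjMap F X)"
    using ff_full[OF F gob(1)[OF functor_Obj[OF Ff]] _ \<epsilon>[OF functor_Obj[OF Ff]]] by metis
  then obtain \<eta> where \<eta>: "\<And>X. X \<in> Obj C \<Longrightarrow> arr C (gob (ObjMap F X)) X (\<eta> X)"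
    and F\<eta>: "\<And>X. X \<in> Obj C \<Longrightarrow> ArrMap F (\<eta> X) = \<epsilon> (ObjMap F X)" by metis
  have \<eta>iso: "is_isomorphism C (gob (ObjMap F X)) X (\<eta> X)" if X: "X \<in> Obj C" for X
  proof -
    have FX: "ObjMap F X \<in> Obj D" by (rule functor_Obj[OF Ff X])
    obtain k where k: "arr C X (gob (ObjMap F X)) k" "ArrMap F k = \<epsilon>' (ObjMap F X)"
      using ff_full[OF F X gob(1)[OF FX] \<epsilon>'[OF FX]] .
    show ?thesis
    proof (rule C.isomorphismI[OF \<eta>[OF X] k(1)])
      show "k \<diamondop>\<^bsub>C\<^esub> \<eta> X = Ident C (gob (ObjMap F X))"
        using ff_inj[OF F C.arr_comp[OF \<eta>[OF X] k(1)] C.arr_Ident[OF gob(1)[OF FX]]]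
          functor_comp[OF Ff \<eta>[OF X] k(1)] F\<eta>[OF X] k(2) \<epsilon>\<epsilon>(1)[OF FX] functor_Ident[OF Ff gob(1)[OF FX]] by simp
      show "\<eta> X \<diamondop>\<^bsub>C\<^esub> k = Ident C X"
        using ff_inj[OF F C.arr_comp[OF k(1) \<eta>[OF X]] C.arr_Ident[OF X]]
          functor_comp[OF Ff k(1) \<eta>[OF X]] F\<eta>[OF X] k(2) \<epsilon>\<epsilon>(2)[OF FX] functor_Ident[OF Ff X] by simp
    qed
  qed
  have \<eta>nat: "\<eta> Y \<diamondop>\<^bsub>C\<^esub> garr (ArrMap F f) = f \<diamondop>\<^bsub>C\<^esub> \<eta> X" if f: "arr C X Y f" for X Y f
  proof -
    have o: "X \<in> Obj C" "Y \<in> Obj C" using f by (auto dest: arrD)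
    note g = garr[OF functor_arr[OF Ff f]]
    show ?thesis
      using ff_inj[OF F C.arr_comp[OF g(1) \<eta>[OF o(2)]] C.arr_comp[OF \<eta>[OF o(1)] f]]
        functor_comp[OF Ff g(1) \<eta>[OF o(2)]] functor_comp[OF Ff \<eta>[OF o(1)] f] F\<eta> o g(2) by simp
  qed
  have GF: "naturally_isomorphic C C (comp_functor G F) id_functor"
    unfolding naturally_isomorphic_def is_natural_def comp_functor_def id_functor_def G_def
    using \<eta> \<eta>iso \<eta>nat by (intro exI[of _ \<eta>]) (auto simp: arr_def)
  show ?thesis unfolding equivalent_categories_def using Ff G GF FG by blast
qed

text \<open>\<open>h\<close> picks objects with \<open>F (h V)\<close> isomorphic to
  \<open>V\<close>. Morphisms from \<open>h V\<close> to \<open>X\<close> then correspond to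
  morphisms from \<open>V\<close> to \<open>F X\<close> (\<open>lift\<close> and \<open>inj\<close>
  below), which carries bijectivity and factorizations across.\<close>

lemma module_generators_transfer:
  assumes C: "category C" and D: "category D" and F: "fully_faithful C D F" and es: "ess_surj C D F"
    and gen: "module_generators D \<V>"
  obtains h where "module_generators C (h ` \<V>)"
proof -
  interpret C: category C by fact
  interpret D: category D by fact
  note Ff = ff_functor[OF F]
  note gV = module_generatorsD(1)[OF gen]
  have ex: "\<exists>X e. X \<in> Obj C \<and> is_isomorphism D (ObjMap F X) Y e" if "Y \<in> Obj D" for Y
    using es that unfolding ess_surj_def isomorphic_def by blast
  have "\<forall>V. \<exists>U e e'. V \<in> Obj D \<longrightarrow> U \<in> Obj C \<and> arr D (ObjMap F U) V e \<and> arr D V (ObjMap F U) e' \<and>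
     e' \<diamondop>\<^bsub>D\<^esub> e = Ident D (ObjMap F U) \<and> e \<diamondop>\<^bsub>D\<^esub> e' = Ident D V"
    using ex functor_Obj[OF Ff] D.isomorphismE by metis
  then obtain h \<theta> \<theta>' where h0: "\<And>V. V \<in> Obj D \<Longrightarrow> h V \<in> Obj C \<and> arr D (ObjMap F (h V)) V (\<theta> V) \<and>
     arr D V (ObjMap F (h V)) (\<theta>' V) \<and> \<theta>' V \<diamondop>\<^bsub>D\<^esub> \<theta> V = Ident D (ObjMap F (h V)) \<and> \<theta> V \<diamondop>\<^bsub>D\<^esub> \<theta>' V = Ident D V"
    by metis
  have h: "h V \<in> Obj C" "arr D (ObjMap F (h V)) V (\<theta> V)" "arr D V (ObjMap F (h V)) (\<theta>' V)"
    "\<theta>' V \<diamondop>\<^bsub>D\<^esub> \<theta> V = Ident D (ObjMap F (h V))" "\<theta> V \<diamondop>\<^bsub>D\<^esub> \<theta>' V = Ident D V" if "V \<in> \<V>" for V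
    using h0 gV that by blast+
  have lift: "\<exists>s. arr C (h V) X s \<and> ArrMap F s \<diamondop>\<^bsub>D\<^esub> \<theta>' V = t"
    if V: "V \<in> \<V>" and X: "X \<in> Obj C" and t: "arr D V (ObjMap F X) t" for V X t
  proof -
    obtain s where s: "arr C (h V) X s" "ArrMap F s = t \<diamondop>\<^bsub>D\<^esub> \<theta> V"
      using ff_full[OF F h(1)[OF V] X D.arr_comp[OF h(2)[OF V] t]] .
    then show ?thesis using D.assoc[OF h(3)[OF V] h(2)[OF V] t] h(5)[OF V] t by auto
  qed
  have \<theta>'iso: "is_isomorphism D V (ObjMap F (h V)) (\<theta>' V)" if "V \<in> \<V>" for V
    using D.isomorphismI h that by metis
  have inj: "s = t" if V: "V \<in> \<V>" and s: "arr C (h V) X s" and t: "arr C (h V) X t"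
    and eq: "ArrMap F s \<diamondop>\<^bsub>D\<^esub> \<theta>' V = ArrMap F t \<diamondop>\<^bsub>D\<^esub> \<theta>' V" for V X s t
    using D.iso_cancel_right[OF \<theta>'iso[OF V] functor_arr[OF Ff s] functor_arr[OF Ff t] _ eq] gV V
      ff_inj[OF F s t] by blast
  have det: "is_isomorphism C X Y v"
    if v: "arr C X Y v" and bij: "\<And>V. V \<in> \<V> \<Longrightarrow> bij_betw (\<lambda>s. v \<diamondop>\<^bsub>C\<^esub> s) (Hom C (h V) X) (Hom C (h V) Y)" for X Y v
  proof -
    have XY: "X \<in> Obj C" "Y \<in> Obj C" using v by (auto dest: arrD)
    note Fv = functor_arr[OF Ff v]
    have bijD: "bij_betw (\<lambda>t. ArrMap F v \<diamondop>\<^bsub>D\<^esub> t) (Hom D V (ObjMap F X)) (Hom D V (ObjMap F Y))"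
      if V: "V \<in> \<V>" for V
    proof -
      have VD: "V \<in> Obj D" using V gV by blast
      have push: "ArrMap F v \<diamondop>\<^bsub>D\<^esub> (ArrMap F s \<diamondop>\<^bsub>D\<^esub> \<theta>' V) = ArrMap F (v \<diamondop>\<^bsub>C\<^esub> s) \<diamondop>\<^bsub>D\<^esub> \<theta>' V" if "arr C (h V) X s" for s
        using D.assoc[OF h(3)[OF V] functor_arr[OF Ff that] Fv] functor_comp[OF Ff that v] by simp
      show ?thesis
        unfolding bij_betw_def
      proof
        show "inj_on (\<lambda>t. ArrMap F v \<diamondop>\<^bsub>D\<^esub> t) (Hom D V (ObjMap F X))"
        proof (rule inj_onI)
          fix t t' assume "t \<in> Hom D V (ObjMap F X)" "t' \<in> Hom D V (ObjMap F X)"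
            and eq: "ArrMap F v \<diamondop>\<^bsub>D\<^esub> t = ArrMap F v \<diamondop>\<^bsub>D\<^esub> t'"
          then have t: "arr D V (ObjMap F X) t" "arr D V (ObjMap F X) t'"
            using VD functor_Obj[OF Ff XY(1)] by (simp_all add: arr_def)
          obtain s where s: "arr C (h V) X s" "ArrMap F s \<diamondop>\<^bsub>D\<^esub> \<theta>' V = t" using lift[OF V XY(1) t(1)] by blast
          obtain s' where s': "arr C (h V) X s'" "ArrMap F s' \<diamondop>\<^bsub>D\<^esub> \<theta>' V = t'" using lift[OF V XY(1) t(2)] by blast
          have "v \<diamondop>\<^bsub>C\<^esub> s = v \<diamondop>\<^bsub>C\<^esub> s'"
            by (rule inj[OF V C.arr_comp[OF s(1) v] C.arr_comp[OF s'(1) v]])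
              (use push[OF s(1)] push[OF s'(1)] s s' eq in simp)
          then have "s = s'" using bij[OF V] s(1) s'(1) unfolding bij_betw_def inj_on_def arr_def by blast
          then show "t = t'" using s s' by simp
        qed
        show "(\<lambda>t. ArrMap F v \<diamondop>\<^bsub>D\<^esub> t) ` Hom D V (ObjMap F X) = Hom D V (ObjMap F Y)"
        proof (intro equalityI subsetI)
          fix y assume "y \<in> (\<lambda>t. ArrMap F v \<diamondop>\<^bsub>D\<^esub> t) ` Hom D V (ObjMap F X)"
          then show "y \<in> Hom D V (ObjMap F Y)" using D.arr_comp[OF _ Fv] VD Fv unfolding arr_def by blast
        next
          fix y assume "y \<in> Hom D V (ObjMap F Y)"
          then have y: "arr D V (ObjMap F Y) y" using VD functor_Obj[OF Ff XY(2)] by (simp add: arr_def)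
          obtain s where s: "arr C (h V) Y s" "ArrMap F s \<diamondop>\<^bsub>D\<^esub> \<theta>' V = y" using lift[OF V XY(2) y] by blast
          then have "s \<in> (\<lambda>s. v \<diamondop>\<^bsub>C\<^esub> s) ` Hom C (h V) X" using bij[OF V] by (simp add: bij_betw_def arr_def)
          then obtain r where r: "arr C (h V) X r" "s = v \<diamondop>\<^bsub>C\<^esub> r" using h(1)[OF V] XY by (auto simp: arr_def)
          have "ArrMap F r \<diamondop>\<^bsub>D\<^esub> \<theta>' V \<in> Hom D V (ObjMap F X)"
            using D.arr_comp[OF h(3)[OF V] functor_arr[OF Ff r(1)]] by (rule arrD)
          moreover have "y = ArrMap F v \<diamondop>\<^bsub>D\<^esub> (ArrMap F r \<diamondop>\<^bsub>D\<^esub> \<theta>' V)" using push[OF r(1)] r s by simp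
          ultimately show "y \<in> (\<lambda>t. ArrMap F v \<diamondop>\<^bsub>D\<^esub> t) ` Hom D V (ObjMap F X)" by (rule rev_image_eqI)
        qed
      qed
    qed
    have "is_isomorphism D (ObjMap F X) (ObjMap F Y) (ArrMap F v)"
      by (rule module_generatorsD(2)[OF gen Fv bijD])
    then obtain w' where w': "arr D (ObjMap F Y) (ObjMap F X) w'"
      "w' \<diamondop>\<^bsub>D\<^esub> ArrMap F v = Ident D (ObjMap F X)" "ArrMap F v \<diamondop>\<^bsub>D\<^esub> w' = Ident D (ObjMap F Y)"
      using D.isomorphismE functor_Obj[OF Ff] XY by metis
    obtain w where w: "arr C Y X w" "ArrMap F w = w'" using ff_full[OF F XY(2,1) w'(1)] .
    show ?thesis
    proof (rule C.isomorphismI[OF v w(1)])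
      show "w \<diamondop>\<^bsub>C\<^esub> v = Ident C X"
        by (rule ff_inj[OF F C.arr_comp[OF v w(1)] C.arr_Ident[OF XY(1)]])
          (use functor_comp[OF Ff v w(1)] functor_Ident[OF Ff XY(1)] w w' in simp)
      show "v \<diamondop>\<^bsub>C\<^esub> w = Ident C Y"
        by (rule ff_inj[OF F C.arr_comp[OF w(1) v] C.arr_Ident[OF XY(2)]])
          (use functor_comp[OF Ff w(1) v] functor_Ident[OF Ff XY(2)] w w' in simp)
    qed
  qed
  have dom: "\<exists>(Y, w)\<in>W. factors C (h V) x Y w"
    if W: "directed_sink C X W" and V: "V \<in> \<V>" and x: "arr C (h V) X x" and dm: "dominated C X W x" for X W V x
  proof -
    have X: "X \<in> Obj C" using x by (rule arrD)
    have Wa: "arr C Y X w" if "(Y, w) \<in> W" for Y w using W that unfolding directed_sink_def by auto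
    let ?W = "(\<lambda>(Y, w). (ObjMap F Y, ArrMap F w)) ` W"
    have fac: "factors D (ObjMap F Y) (ArrMap F w) (ObjMap F Z) (ArrMap F z)"
      if f: "factors C Y w Z z" and z: "arr C Z X z" for Y w Z z
    proof -
      obtain a where a: "arr C Y Z a" "z \<diamondop>\<^bsub>C\<^esub> a = w" using f by (auto simp: factors_def)
      then show ?thesis
        unfolding factors_def using functor_arr[OF Ff a(1)] functor_comp[OF Ff a(1) z] by auto
    qed
    have W': "directed_sink D (ObjMap F X) ?W"
      unfolding directed_sink_def
    proof (intro conjI ballI; clarsimp)
      assume "W = {}" then show False using W by (simp add: directed_sink_def)
    next
      fix Y w assume "(Y, w) \<in> W"
      then show "arr D (ObjMap F Y) (ObjMap F X) (ArrMap F w)" using Wa functor_arr[OF Ff] by blast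
    next
      fix Y w Y' w' assume "(Y, w) \<in> W" "(Y', w') \<in> W"
      then obtain Z z where z: "(Z, z) \<in> W" "factors C Y w Z z" "factors C Y' w' Z z"
        using W unfolding directed_sink_def by blast
      then show "\<exists>p\<in>W. case case p of (Y, w) \<Rightarrow> (ObjMap F Y, ArrMap F w) of (Z, z) \<Rightarrow>
          factors D (ObjMap F Y) (ArrMap F w) Z z \<and> factors D (ObjMap F Y') (ArrMap F w') Z z"
        using fac Wa by (intro bexI[of _ "(Z, z)"]) auto
    qed
    let ?x = "ArrMap F x \<diamondop>\<^bsub>D\<^esub> \<theta>' V"
    note Fx = functor_arr[OF Ff x]
    have x': "arr D V (ObjMap F X) ?x" using h(3)[OF V] Fx by auto
    have "dominated D (ObjMap F X) ?W ?x"
      unfolding dominated_def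
    proof (intro allI impI)
      fix L g g' assume *: "arr D (ObjMap F X) L g \<and> arr D (ObjMap F X) L g' \<and> (\<forall>(Y, w)\<in>?W. g \<diamondop>\<^bsub>D\<^esub> w = g' \<diamondop>\<^bsub>D\<^esub> w)"
      then have g: "arr D (ObjMap F X) L g" "arr D (ObjMap F X) L g'"
        and gw: "\<And>Y w. (Y, w) \<in> W \<Longrightarrow> g \<diamondop>\<^bsub>D\<^esub> ArrMap F w = g' \<diamondop>\<^bsub>D\<^esub> ArrMap F w" by auto
      have L: "L \<in> Obj D" using g by (auto dest: arrD)
      \<comment> \<open>The test object \<open>L\<close> may lie outside the image of
        \<open>F\<close>; it is replaced by an isomorphic \<open>F M\<close>, so that
        \<open>g\<close> and \<open>g'\<close> descend to morphisms of \<open>C\<close>.\<close>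
      obtain M e where M: "M \<in> Obj C" and e: "is_isomorphism D (ObjMap F M) L e" using ex[OF L] by blast
      obtain e' where e': "arr D (ObjMap F M) L e" "arr D L (ObjMap F M) e'" "e \<diamondop>\<^bsub>D\<^esub> e' = Ident D L"
        "e' \<diamondop>\<^bsub>D\<^esub> e = Ident D (ObjMap F M)"
        using D.isomorphismE[OF e functor_Obj[OF Ff M] L] by blast
      obtain k where k: "arr C X M k" "ArrMap F k = e' \<diamondop>\<^bsub>D\<^esub> g"
        using ff_full[OF F X M D.arr_comp[OF g(1) e'(2)]] .
      obtain k' where k': "arr C X M k'" "ArrMap F k' = e' \<diamondop>\<^bsub>D\<^esub> g'"
        using ff_full[OF F X M D.arr_comp[OF g(2) e'(2)]] .
      have "k \<diamondop>\<^bsub>C\<^esub> w = k' \<diamondop>\<^bsub>C\<^esub> w" if w: "(Y, w) \<in> W" for Y w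
        by (rule ff_inj[OF F C.arr_comp[OF Wa[OF w] k(1)] C.arr_comp[OF Wa[OF w] k'(1)]])
          (use functor_comp[OF Ff Wa[OF w] k(1)] functor_comp[OF Ff Wa[OF w] k'(1)] k k' gw[OF w]
            D.assoc[OF functor_arr[OF Ff Wa[OF w]] g(1) e'(2)] D.assoc[OF functor_arr[OF Ff Wa[OF w]] g(2) e'(2)] in simp)
      then have "k \<diamondop>\<^bsub>C\<^esub> x = k' \<diamondop>\<^bsub>C\<^esub> x" using dm k(1) k'(1) unfolding dominated_def by blast
      then have "ArrMap F k \<diamondop>\<^bsub>D\<^esub> ArrMap F x = ArrMap F k' \<diamondop>\<^bsub>D\<^esub> ArrMap F x"
        using functor_comp[OF Ff x k(1)] functor_comp[OF Ff x k'(1)] by simp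
      then have "e' \<diamondop>\<^bsub>D\<^esub> (g \<diamondop>\<^bsub>D\<^esub> ArrMap F x) = e' \<diamondop>\<^bsub>D\<^esub> (g' \<diamondop>\<^bsub>D\<^esub> ArrMap F x)"
        using D.assoc[OF Fx g(1) e'(2)] D.assoc[OF Fx g(2) e'(2)] k(2) k'(2) by simp
      moreover have "is_isomorphism D L (ObjMap F M) e'" using D.isomorphismI e' by metis
      ultimately have "g \<diamondop>\<^bsub>D\<^esub> ArrMap F x = g' \<diamondop>\<^bsub>D\<^esub> ArrMap F x"
        using D.iso_cancel_left D.arr_comp[OF Fx g(1)] D.arr_comp[OF Fx g(2)] functor_Obj[OF Ff M] by metis
      then show "g \<diamondop>\<^bsub>D\<^esub> ?x = g' \<diamondop>\<^bsub>D\<^esub> ?x"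
        using D.assoc[OF h(3)[OF V] Fx g(1)] D.assoc[OF h(3)[OF V] Fx g(2)] by simp
    qed
    then obtain Y w where w: "(Y, w) \<in> W" and "factors D V ?x (ObjMap F Y) (ArrMap F w)"
      using module_generatorsD(3)[OF gen W' V x'] by auto
    then obtain t where t: "arr D V (ObjMap F Y) t" "ArrMap F w \<diamondop>\<^bsub>D\<^esub> t = ?x" by (auto simp: factors_def)
    obtain s where s: "arr C (h V) Y s" "ArrMap F s \<diamondop>\<^bsub>D\<^esub> \<theta>' V = t"
      using lift[OF V arrD(1)[OF Wa[OF w]] t(1)] by blast
    have "w \<diamondop>\<^bsub>C\<^esub> s = x"
      by (rule inj[OF V C.arr_comp[OF s(1) Wa[OF w]] x])
        (use D.assoc[OF h(3)[OF V] functor_arr[OF Ff s(1)] functor_arr[OF Ff Wa[OF w]]]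
          functor_comp[OF Ff s(1) Wa[OF w]] s t in simp)
    then show ?thesis using w s(1) by (auto simp: factors_def)
  qed
  have "module_generators C (h ` \<V>)"
    unfolding module_generators_def
  proof (intro conjI allI impI)
    show "h ` \<V> \<subseteq> Obj C" using h(1) by blast
    fix X Y v assume "arr C X Y v \<and> (\<forall>U\<in>h ` \<V>. bij_betw (\<lambda>s. v \<diamondop>\<^bsub>C\<^esub> s) (Hom C U X) (Hom C U Y))"
    then show "is_isomorphism C X Y v" using det[of X Y v] by simp
  next
    fix X W U x assume *: "directed_sink C X W \<and> U \<in> h ` \<V> \<and> arr C U X x \<and> dominated C X W x"
    then obtain V where "V \<in> \<V>" "U = h V" by blast
    then show "\<exists>(Y, w)\<in>W. factors C U x Y w" using dom[of X W V x] * by simp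
  qed
  then show thesis by (rule that)
qed

section \<open>Full subcategories and coreflections\<close>

lemma Obj_full [simp]: "Obj (full_subcategory A B) = B"
  and Hom_full [simp]: "Hom (full_subcategory A B) = Hom A"
  and Ident_full [simp]: "Ident (full_subcategory A B) = Ident A"
  and Comp_full [simp]: "Comp (full_subcategory A B) = Comp A"
  by (simp_all add: full_subcategory_def)

lemma arr_full:
  "B \<subseteq> Obj A \<Longrightarrow> arr (full_subcategory A B) X Y f \<longleftrightarrow> X \<in> B \<and> Y \<in> B \<and> arr A X Y f"
  by (auto simp: arr_def)

lemma category_full:
  assumes "category A" "B \<subseteq> Obj A"
  shows "category (full_subcategory A B)"
proof -
  interpret category A by fact
  have m: "X \<in> Obj A" if "X \<in> B" for X using assms(2) that by blast
  show ?thesis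
    by (unfold_locales; simp)
      (blast intro: m comp_in_Hom comp_assoc Ident_in_Hom comp_Ident Ident_comp | meson m Hom_disjoint)+
qed

lemma functor_full:
  assumes F: "is_functor C D F" and B: "B \<subseteq> Obj C"
  shows "is_functor (full_subcategory C B) D F"
proof -
  have m: "X \<in> Obj C" if "X \<in> B" for X using B that by blast
  show ?thesis
    unfolding is_functor_def Obj_full Hom_full Ident_full Comp_full
  proof (intro conjI ballI)
    fix X Y f assume "X \<in> B" "Y \<in> B" "f \<in> Hom C X Y"
    then have f: "arr C X Y f" using m by (simp add: arr_def)
    show "ArrMap F f \<in> Hom D (ObjMap F X) (ObjMap F Y)" using functor_arr[OF F f] by (rule arrD)
  next
    fix X Y Z f g assume "X \<in> B" "Y \<in> B" "Z \<in> B" "f \<in> Hom C X Y" "g \<in> Hom C Y Z"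
    then have "arr C X Y f" "arr C Y Z g" using m by (simp_all add: arr_def)
    then show "ArrMap F (g \<diamondop>\<^bsub>C\<^esub> f) = ArrMap F g \<diamondop>\<^bsub>D\<^esub> ArrMap F f" by (rule functor_comp[OF F])
  qed (use functor_Obj[OF F] functor_Ident[OF F] m in blast)+
qed

text \<open>A universal arrow from \<open>B\<close> to \<open>Y\<close>. Working with one object at
  a time avoids carrying a right adjoint functor through the proofs.\<close>

definition coreflection :: "('o, 'm, 'x) category_scheme \<Rightarrow> 'o set \<Rightarrow> 'o \<Rightarrow> 'o \<Rightarrow> 'm \<Rightarrow> bool" where
  "coreflection A B Y R e \<longleftrightarrow> R \<in> B \<and> arr A R Y e \<and>
     (\<forall>X\<in>B. bij_betw (\<lambda>g. e \<diamondop>\<^bsub>A\<^esub> g) (Hom A X R) (Hom A X Y))"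

lemma coreflection_lift:
  assumes "coreflection A B Y R e" "X \<in> B" "B \<subseteq> Obj A" "arr A X Y f"
  obtains g where "arr A X R g" "e \<diamondop>\<^bsub>A\<^esub> g = f"
proof -
  have "(\<lambda>g. e \<diamondop>\<^bsub>A\<^esub> g) ` Hom A X R = Hom A X Y"
    using assms(1,2) by (simp add: coreflection_def bij_betw_def)
  then have "f \<in> (\<lambda>g. e \<diamondop>\<^bsub>A\<^esub> g) ` Hom A X R" using arrD(3)[OF assms(4)] by simp
  then obtain g where "g \<in> Hom A X R" "e \<diamondop>\<^bsub>A\<^esub> g = f" by blast
  then show thesis using that assms by (auto simp: arr_def coreflection_def)
qed

lemma coreflection_unique:
  assumes "coreflection A B Y R e" "X \<in> B" "arr A X R g" "arr A X R h" "e \<diamondop>\<^bsub>A\<^esub> g = e \<diamondop>\<^bsub>A\<^esub> h"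
  shows "g = h"
  using assms unfolding coreflection_def bij_betw_def inj_on_def arr_def by blast

text \<open>The universal arrow \<open>e\<close> is the counit, the morphism that the adjunction
  bijection sends to the identity. Conversely, universality of the chosen arrows defines the right
  adjoint on morphisms and makes it functorial.\<close>

lemma coreflective_iff:
  assumes A: "category A" and B: "B \<subseteq> Obj A"
  shows "coreflective A B \<longleftrightarrow> (\<forall>Y\<in>Obj A. \<exists>R e. coreflection A B Y R e)"
proof
  interpret category A by fact
  assume "coreflective A B"
  then obtain G \<phi> where G: "is_functor A (full_subcategory A B) G"
    and bij0: "\<forall>X\<in>B. \<forall>Y\<in>Obj A. bij_betw (\<phi> X Y) (Hom A X Y) (Hom A X (ObjMap G Y))"
    and nat0: "\<forall>X\<in>B. \<forall>X'\<in>B. \<forall>Y\<in>Obj A. \<forall>Y'\<in>Obj A. \<forall>a\<in>Hom A X' X. \<forall>b\<in>Hom A Y Y'. \<forall>g\<in>Hom A X Y.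
       \<phi> X' Y' (b \<diamondop>\<^bsub>A\<^esub> g \<diamondop>\<^bsub>A\<^esub> a) = ArrMap G b \<diamondop>\<^bsub>A\<^esub> \<phi> X Y g \<diamondop>\<^bsub>A\<^esub> a"
    unfolding coreflective_def is_right_adjoint_def by (auto simp: id_functor_def)
  note bij = bij0[rule_format] and nat = nat0[rule_format]
  show "\<forall>Y\<in>Obj A. \<exists>R e. coreflection A B Y R e"
  proof
    fix Y assume Y: "Y \<in> Obj A"
    let ?R = "ObjMap G Y"
    have R: "?R \<in> B" using functor_Obj[OF G Y] by simp
    then have RA: "?R \<in> Obj A" using B by blast
    obtain e where e: "e \<in> Hom A ?R Y" "\<phi> ?R Y e = Ident A ?R"
      using bij[OF R Y] Ident_in_Hom[OF RA] unfolding bij_betw_def by (metis imageE)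
    have ea: "arr A ?R Y e" using e R Y B by (auto simp: arr_def)
    have inv: "\<phi> X Y (e \<diamondop>\<^bsub>A\<^esub> a) = a" if X: "X \<in> B" and a: "a \<in> Hom A X ?R" for X a
    proof -
      have aa: "arr A X ?R a" using X a RA B by (auto simp: arr_def)
      \<comment> \<open>Naturality at the counit, in the source variable only: \<open>b\<close> is
        the identity of \<open>Y\<close>.\<close>
      have "\<phi> X Y (Ident A Y \<diamondop>\<^bsub>A\<^esub> e \<diamondop>\<^bsub>A\<^esub> a) = ArrMap G (Ident A Y) \<diamondop>\<^bsub>A\<^esub> \<phi> ?R Y e \<diamondop>\<^bsub>A\<^esub> a"
        by (rule nat[OF R X Y Y a Ident_in_Hom[OF Y] e(1)])
      then show ?thesis using id_comp[OF arr_comp[OF aa ea]] functor_Ident[OF G Y] e(2) aa id_comp[OF aa] by simp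
    qed
    have "bij_betw (\<lambda>g. e \<diamondop>\<^bsub>A\<^esub> g) (Hom A X ?R) (Hom A X Y)" if X: "X \<in> B" for X
    proof -
      have XA: "X \<in> Obj A" using X B by blast
      have *: "e \<diamondop>\<^bsub>A\<^esub> g \<in> Hom A X Y" if "g \<in> Hom A X ?R" for g
        using comp_in_Hom[OF XA RA Y that e(1)] .
      show ?thesis
      proof (rule bij_betwI[where g = "\<phi> X Y"])
        show "(\<lambda>g. e \<diamondop>\<^bsub>A\<^esub> g) \<in> Hom A X ?R \<rightarrow> Hom A X Y" using * by blast
        show "\<phi> X Y \<in> Hom A X Y \<rightarrow> Hom A X ?R" using bij[OF X Y] by (auto simp: bij_betw_def)
        show "\<phi> X Y (e \<diamondop>\<^bsub>A\<^esub> g) = g" if "g \<in> Hom A X ?R" for g using inv[OF X that] .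
        show "e \<diamondop>\<^bsub>A\<^esub> \<phi> X Y f = f" if f: "f \<in> Hom A X Y" for f
        proof -
          have p: "\<phi> X Y f \<in> Hom A X ?R" using bij[OF X Y] f by (auto simp: bij_betw_def)
          then have "\<phi> X Y (e \<diamondop>\<^bsub>A\<^esub> \<phi> X Y f) = \<phi> X Y f" by (rule inv[OF X])
          then show ?thesis using bij[OF X Y] f *[OF p] unfolding bij_betw_def inj_on_def by blast
        qed
      qed
    qed
    then have "coreflection A B Y ?R e" unfolding coreflection_def using R ea by blast
    then show "\<exists>R e. coreflection A B Y R e" by blast
  qed
next
  interpret category A by fact
  assume "\<forall>Y\<in>Obj A. \<exists>R e. coreflection A B Y R e"
  then obtain R e where c: "\<And>Y. Y \<in> Obj A \<Longrightarrow> coreflection A B Y (R Y) (e Y)" by metis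
  have R: "R Y \<in> B" and e: "arr A (R Y) Y (e Y)" if "Y \<in> Obj A" for Y
    using c[OF that] by (auto simp: coreflection_def)
  have RA: "R Y \<in> Obj A" if "Y \<in> Obj A" for Y using R[OF that] B by blast
  define garr where "garr b = (SOME g. \<exists>Y Y'. arr A Y Y' b \<and> arr A (R Y) (R Y') g \<and> e Y' \<diamondop>\<^bsub>A\<^esub> g = b \<diamondop>\<^bsub>A\<^esub> e Y)" for b
  have garr: "arr A (R Y) (R Y') (garr b)" "e Y' \<diamondop>\<^bsub>A\<^esub> garr b = b \<diamondop>\<^bsub>A\<^esub> e Y" if b: "arr A Y Y' b" for Y Y' b
  proof -
    have Y: "Y \<in> Obj A" "Y' \<in> Obj A" using b by (auto dest: arrD)
    obtain g where "arr A (R Y) (R Y') g" "e Y' \<diamondop>\<^bsub>A\<^esub> g = b \<diamondop>\<^bsub>A\<^esub> e Y"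
      using coreflection_lift[OF c[OF Y(2)] R[OF Y(1)] B arr_comp[OF e[OF Y(1)] b]] .
    then have "\<exists>g Y Y'. arr A Y Y' b \<and> arr A (R Y) (R Y') g \<and> e Y' \<diamondop>\<^bsub>A\<^esub> g = b \<diamondop>\<^bsub>A\<^esub> e Y" using b by blast
    from someI_ex[OF this] obtain Z Z' where Z: "arr A Z Z' b" "arr A (R Z) (R Z') (garr b)"
      "e Z' \<diamondop>\<^bsub>A\<^esub> garr b = b \<diamondop>\<^bsub>A\<^esub> e Z" unfolding garr_def by blast
    moreover have "Z = Y" "Z' = Y'" using arr_unique Z(1) b by blast+
    ultimately show "arr A (R Y) (R Y') (garr b)" "e Y' \<diamondop>\<^bsub>A\<^esub> garr b = b \<diamondop>\<^bsub>A\<^esub> e Y" by simp_all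
  qed
  have uniq: "g = g'" if "Y \<in> Obj A" "X \<in> B" "arr A X (R Y) g" "arr A X (R Y) g'" "e Y \<diamondop>\<^bsub>A\<^esub> g = e Y \<diamondop>\<^bsub>A\<^esub> g'" for X Y g g'
    using coreflection_unique[OF c[OF that(1)] that(2-5)] .
  define G where "G = \<lparr>ObjMap = R, ArrMap = garr\<rparr>"
  have G: "is_functor A (full_subcategory A B) G"
    unfolding is_functor_def G_def
  proof (intro conjI ballI; simp)
    fix Y assume Y: "Y \<in> Obj A"
    show "R Y \<in> B" by (rule R[OF Y])
    show "garr (Ident A Y) = Ident A (R Y)"
      by (rule uniq[OF Y R[OF Y] garr(1)[OF arr_Ident[OF Y]] arr_Ident[OF RA[OF Y]]])
        (use garr(2)[OF arr_Ident[OF Y]] e[OF Y] in simp)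
  next
    fix X Y f assume "X \<in> Obj A" "Y \<in> Obj A" "f \<in> Hom A X Y"
    then show "garr f \<in> Hom A (R X) (R Y)" using garr(1) by (simp add: arr_def)
  next
    fix X Y Z f g assume "X \<in> Obj A" "Y \<in> Obj A" "Z \<in> Obj A" "f \<in> Hom A X Y" "g \<in> Hom A Y Z"
    then have f: "arr A X Y f" and g: "arr A Y Z g" and o: "X \<in> Obj A" "Y \<in> Obj A" "Z \<in> Obj A"
      by (auto simp: arr_def)
    note f' = garr[OF f] and g' = garr[OF g] and gf = garr[OF arr_comp[OF f g]]
    show "garr (g \<diamondop>\<^bsub>A\<^esub> f) = garr g \<diamondop>\<^bsub>A\<^esub> garr f"
    proof (rule uniq[OF o(3) R[OF o(1)] gf(1) arr_comp[OF f'(1) g'(1)]])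
      show "e Z \<diamondop>\<^bsub>A\<^esub> garr (g \<diamondop>\<^bsub>A\<^esub> f) = e Z \<diamondop>\<^bsub>A\<^esub> garr g \<diamondop>\<^bsub>A\<^esub> garr f"
        using gf(2) f'(2) g'(2) assoc[OF f'(1) g'(1) e[OF o(3)]] assoc[OF f'(1) e[OF o(2)] g]
          assoc[OF e[OF o(1)] f g] by simp
    qed
  qed
  define \<phi> where "\<phi> X Y g = inv_into (Hom A X (R Y)) (\<lambda>h. e Y \<diamondop>\<^bsub>A\<^esub> h) g" for X Y g
  have bij0: "bij_betw (\<lambda>h. e Y \<diamondop>\<^bsub>A\<^esub> h) (Hom A X (R Y)) (Hom A X Y)" if "X \<in> B" "Y \<in> Obj A" for X Y
    using c[OF that(2)] that(1) by (simp add: coreflection_def)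
  have \<phi>: "arr A X (R Y) (\<phi> X Y g)" "e Y \<diamondop>\<^bsub>A\<^esub> \<phi> X Y g = g" if X: "X \<in> B" and g: "arr A X Y g" for X Y g
  proof -
    have o: "X \<in> Obj A" "Y \<in> Obj A" using g by (auto dest: arrD)
    have "g \<in> (\<lambda>h. e Y \<diamondop>\<^bsub>A\<^esub> h) ` Hom A X (R Y)"
      using bij0[OF X o(2)] arrD(3)[OF g] by (simp add: bij_betw_def)
    from inv_into_into[OF this] f_inv_into_f[OF this]
    show "arr A X (R Y) (\<phi> X Y g)" "e Y \<diamondop>\<^bsub>A\<^esub> \<phi> X Y g = g"
      unfolding \<phi>_def arr_def using o RA by simp_all
  qed
  have "is_functor (full_subcategory A B) A id_functor"
    unfolding is_functor_def id_functor_def using B by auto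
  moreover have "bij_betw (\<phi> X Y) (Hom A X Y) (Hom A X (R Y))" if "X \<in> B" "Y \<in> Obj A" for X Y
    unfolding \<phi>_def using bij0[OF that] by (rule bij_betw_inv_into)
  moreover have "\<phi> X' Y' (b \<diamondop>\<^bsub>A\<^esub> g \<diamondop>\<^bsub>A\<^esub> a) = garr b \<diamondop>\<^bsub>A\<^esub> \<phi> X Y g \<diamondop>\<^bsub>A\<^esub> a"
    if "X \<in> B" "X' \<in> B" "Y \<in> Obj A" "Y' \<in> Obj A" "a \<in> Hom A X' X" "b \<in> Hom A Y Y'" "g \<in> Hom A X Y"
    for X X' Y Y' a b g
  proof -
    have a: "arr A X' X a" and b: "arr A Y Y' b" and g: "arr A X Y g" using that B by (auto simp: arr_def)
    note p = \<phi>[OF that(1) g] and gb = garr[OF b]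
    note bga = arr_comp[OF arr_comp[OF a g] b]
    show ?thesis
    proof (rule uniq[OF that(4,2) \<phi>(1)[OF that(2) bga] arr_comp[OF arr_comp[OF a p(1)] gb(1)]])
      have "e Y' \<diamondop>\<^bsub>A\<^esub> garr b \<diamondop>\<^bsub>A\<^esub> \<phi> X Y g \<diamondop>\<^bsub>A\<^esub> a = (b \<diamondop>\<^bsub>A\<^esub> e Y) \<diamondop>\<^bsub>A\<^esub> \<phi> X Y g \<diamondop>\<^bsub>A\<^esub> a"
        using assoc[OF arr_comp[OF a p(1)] gb(1) e[OF that(4)]] gb(2) by simp
      also have "\<dots> = b \<diamondop>\<^bsub>A\<^esub> g \<diamondop>\<^bsub>A\<^esub> a"
        using assoc[OF arr_comp[OF a p(1)] e[OF that(3)] b] assoc[OF a p(1) e[OF that(3)]] p(2) by simp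
      finally show "e Y' \<diamondop>\<^bsub>A\<^esub> \<phi> X' Y' (b \<diamondop>\<^bsub>A\<^esub> g \<diamondop>\<^bsub>A\<^esub> a) = e Y' \<diamondop>\<^bsub>A\<^esub> garr b \<diamondop>\<^bsub>A\<^esub> \<phi> X Y g \<diamondop>\<^bsub>A\<^esub> a"
        using \<phi>(2)[OF that(2) bga] by simp
    qed
  qed
  ultimately have "is_right_adjoint (full_subcategory A B) A id_functor G"
    unfolding is_right_adjoint_def using G
    by (intro conjI exI[of _ \<phi>]) (simp_all add: id_functor_def G_def)
  then show "coreflective A B" unfolding coreflective_def by blast
qed

text \<open>As \<open>R\<close> lies in \<open>B\<close>, \<open>e\<close> can be cancelled on the
  left of \<open>e \<diamondop> s \<diamondop> e = e\<close>, so the one-sided inverse is two-sided.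
  Closure of \<open>B\<close> under colimits of the ambient category rests on this.\<close>

lemma (in category) coreflection_section_imp_iso:
  assumes c: "coreflection C B Y R e" and B: "B \<subseteq> Obj C" and s: "arr C Y R s" and es: "e \<diamondop> s = Ident C Y"
  shows "is_isomorphism C R Y e"
proof -
  have R: "R \<in> B" and e: "arr C R Y e" using c by (auto simp: coreflection_def)
  have "e \<diamondop> (s \<diamondop> e) = e \<diamondop> Ident C R" using assoc[OF e s e] es e by simp
  then have "s \<diamondop> e = Ident C R"
    using coreflection_unique[OF c R arr_comp[OF e s] arr_Ident] R B by blast
  then show ?thesis using isomorphismI[OF e s _ es] by blast
qed

subsection \<open>Sums and presentations\<close>

lemma coproduct_cong:
  assumes "\<And>i. i \<in> I \<Longrightarrow> D i = D' i" "\<And>i. i \<in> I \<Longrightarrow> \<iota> i = \<iota>' i"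
  shows "is_coproduct C I D X \<iota> \<longleftrightarrow> is_coproduct C I D' X \<iota>'"
  using assms by (simp add: is_coproduct_def cong: ball_cong)

lemma (in category) coproduct_pullback:
  assumes cp: "is_coproduct C J D X \<iota>" and e: "bij_betw e I J" and D: "\<And>j. j \<in> J \<Longrightarrow> D j \<in> Obj C"
  shows "is_coproduct C I (D \<circ> e) X (\<iota> \<circ> e)"
proof -
  let ?e = "inv_into I e"
  have "is_coproduct C J ((D \<circ> e) \<circ> ?e) X \<iota>"
    using cp by (subst coproduct_cong[of J _ D \<iota> \<iota>]) (auto simp: bij_betw_inv_into_right[OF e])
  moreover have e': "bij_betw ?e J I" using e by (rule bij_betw_inv_into)
  moreover have "(D \<circ> e) i \<in> Obj C" if "i \<in> I" for i using D bij_betwE[OF e] that by simp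
  ultimately have "is_coproduct C I (D \<circ> e) X (\<iota> \<circ> inv_into J ?e)" by (rule coproduct_reindex)
  moreover have "inv_into J ?e i = e i" if "i \<in> I" for i
    using e e' that by (metis bij_betwE bij_betw_inv_into_left bij_betw_def inv_into_f_eq)
  ultimately show ?thesis
    by (subst coproduct_cong[of I _ "D \<circ> e" _ "\<iota> \<circ> inv_into J ?e"]) auto
qed

context abelian_category
begin

lemma Sum_classI:
  assumes J: "small TYPE('u) J" and D: "\<And>j. j \<in> J \<Longrightarrow> D j \<in> \<U>" and U: "\<U> \<subseteq> Obj C"
    and cp: "is_coproduct C J D X \<iota>"
  shows "X \<in> Sum_class TYPE('u) C \<U>"
proof -
  obtain I :: "'u set" and e where I: "small TYPE('u) I" and e: "bij_betw e I J"
    using small_index[OF J] .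
  have "is_coproduct C I (D \<circ> e) X (\<iota> \<circ> e)"
    by (rule coproduct_pullback[OF cp e]) (use D U in blast)
  moreover have "\<forall>i\<in>I. (D \<circ> e) i \<in> \<U>" using D bij_betwE[OF e] by simp
  ultimately show ?thesis unfolding Sum_class_def using I by blast
qed

lemma Sum_class_Obj: "X \<in> Sum_class u C \<U> \<Longrightarrow> X \<in> Obj C"
  unfolding Sum_class_def using coproduct_Obj by blast

lemma Pres_class_Obj: "X \<in> Pres_class u C \<U> \<Longrightarrow> X \<in> Obj C"
  unfolding Pres_class_def is_cokernel_def by blast

lemma Sum_classE:
  assumes "X \<in> Sum_class u C \<U>" "\<U> \<subseteq> Obj C"
  obtains I :: "'u set" and D \<iota> where "small (u :: 'u itself) I" "\<And>i. i \<in> I \<Longrightarrow> D i \<in> \<U>"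
    "\<And>i. i \<in> I \<Longrightarrow> D i \<in> Obj C" "is_coproduct C I D X \<iota>"
  using assms unfolding Sum_class_def by blast

lemma Pres_classE:
  assumes "X \<in> Pres_class u C \<U>"
  obtains S T f c where "S \<in> Sum_class u C \<U>" "T \<in> Sum_class u C \<U>" "arr C S T f" "is_cokernel C S T f X c"
  using assms Sum_class_Obj unfolding Pres_class_def arr_def by blast

lemma Pres_classI:
  "\<lbrakk>S \<in> Sum_class u C \<U>; T \<in> Sum_class u C \<U>; arr C S T f; is_cokernel C S T f X c\<rbrakk> \<Longrightarrow> X \<in> Pres_class u C \<U>"
  unfolding Pres_class_def arr_def by blast

lemma Pres_class_iso:
  assumes X: "X \<in> Pres_class u C \<U>" and Y: "Y \<in> Obj C" and iso: "is_isomorphism C X Y e"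
  shows "Y \<in> Pres_class u C \<U>"
proof -
  obtain S T f c where S: "S \<in> Sum_class u C \<U>" "T \<in> Sum_class u C \<U>" and f: "arr C S T f"
    and c: "is_cokernel C S T f X c" using Pres_classE[OF X] .
  note ca = cokernelD[OF c f]
  have XO: "X \<in> Obj C" using ca by (auto dest: arrD)
  obtain e' where e: "arr C X Y e" "arr C Y X e'" "e' \<diamondop> e = Ident C X" "e \<diamondop> e' = Ident C Y"
    using isomorphismE[OF iso XO Y] by blast
  have SO: "S \<in> Obj C" using f by (rule arrD)
  have ec: "arr C T Y (e \<diamondop> c)" using ca e by auto
  have "is_cokernel C S T f Y (e \<diamondop> c)"
  proof (rule cokernelI[OF f _ Y])
    show "(e \<diamondop> c) \<diamondop> f = Zero C S Y" using assoc[OF f ca(1) e(1)] ca e SO by simp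
    show "is_epi C T Y (e \<diamondop> c)"
    proof (rule epiI[OF ec])
      fix Z g assume g: "arr C Y Z g" "g \<diamondop> e \<diamondop> c = Zero C T Z"
      have Z: "Z \<in> Obj C" using g by (auto dest: arrD)
      have "(g \<diamondop> e) \<diamondop> c = Zero C X Z \<diamondop> c" using g assoc[OF ca(1) e(1) g(1)] ca Z by simp
      then have "g \<diamondop> e = Zero C X Z" using epiD[OF cokernel_epi[OF c f]] g e XO Z by blast
      then show "g = Zero C Y Z"
        using iso_cancel_right[OF iso g(1) arr_Zero[OF Y Z] XO] e Z by simp
    qed
    fix W g assume g: "arr C T W g" "g \<diamondop> f = Zero C S W"
    obtain h where h: "arr C X W h" "h \<diamondop> c = g" using cokernel_desc[OF c g] .
    have "(h \<diamondop> e') \<diamondop> e \<diamondop> c = g"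
      using h assoc[OF ec e(2) h(1)] assoc[OF ca(1) e(1,2)] e(3) ca by simp
    then show "\<exists>h. arr C Y W h \<and> h \<diamondop> e \<diamondop> c = g" using arr_comp[OF e(2) h(1)] by blast
  qed
  then show ?thesis by (rule Pres_classI[OF S f])
qed

lemma Sum_class_superset:
  assumes univ: "universe TYPE('u)" and "U \<in> \<U>" "\<U> \<subseteq> Obj C"
  shows "U \<in> Sum_class TYPE('u) C \<U>"
  using assms by (intro Sum_classI[of "{()}" "\<lambda>_. U", OF small_finite[OF univ] _ _ coproduct_singleton]) auto

text \<open>\<open>X\<close> is the cokernel of the zero morphism from the empty sum.\<close>

lemma Sum_subset_Pres:
  assumes univ: "universe TYPE('u)" and cc: "cocomplete TYPE('u) C" and U: "\<U> \<subseteq> Obj C"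
    and X: "X \<in> Sum_class TYPE('u) C \<U>"
  shows "X \<in> Pres_class TYPE('u) C \<U>"
proof -
  have XO: "X \<in> Obj C" using X by (rule Sum_class_Obj)
  have D: "\<And>i. i \<in> ({} :: nat set) \<Longrightarrow> X \<in> \<U>" by simp
  obtain Z \<iota> where Z: "is_coproduct C ({} :: nat set) (\<lambda>_. X) Z \<iota>"
    using ex_finite_coproduct[of "{}" "\<lambda>_. X"] by auto
  have ZS: "Z \<in> Sum_class TYPE('u) C \<U>"
    by (rule Sum_classI[OF small_finite[OF univ finite.emptyI] D U Z])
  have ZO: "Z \<in> Obj C" using Z by (rule coproduct_Obj)
  have i: "arr C X X (Ident C X)" using XO by simp
  have "is_cokernel C Z X (Zero C Z X) X (Ident C X)"
  proof (rule cokernelI[OF arr_Zero[OF ZO XO] epiI[OF i] XO])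
    show "g = Zero C X Y" if "arr C X Y g" "g \<diamondop> Ident C X = Zero C X Y" for Y g using that by simp
    show "Ident C X \<diamondop> Zero C Z X = Zero C Z X" using i ZO by simp
    show "\<exists>h. arr C X W h \<and> h \<diamondop> Ident C X = g" if "arr C X W g" for W g using that by auto
  qed
  then show ?thesis by (rule Pres_classI[OF ZS X arr_Zero[OF ZO XO]])
qed

text \<open>The vanishing of \<open>Hom(U, K / tr K)\<close> is automatic: a morphism \<open>U \<rightarrow> K / T \<subseteq> S / T\<close> lifts to
  \<open>U \<rightarrow> S\<close> since \<open>S / T\<close> is presented by \<open>\<U>\<close>, the lift lands in \<open>K\<close>, hence in the trace \<open>T\<close>.\<close>

lemma trace_conditionI:
  assumes univ: "universe TYPE('u)" and U: "\<U> \<subseteq> Obj C"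
    and re: "\<And>S P Y m p. \<lbrakk>S \<in> Sum_class TYPE('u) C \<U>; P \<in> Pres_class TYPE('u) C \<U>; Y \<in> Obj C;
      is_mono C Y P m; is_epi C S Y p\<rbrakk> \<Longrightarrow> relative_epi C \<U> S Y p"
  shows "trace_condition TYPE('u) C \<U>"
  unfolding trace_condition_def
proof (intro ballI allI impI conjI; (elim conjE)?)
  fix S P Y m p
  assume S: "S \<in> Sum_class TYPE('u) C \<U>" and P: "P \<in> Pres_class TYPE('u) C \<U>" and Y: "Y \<in> Obj C"
    and m: "is_mono C Y P m" and p: "is_epi C S Y p"
  show "relative_epi C \<U> S Y p" by (rule re[OF S P Y m p])
  fix K k T t Q q V
  assume k: "is_kernel C S Y p K k" and tr: "is_trace TYPE('u) C \<U> K T t" and q: "is_cokernel C T K t Q q"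
    and V: "V \<in> \<U>"
  have SO: "S \<in> Obj C" and VO: "V \<in> Obj C" using S Sum_class_Obj V U by blast+
  have pa: "arr C S Y p" using p SO Y by (rule epi_arr)
  note ka = kernelD[OF k pa] and km = kernel_mono[OF k pa]
  have KO: "K \<in> Obj C" using ka by (auto dest: arrD)
  obtain S' e where TO: "T \<in> Obj C" and tm: "is_mono C T K t" and S': "S' \<in> Sum_class TYPE('u) C \<U>"
    and e: "is_epi C S' T e"
    using tr unfolding is_trace_def generated_subobject_def by blast
  have ta: "arr C T K t" using tm TO KO by (rule mono_arr)
  have ea: "arr C S' T e" using e Sum_class_Obj[OF S'] TO by (rule epi_arr)
  have S'O: "S' \<in> Obj C" using ea by (rule arrD)
  have kt: "arr C T S (k \<diamondop> t)" using ta ka by auto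
  have kte: "arr C S' S ((k \<diamondop> t) \<diamondop> e)" using kt ea by auto
  obtain R r where r: "is_cokernel C T S (k \<diamondop> t) R r" using ex_cokernel[OF TO SO arrD(3)[OF kt]] by blast
  note ra = cokernelD[OF r kt] and rm = cokernel_epi[OF r kt]
  have RO: "R \<in> Obj C" using ra by (auto dest: arrD)
  \<comment> \<open>Precomposing with the epimorphism \<open>e\<close> does not change the cokernel,
    so the quotient \<open>R = S/T\<close> is presented by the sums \<open>S'\<close> and
    \<open>S\<close>.\<close>
  have "is_cokernel C S' S ((k \<diamondop> t) \<diamondop> e) R r"
  proof (rule cokernelI[OF kte rm RO])
    show "r \<diamondop> (k \<diamondop> t) \<diamondop> e = Zero C S' R" using assoc[OF ea kt ra(1)] ra ea RO by simp
    fix W g assume g: "arr C S W g" "g \<diamondop> (k \<diamondop> t) \<diamondop> e = Zero C S' W"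
    have W: "W \<in> Obj C" using g by (auto dest: arrD)
    have "(g \<diamondop> (k \<diamondop> t)) \<diamondop> e = Zero C T W \<diamondop> e" using g assoc[OF ea kt g(1)] ea W by simp
    then have "g \<diamondop> (k \<diamondop> t) = Zero C T W" using epiD[OF e] arr_comp[OF kt g(1)] TO W by blast
    then show "\<exists>h. arr C R W h \<and> h \<diamondop> r = g" using cokernel_desc[OF r g(1)] by blast
  qed
  then have RP: "R \<in> Pres_class TYPE('u) C \<U>" by (rule Pres_classI[OF S' S kte])
  \<comment> \<open>The lifting property is applied with \<open>R\<close> as a subobject of
    itself.\<close>
  have "is_mono C R R (Ident C R)" by (rule monoI) (use RO in auto)
  then have rr: "relative_epi C \<U> S R r" by (rule re[OF S RP RO _ rm])
  note qa = cokernelD[OF q ta] and qe = cokernel_epi[OF q ta]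
  have QO: "Q \<in> Obj C" using qa by (auto dest: arrD)
  have rk: "arr C K R (r \<diamondop> k)" using ra ka by auto
  have "(r \<diamondop> k) \<diamondop> t = Zero C T R" using assoc[OF ta ka(1) ra(1)] ra by simp
  then obtain j where j: "arr C Q R j" "j \<diamondop> q = r \<diamondop> k" using cokernel_desc[OF q rk] by blast
  have jm: "is_mono C Q R j" by (rule quotient_mono[OF tm km TO KO SO q r j])
  have "p \<diamondop> (k \<diamondop> t) = Zero C T Y" using assoc[OF ta ka(1) pa] ka ta Y by simp
  then obtain v where v: "arr C R Y v" "v \<diamondop> r = p" using cokernel_desc[OF r pa] by blast
  \<comment> \<open>\<open>v \<diamondop> j\<close> is the map from \<open>K/T\<close> to
    \<open>Y\<close> induced by \<open>p \<diamondop> k\<close>, which is zero; therefore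
    \<open>p\<close> kills every lift along \<open>r\<close> of a morphism into
    \<open>K/T\<close>.\<close>
  have "(v \<diamondop> j) \<diamondop> q = Zero C Q Y \<diamondop> q"
    using assoc[OF qa(1) j(1) v(1)] assoc[OF ka(1) ra(1) v(1)] j v ka qa Y by simp
  then have vj: "v \<diamondop> j = Zero C Q Y" using epiD[OF qe arr_comp[OF j(1) v(1)]] QO Y by blast
  have "u = Zero C V Q" if "u \<in> Hom C V Q" for u
  proof -
    have u: "arr C V Q u" using that VO QO by (simp add: arr_def)
    have ju: "arr C V R (j \<diamondop> u)" using u j by auto
    then have "j \<diamondop> u \<in> (\<lambda>f. r \<diamondop> f) ` Hom C V S"
      using rr V unfolding relative_epi_def by (simp add: arr_def)
    then obtain s where s: "arr C V S s" "j \<diamondop> u = r \<diamondop> s" using VO SO by (auto simp: arr_def)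
    have "p \<diamondop> s = (v \<diamondop> j) \<diamondop> u" using v s(2) assoc[OF s(1) ra(1) v(1)] assoc[OF u j(1) v(1)] by simp
    then have "p \<diamondop> s = Zero C V Y" using vj u Y by simp
    then obtain s' where s': "arr C V K s'" "k \<diamondop> s' = s" using kernel_lift[OF k s(1)] by blast
    \<comment> \<open>The image of the lift is a quotient of \<open>V\<close>, itself a sum with one
      summand; so it is a generated subobject of \<open>K\<close> and lies in the trace
      \<open>T\<close>, which \<open>r\<close> kills.\<close>
    obtain I e' m' where I: "I \<in> Obj C" "is_epi C V I e'" "is_mono C I K m'" "m' \<diamondop> e' = s'"
      using image_factorization[OF s'(1)] .
    have "generated_subobject TYPE('u) C \<U> K I m'"
      unfolding generated_subobject_def using I Sum_class_superset[OF univ V U] by blast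
    then obtain h where "h \<in> Hom C I T" "t \<diamondop> h = m'" using tr unfolding is_trace_def by blast
    then have h: "arr C I T h" "t \<diamondop> h = m'" using I TO by (simp_all add: arr_def)
    have e'a: "arr C V I e'" using I(2) VO I(1) by (rule epi_arr)
    have "s = k \<diamondop> (t \<diamondop> h) \<diamondop> e'" using h I s' by simp
    also have "\<dots> = (k \<diamondop> t) \<diamondop> (h \<diamondop> e')"
      using assoc[OF e'a h(1) ta] assoc[OF arr_comp[OF e'a h(1)] ta ka(1)] by simp
    finally have "r \<diamondop> s = (r \<diamondop> (k \<diamondop> t)) \<diamondop> (h \<diamondop> e')"
      using assoc[OF arr_comp[OF e'a h(1)] kt ra(1)] by simp
    then have "j \<diamondop> u = Zero C V R" using s ra arr_comp[OF e'a h(1)] RO by simp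
    then have "j \<diamondop> u = j \<diamondop> Zero C V Q" using j VO by simp
    then show ?thesis using monoD[OF jm u] VO QO by blast
  qed
  then show "Hom C V Q = {Zero C V Q}" using arr_Zero[OF VO QO] by (auto simp: arr_def)
qed

end

section \<open>Closure of coreflective subcategories under coproducts and cokernels\<close>

lemma (in category) coreflective_iso_closed:
  assumes "B \<subseteq> Obj C" "\<And>X Y. \<lbrakk>X \<in> B; Y \<in> Obj C; isomorphic C X Y\<rbrakk> \<Longrightarrow> Y \<in> B"
    and "coreflection C B X R e" "arr C X R s" "e \<diamondop> s = Ident C X"
  shows "X \<in> B"
  using coreflection_section_imp_iso[OF assms(3,1,4,5)] assms unfolding isomorphic_def coreflection_def
  by (meson arrD(1))

text \<open>The injections start in \<open>B\<close>, so they lift to the coreflection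
  \<open>R\<close> of \<open>X\<close>. The morphism that they induce is a section of
  \<open>e\<close>, and a coreflection with a section is an isomorphism.\<close>

lemma (in category) coreflective_coproduct_closed:
  assumes B: "B \<subseteq> Obj C" and iso: "\<And>X Y. \<lbrakk>X \<in> B; Y \<in> Obj C; isomorphic C X Y\<rbrakk> \<Longrightarrow> Y \<in> B"
    and core: "coreflective C B" and cp: "is_coproduct C I D X \<iota>" and D: "\<And>i. i \<in> I \<Longrightarrow> D i \<in> B"
  shows "X \<in> B"
proof -
  have XO: "X \<in> Obj C" using cp by (rule coproduct_Obj)
  obtain R e where c: "coreflection C B X R e" using core coreflective_iff[OF category_axioms B] XO by blast
  have e: "arr C R X e" using c by (simp add: coreflection_def)
  have DO: "D i \<in> Obj C" if "i \<in> I" for i using D B that by blast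
  have "\<exists>g. arr C (D i) R g \<and> e \<diamondop> g = \<iota> i" if "i \<in> I" for i
    using coreflection_lift[OF c D[OF that] B coproduct_arr[OF cp that DO[OF that]]] by blast
  then obtain g where g: "\<And>i. i \<in> I \<Longrightarrow> arr C (D i) R (g i) \<and> e \<diamondop> g i = \<iota> i" by metis
  then obtain s where s: "arr C X R s" "\<And>i. i \<in> I \<Longrightarrow> s \<diamondop> \<iota> i = g i"
    using coproduct_desc[OF cp arrD(1)[OF e], of g] by blast
  have "e \<diamondop> s = Ident C X"
  proof (rule coproduct_ext[OF cp arr_comp[OF s(1) e] arr_Ident[OF XO] DO])
    fix i assume i: "i \<in> I"
    note \<iota> = coproduct_arr[OF cp i DO[OF i]]
    show "(e \<diamondop> s) \<diamondop> \<iota> i = Ident C X \<diamondop> \<iota> i" using assoc[OF \<iota> s(1) e] s(2)[OF i] g[OF i] \<iota> by simp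
  qed
  from coreflective_iso_closed[OF B _ c s(1) this] show ?thesis using iso by blast
qed

text \<open>\<open>q\<close> lifts to a morphism \<open>g\<close> into the coreflection of
  \<open>Q\<close>. As \<open>X\<close> lies in \<open>B\<close> as well, uniqueness of lifts forces
  \<open>g\<close> to kill \<open>f\<close>, so \<open>g\<close> descends to a section.\<close>

lemma (in preadditive_category) coreflective_cokernel_closed:
  assumes B: "B \<subseteq> Obj C" and iso: "\<And>X Y. \<lbrakk>X \<in> B; Y \<in> Obj C; isomorphic C X Y\<rbrakk> \<Longrightarrow> Y \<in> B"
    and core: "coreflective C B" and f: "arr C X Y f" and q: "is_cokernel C X Y f Q q"
    and XY: "X \<in> B" "Y \<in> B"
  shows "Q \<in> B"
proof -
  note qa = cokernelD[OF q f]
  have QO: "Q \<in> Obj C" and XO: "X \<in> Obj C" using qa f by (auto dest: arrD)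
  obtain R e where c: "coreflection C B Q R e" using core coreflective_iff[OF category_axioms B] QO by blast
  have e: "arr C R Q e" using c by (simp add: coreflection_def)
  have RO: "R \<in> Obj C" using e by (rule arrD)
  obtain g where g: "arr C Y R g" "e \<diamondop> g = q" using coreflection_lift[OF c XY(2) B qa(1)] .
  have "e \<diamondop> (g \<diamondop> f) = e \<diamondop> Zero C X R" using assoc[OF f g(1) e] g qa e XO by simp
  then have "g \<diamondop> f = Zero C X R"
    using coreflection_unique[OF c XY(1) arr_comp[OF f g(1)] arr_Zero[OF XO RO]] by blast
  then obtain s where s: "arr C Q R s" "s \<diamondop> q = g" using cokernel_desc[OF q g(1)] by blast
  have "(e \<diamondop> s) \<diamondop> q = Ident C Q \<diamondop> q" using assoc[OF qa(1) s(1) e] s g qa by simp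
  then have "e \<diamondop> s = Ident C Q" using epiD[OF cokernel_epi[OF q f]] s e QO by blast
  from coreflective_iso_closed[OF B _ c s(1) this] show ?thesis using iso by blast
qed

lemma closed_under_cokernels_coreflective:
  assumes A: "abelian_category A" and add: "additive_subcategory A B" and core: "coreflective A B"
  shows "closed_under_cokernels A B"
  unfolding closed_under_cokernels_def
proof (intro ballI allI impI)
  interpret abelian_category A by (rule A)
  have B: "B \<subseteq> Obj A" and iso: "\<And>X Y. \<lbrakk>X \<in> B; Y \<in> Obj A; isomorphic A X Y\<rbrakk> \<Longrightarrow> Y \<in> B"
    using add unfolding additive_subcategory_def by blast+
  fix X Y f Q q assume *: "X \<in> B" "Y \<in> B" and f: "f \<in> Hom A X Y" and q: "is_cokernel A X Y f Q q"
  then have "arr A X Y f" using B by (auto simp: arr_def)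
  from coreflective_cokernel_closed[OF B _ core this q *] iso show "Q \<in> B" by blast
qed

lemma hom_finprod:
  assumes G: "comm_group G" and H: "comm_group H" and h: "h \<in> hom G H" and f: "f \<in> J \<rightarrow> carrier G"
  shows "h (finprod G f J) = finprod H (\<lambda>i. h (f i)) J"
proof -
  interpret G: comm_group G by fact
  interpret H: comm_group H by fact
  interpret group_hom G H h using h by unfold_locales
  show ?thesis
  proof (cases "finite J")
    case True
    then show ?thesis using f
    proof (induction J)
      case (insert i J)
      have "(\<lambda>i. h (f i)) \<in> J \<rightarrow> carrier H" using insert.prems by (auto simp: Pi_iff)
      then show ?case using insert by (simp add: Pi_iff)
    qed simp
  qed (simp add: G.finprod_infinite H.finprod_infinite)
qed

section \<open>From module generators of a coreflective subcategory to a presenting set\<close>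

context
  fixes A :: "('o, 'm) preadd" (structure) and B :: "'o set" and \<U> :: "'o set"
  assumes univ: "universe TYPE('u)" and A: "abelian_category A" and ls: "locally_small TYPE('u) A"
    and cc: "cocomplete TYPE('u) A" and add: "additive_subcategory A B" and core: "coreflective A B"
    and gen: "module_generators (full_subcategory A B) \<U>" and sm: "small TYPE('u) \<U>"
begin

interpretation A: abelian_category A by (rule A)

lemma B_Obj: "B \<subseteq> Obj A" and B_iso: "\<lbrakk>X \<in> B; Y \<in> Obj A; isomorphic A X Y\<rbrakk> \<Longrightarrow> Y \<in> B"
  using add unfolding additive_subcategory_def by blast+

lemma U_sub: "\<U> \<subseteq> B" "\<U> \<subseteq> Obj A"
  using module_generatorsD(1)[OF gen] B_Obj by auto

lemma coproduct_B: "\<lbrakk>is_coproduct A I D X \<iota>; \<And>i. i \<in> I \<Longrightarrow> D i \<in> B\<rbrakk> \<Longrightarrow> X \<in> B"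
  by (rule A.coreflective_coproduct_closed[OF B_Obj B_iso core])

lemma cokernel_B: "\<lbrakk>arr A X Y f; is_cokernel A X Y f Q q; X \<in> B; Y \<in> B\<rbrakk> \<Longrightarrow> Q \<in> B"
  by (rule A.coreflective_cokernel_closed[OF B_Obj B_iso core])

lemma Sum_B: "X \<in> Sum_class TYPE('u) A \<U> \<Longrightarrow> X \<in> B"
  using coproduct_B U_sub unfolding Sum_class_def by blast

lemma Pres_B: "X \<in> Pres_class TYPE('u) A \<U> \<Longrightarrow> X \<in> B"
  using cokernel_B Sum_B A.Pres_classE by metis

text \<open>\<open>Y\<close> may lie outside \<open>B\<close>, so the factorization property is used
  at \<open>P\<close>, for the single morphism \<open>m \<diamondop> p\<close>. It dominates
  \<open>m \<diamondop> a\<close> because \<open>p\<close> is an epimorphism of the whole category;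
  \<open>m\<close> is cancelled at the end.\<close>

lemma epi_lift:
  assumes S: "S \<in> B" and P: "P \<in> B" and Y: "Y \<in> Obj A" and m: "is_mono A Y P m" and p: "is_epi A S Y p"
    and U: "U \<in> \<U>" and a: "arr A U Y a"
  obtains b where "arr A U S b" "p \<diamondop> b = a"
proof -
  have o: "S \<in> Obj A" "P \<in> Obj A" using S P B_Obj by auto
  have ma: "arr A Y P m" using m Y o(2) by (rule A.mono_arr)
  have pa: "arr A S Y p" using p o(1) Y by (rule A.epi_arr)
  note f = arr_full[OF B_Obj]
  have UB: "U \<in> B" using U U_sub by blast
  have sink: "directed_sink (full_subcategory A B) P {(S, m \<diamondop> p)}"
    unfolding directed_sink_def factors_def f using S P A.arr_comp[OF pa ma] o
    by (auto intro!: exI[of _ "Ident A S"])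
  have "dominated (full_subcategory A B) P {(S, m \<diamondop> p)} (m \<diamondop> a)"
    unfolding dominated_def f
  proof (intro allI impI; clarsimp)
    fix L g g' assume g: "arr A P L g" "arr A P L g'" and eq: "g \<diamondop> m \<diamondop> p = g' \<diamondop> m \<diamondop> p"
    have "(g \<diamondop> m) \<diamondop> p = (g' \<diamondop> m) \<diamondop> p" using eq A.assoc[OF pa ma g(1)] A.assoc[OF pa ma g(2)] by simp
    then have "g \<diamondop> m = g' \<diamondop> m" using A.epiD[OF p A.arr_comp[OF ma g(1)] A.arr_comp[OF ma g(2)]] by blast
    then show "g \<diamondop> m \<diamondop> a = g' \<diamondop> m \<diamondop> a" using A.assoc[OF a ma g(1)] A.assoc[OF a ma g(2)] by simp
  qed
  moreover have "arr (full_subcategory A B) U P (m \<diamondop> a)" unfolding f using UB P A.arr_comp[OF a ma] by blast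
  ultimately obtain b where b: "arr A U S b" "(m \<diamondop> p) \<diamondop> b = m \<diamondop> a"
    using module_generatorsD(3)[OF gen sink U] unfolding factors_def f by auto
  then have "p \<diamondop> b = a" using A.monoD[OF m A.arr_comp[OF b(1) pa] a] A.assoc[OF b(1) pa ma] by simp
  then show thesis using that b by blast
qed

lemma trace_condition_generators: "trace_condition TYPE('u) A \<U>"
proof (rule A.trace_conditionI[OF univ U_sub(2)])
  fix S P Y m p
  assume S: "S \<in> Sum_class TYPE('u) A \<U>" and P: "P \<in> Pres_class TYPE('u) A \<U>" and Y: "Y \<in> Obj A"
    and m: "is_mono A Y P m" and p: "is_epi A S Y p"
  have pa: "arr A S Y p" using p A.Sum_class_Obj[OF S] Y by (rule A.epi_arr)
  have "(\<lambda>f. p \<diamondop> f) ` Hom A U S = Hom A U Y" if U: "U \<in> \<U>" for U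
  proof (intro equalityI subsetI)
    have UO: "U \<in> Obj A" using U U_sub by blast
    fix a assume "a \<in> (\<lambda>f. p \<diamondop> f) ` Hom A U S"
    then show "a \<in> Hom A U Y" using A.arr_comp[OF _ pa] UO pa unfolding arr_def by blast
  next
    have UO: "U \<in> Obj A" using U U_sub by blast
    fix a assume "a \<in> Hom A U Y"
    then have a: "arr A U Y a" using UO Y by (simp add: arr_def)
    obtain b where "arr A U S b" "p \<diamondop> b = a" using epi_lift[OF Sum_B[OF S] Pres_B[OF P] Y m p U a] .
    then show "a \<in> (\<lambda>f. p \<diamondop> f) ` Hom A U S" by (auto simp: arr_def)
  qed
  then show "relative_epi A \<U> S Y p" unfolding relative_epi_def using arrD(3)[OF pa] by blast
qed

text \<open>\<open>S\<close> has one summand for each morphism from a generator to \<open>X\<close>,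
  so each such morphism is the restriction of \<open>p\<close> to a summand. Local smallness bounds
  the index set.\<close>

lemma covering_sum:
  assumes X: "X \<in> Obj A"
  obtains S p where "S \<in> Sum_class TYPE('u) A \<U>" "arr A S X p"
    "\<And>U g. \<lbrakk>U \<in> \<U>; arr A U X g\<rbrakk> \<Longrightarrow> \<exists>h. arr A U S h \<and> p \<diamondop> h = g"
    "\<And>Z f. \<lbrakk>arr A X Z f; \<And>U g. \<lbrakk>U \<in> \<U>; arr A U X g\<rbrakk> \<Longrightarrow> f \<diamondop> g = Zero A U Z\<rbrakk> \<Longrightarrow> f \<diamondop> p = Zero A S Z"
proof -
  let ?J = "Sigma \<U> (\<lambda>U. Hom A U X)"
  have J: "small TYPE('u) ?J"
    using ls U_sub X by (intro small_Sigma[OF univ sm]) (auto simp: locally_small_def)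
  have D: "fst j \<in> \<U>" "fst j \<in> Obj A" if "j \<in> ?J" for j using that U_sub by auto
  obtain S \<iota> where S: "is_coproduct A ?J fst S \<iota>" using A.ex_coproduct[OF univ cc J] D by blast
  have \<iota>: "arr A (fst j) S (\<iota> j)" if "j \<in> ?J" for j using A.coproduct_arr[OF S that D(2)[OF that]] .
  have sn: "arr A (fst j) X (snd j)" if "j \<in> ?J" for j using that U_sub X by (auto simp: arr_def)
  obtain p where p: "arr A S X p" "\<And>j. j \<in> ?J \<Longrightarrow> p \<diamondop> \<iota> j = snd j"
    using A.coproduct_desc[OF S X sn] by blast
  show thesis
  proof (rule that)
    show "S \<in> Sum_class TYPE('u) A \<U>" by (rule A.Sum_classI[OF J D(1) U_sub(2) S])
    show "arr A S X p" by (rule p)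
    show "\<exists>h. arr A U S h \<and> p \<diamondop> h = g" if "U \<in> \<U>" "arr A U X g" for U g
      using that \<iota>[of "(U, g)"] p(2)[of "(U, g)"] by (auto simp: arr_def)
    fix Z f assume f: "arr A X Z f" and z: "\<And>U g. \<lbrakk>U \<in> \<U>; arr A U X g\<rbrakk> \<Longrightarrow> f \<diamondop> g = Zero A U Z"
    have o: "S \<in> Obj A" "Z \<in> Obj A" using p f by (auto dest: arrD)
    show "f \<diamondop> p = Zero A S Z"
    proof (rule A.coproduct_ext[OF S A.arr_comp[OF p(1) f] A.arr_Zero[OF o] D(2)])
      fix j assume j: "j \<in> ?J"
      show "(f \<diamondop> p) \<diamondop> \<iota> j = Zero A S Z \<diamondop> \<iota> j"
        using A.assoc[OF \<iota>[OF j] p(1) f] p(2)[OF j] z[OF D(1)[OF j] sn[OF j]] \<iota>[OF j] o by simp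
    qed
  qed
qed

text \<open>\<open>X\<close> is compared with the cokernel \<open>Q\<close> of
  \<open>S' \<rightarrow> K \<rightarrow> S\<close>, where \<open>S\<close> covers \<open>X\<close>
  and \<open>S'\<close> covers the kernel \<open>K\<close> of \<open>p\<close>. Coverings are not
  known to be epimorphisms, so the comparison \<open>v\<close> is inverted by detection on Hom(U,
  -). Surjectivity holds because \<open>p\<close> already reaches every morphism from
  \<open>U\<close>. For injectivity, a morphism into \<open>Q\<close> lifts to \<open>S\<close>; if
  \<open>v\<close> kills it, the lift comes from \<open>K\<close>, hence from \<open>S'\<close>, and
  dies in \<open>Q\<close>.\<close>

lemma B_eq_Pres: "B = Pres_class TYPE('u) A \<U>"
proof (intro equalityI subsetI)
  fix X assume X: "X \<in> B"
  then have XO: "X \<in> Obj A" using B_Obj by blast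
  obtain S p where S: "S \<in> Sum_class TYPE('u) A \<U>" and p: "arr A S X p"
    and pl: "\<And>U g. \<lbrakk>U \<in> \<U>; arr A U X g\<rbrakk> \<Longrightarrow> \<exists>h. arr A U S h \<and> p \<diamondop> h = g"
    using covering_sum[OF XO] by metis
  have SO: "S \<in> Obj A" using p by (rule arrD)
  obtain K k where k: "is_kernel A S X p K k" using A.ex_kernel[OF SO XO arrD(3)[OF p]] by blast
  note ka = A.kernelD[OF k p]
  have KO: "K \<in> Obj A" using ka by (auto dest: arrD)
  obtain S' s where S': "S' \<in> Sum_class TYPE('u) A \<U>" and s: "arr A S' K s"
    and sl: "\<And>U g. \<lbrakk>U \<in> \<U>; arr A U K g\<rbrakk> \<Longrightarrow> \<exists>h. arr A U S' h \<and> s \<diamondop> h = g"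
    using covering_sum[OF KO] by metis
  have S'O: "S' \<in> Obj A" using s by (rule arrD)
  have ks: "arr A S' S (k \<diamondop> s)" using s ka by auto
  obtain Q q where q: "is_cokernel A S' S (k \<diamondop> s) Q q" using A.ex_cokernel[OF S'O SO arrD(3)[OF ks]] by blast
  note qa = A.cokernelD[OF q ks] and qe = A.cokernel_epi[OF q ks]
  have QO: "Q \<in> Obj A" using qa by (auto dest: arrD)
  have Q: "Q \<in> Pres_class TYPE('u) A \<U>" by (rule A.Pres_classI[OF S' S ks q])
  have "p \<diamondop> (k \<diamondop> s) = Zero A S' X" using A.assoc[OF s ka(1) p] ka s XO by simp
  then obtain v where v: "arr A Q X v" "v \<diamondop> q = p" using A.cokernel_desc[OF q p] by blast
  have "bij_betw (\<lambda>a. v \<diamondop> a) (Hom A U Q) (Hom A U X)" if U: "U \<in> \<U>" for U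
  proof -
    have UO: "U \<in> Obj A" using U U_sub by blast
    have zero: "a = Zero A U Q" if a: "arr A U Q a" "v \<diamondop> a = Zero A U X" for a
    proof -
      have "is_mono A Q Q (Ident A Q)" by (rule A.monoI) (use QO in auto)
      then obtain b where b: "arr A U S b" "q \<diamondop> b = a"
        using epi_lift[OF Sum_B[OF S] Pres_B[OF Q] QO _ qe U a(1)] by blast
      have "p \<diamondop> b = Zero A U X" using A.assoc[OF b(1) qa(1) v(1)] v b a by simp
      then obtain b' where b': "arr A U K b'" "k \<diamondop> b' = b" using A.kernel_lift[OF k b(1)] by blast
      obtain h where h: "arr A U S' h" "s \<diamondop> h = b'" using sl[OF U b'(1)] by blast
      have "b = (k \<diamondop> s) \<diamondop> h" using h b' A.assoc[OF h(1) s ka(1)] by simp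
      then have "a = Zero A S' Q \<diamondop> h" using b A.assoc[OF h(1) ks qa(1)] qa by simp
      then show ?thesis using h QO by simp
    qed
    show ?thesis
      unfolding bij_betw_def
    proof
      show "inj_on (\<lambda>a. v \<diamondop> a) (Hom A U Q)"
      proof (rule inj_onI)
        fix a a' assume "a \<in> Hom A U Q" "a' \<in> Hom A U Q" and eq: "v \<diamondop> a = v \<diamondop> a'"
        then have a: "arr A U Q a" "arr A U Q a'" using UO QO by (simp_all add: arr_def)
        have "v \<diamondop> Sub A U Q a a' = Zero A U X"
          using A.comp_Sub[OF a v(1)] A.Sub_eq_Zero_iff[OF A.arr_comp[OF a(1) v(1)] A.arr_comp[OF a(2) v(1)]] eq
          by simp
        then show "a = a'" using zero[OF A.arr_Sub[OF a]] A.Sub_eq_Zero_iff[OF a] by simp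
      qed
      show "(\<lambda>a. v \<diamondop> a) ` Hom A U Q = Hom A U X"
      proof (intro equalityI subsetI)
        fix g assume "g \<in> (\<lambda>a. v \<diamondop> a) ` Hom A U Q"
        then show "g \<in> Hom A U X" using A.arr_comp[OF _ v(1)] UO v unfolding arr_def by blast
      next
        fix g assume "g \<in> Hom A U X"
        then have g: "arr A U X g" using UO XO by (simp add: arr_def)
        obtain h where h: "arr A U S h" "p \<diamondop> h = g" using pl[OF U g] by blast
        have "g = v \<diamondop> (q \<diamondop> h)" using h v A.assoc[OF h(1) qa(1) v(1)] by simp
        moreover have "q \<diamondop> h \<in> Hom A U Q" using A.arr_comp[OF h(1) qa(1)] by (rule arrD)
        ultimately show "g \<in> (\<lambda>a. v \<diamondop> a) ` Hom A U Q" by (rule image_eqI)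
      qed
    qed
  qed
  then have "is_isomorphism (full_subcategory A B) Q X v"
    by (intro module_generatorsD(2)[OF gen]) (use v X Pres_B[OF Q] in \<open>simp_all add: arr_full[OF B_Obj]\<close>)
  then have "is_isomorphism A Q X v" by (simp add: is_isomorphism_def)
  then show "X \<in> Pres_class TYPE('u) A \<U>" by (rule A.Pres_class_iso[OF Q XO])
qed (rule Pres_B)

text \<open>The finite subcoproducts of a coproduct form a directed family that is jointly epimorphic, so every
  morphism from a generator to the coproduct factors through one of them, where it decomposes
  since finite coproducts are biproducts.\<close>

lemma generators_self_small: "self_small TYPE('u) A \<U>"
  unfolding self_small_def
proof (intro allI impI ballI; elim conjE)
  fix I :: "'u set" and D X \<iota> U
  assume I: "small TYPE('u) I" and DU: "\<forall>i\<in>I. D i \<in> \<U>" and cp: "is_coproduct A I D X \<iota>" and U: "U \<in> \<U>"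
  have DO: "D i \<in> Obj A" and DB: "D i \<in> B" if "i \<in> I" for i using DU U_sub that by auto
  have UO: "U \<in> Obj A" and UB: "U \<in> B" using U U_sub by auto
  have XO: "X \<in> Obj A" using cp by (rule A.coproduct_Obj)
  have XB: "X \<in> B" using coproduct_B[OF cp DB] .
  let ?G = "\<lambda>i. hom_group A U (D i)" and ?H = "hom_group A U X"
  let ?S = "sum_group I ?G" and ?c = "\<lambda>\<phi>. gfinprod ?H (\<lambda>i. \<iota> i \<diamondop> \<phi> i) I"
  interpret H: comm_group ?H by (rule A.hom_comm_group[OF UO XO])
  have \<iota>: "arr A (D i) X (\<iota> i)" if "i \<in> I" for i by (rule A.coproduct_arr[OF cp that DO[OF that]])
  have Gc: "comm_group (?G i)" if "i \<in> I" for i by (rule A.hom_comm_group[OF UO DO[OF that]])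
  have Gg: "group (?G i)" if "i \<in> I" for i using Gc[OF that] by (simp add: comm_group_def)
  have hom: "?c \<in> hom ?S ?H" by (rule H.hom_group_sum[OF A.comp_hom[OF \<iota> UO] Gg])
  have carS: "carrier ?S = {x \<in> \<Pi>\<^sub>E i\<in>I. Hom A U (D i). finite {i \<in> I. x i \<noteq> Zero A U (D i)}}"
    by (simp add: carrier_sum_group[OF Gg])
  have comp: "?c x = finprod ?H (\<lambda>i. \<iota> i \<diamondop> x i) J"
    if "finite J" "J \<subseteq> I" "\<And>i. i \<in> J \<Longrightarrow> arr A U (D i) (x i)" "\<And>i. i \<in> I - J \<Longrightarrow> x i = Zero A U (D i)" for x J
  proof -
    have c: "(\<lambda>i. \<iota> i \<diamondop> x i) \<in> I \<rightarrow> carrier ?H"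
    proof
      fix i assume i: "i \<in> I"
      then have "arr A U (D i) (x i)" using that UO DO[OF i] by (cases "i \<in> J") auto
      then show "\<iota> i \<diamondop> x i \<in> carrier ?H" using A.arr_comp[OF _ \<iota>[OF i]] by (simp add: arr_def)
    qed
    have "?c x = gfinprod ?H (\<lambda>i. \<iota> i \<diamondop> x i) J"
    proof (rule H.gfinprod_mono_neutral_cong_right[OF that(2) _ _ c])
      show "\<iota> i \<diamondop> x i = \<one>\<^bsub>?H\<^esub>" if "i \<in> I - J" for i using \<open>\<And>i. i \<in> I - J \<Longrightarrow> x i = _\<close>[OF that] \<iota> UO that by simp
    qed simp
    also have "\<dots> = finprod ?H (\<lambda>i. \<iota> i \<diamondop> x i) J"
      using c that by (intro H.gfinprod_eq_finprod) (auto simp: Pi_iff)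
    finally show ?thesis .
  qed
  have "inj_on ?c (carrier ?S)"
  proof (rule inj_onI)
    \<comment> \<open>A projection of the coproduct reads the \<open>i\<close>-th coefficient off
      the value of the canonical map.\<close>
    have coeff: "x i = \<pi> \<diamondop> ?c x"
      if x: "x \<in> carrier ?S" and i: "i \<in> I" and \<pi>: "arr A X (D i) \<pi>" "\<pi> \<diamondop> \<iota> i = Ident A (D i)"
        "\<And>j. \<lbrakk>j \<in> I; j \<noteq> i\<rbrakk> \<Longrightarrow> \<pi> \<diamondop> \<iota> j = Zero A (D j) (D i)" for x i \<pi>
    proof -
      \<comment> \<open>\<open>i\<close> is inserted even if \<open>x i\<close> is zero, so that the
        finite sum contains the term that the projection picks out.\<close>
      let ?J = "insert i {i \<in> I. x i \<noteq> Zero A U (D i)}"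
      have xa: "arr A U (D j) (x j)" if "j \<in> I" for j using x that UO DO unfolding carS by (auto simp: arr_def PiE_iff)
      have J: "finite ?J" "?J \<subseteq> I" using x i unfolding carS by auto
      interpret Gi: comm_group "?G i" by (rule Gc[OF i])
      have xc: "(\<lambda>j. \<iota> j \<diamondop> x j) \<in> ?J \<rightarrow> carrier ?H"
        using A.arr_comp[OF xa \<iota>] J(2) by (auto simp: arr_def)
      have "\<pi> \<diamondop> ?c x = \<pi> \<diamondop> finprod ?H (\<lambda>i. \<iota> i \<diamondop> x i) ?J"
        by (subst comp[OF J]) (use xa J(2) in auto)
      also have "\<dots> = finprod (?G i) (\<lambda>j. \<pi> \<diamondop> \<iota> j \<diamondop> x j) ?J"
        by (rule hom_finprod[OF H.comm_group_axioms Gi.comm_group_axioms A.comp_hom[OF \<pi>(1) UO] xc])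
      also have "\<dots> = finprod (?G i) (\<lambda>j. if i = j then x j else \<one>\<^bsub>?G i\<^esub>) ?J"
      proof (rule Gi.finprod_cong'[OF refl])
        show "(\<lambda>j. if i = j then x j else \<one>\<^bsub>?G i\<^esub>) \<in> ?J \<rightarrow> carrier (?G i)"
          using xa[OF i] arrD(3)[OF A.arr_Zero[OF UO DO[OF i]]] by (auto simp: arr_def)
        fix j assume "j \<in> ?J"
        then have j: "j \<in> I" using J by blast
        show "\<pi> \<diamondop> \<iota> j \<diamondop> x j = (if i = j then x j else \<one>\<^bsub>?G i\<^esub>)"
          using A.assoc[OF xa[OF j] \<iota>[OF j] \<pi>(1)] \<pi>(2) \<pi>(3)[OF j] xa[OF j] DO[OF i] by auto
      qed
      also have "\<dots> = x i"
      proof -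
        have eq: "finprod (?G i) (\<lambda>j. if i = j then x j else \<one>\<^bsub>?G i\<^esub>) ?J =
          finprod (?G i) (\<lambda>j. if i = j then x i else \<one>\<^bsub>?G i\<^esub>) ?J"
          by (rule arg_cong[of _ _ "\<lambda>f. finprod (?G i) f ?J"]) auto
        show ?thesis
          unfolding eq using Gi.finprod_singleton[of i ?J "\<lambda>_. x i"] J(1) xa[OF i] by (simp add: arr_def Pi_iff)
      qed
      finally show ?thesis by simp
    qed
    fix x y assume x: "x \<in> carrier ?S" and y: "y \<in> carrier ?S" and eq: "?c x = ?c y"
    show "x = y"
    proof (rule extensionalityI[of _ I])
      show "x \<in> extensional I" "y \<in> extensional I" using x y unfolding carS by (auto simp: PiE_iff)
      fix i assume i: "i \<in> I"
      obtain \<pi> where \<pi>: "arr A X (D i) \<pi>" "\<pi> \<diamondop> \<iota> i = Ident A (D i)"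
        "\<And>j. \<lbrakk>j \<in> I; j \<noteq> i\<rbrakk> \<Longrightarrow> \<pi> \<diamondop> \<iota> j = Zero A (D j) (D i)"
        using A.coproduct_proj[OF cp DO i] by blast
      show "x i = y i" using coeff[OF x i \<pi>] coeff[OF y i \<pi>] eq by simp
    qed
  qed
  moreover have "carrier ?H \<subseteq> ?c ` carrier ?S"
  proof
    fix a assume "a \<in> carrier ?H"
    then have a: "arr A U X a" using UO XO by (simp add: arr_def)
    define W where "W = {(Y, w). arr A Y X w \<and> (\<exists>J \<kappa>. finite J \<and> J \<subseteq> I \<and> is_coproduct A J D Y \<kappa> \<and> (\<forall>j\<in>J. w \<diamondop> \<kappa> j = \<iota> j))}"
    have ex: "\<exists>Y w \<kappa>. arr A Y X w \<and> is_coproduct A J D Y \<kappa> \<and> (\<forall>j\<in>J. w \<diamondop> \<kappa> j = \<iota> j)"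
      if "J \<subseteq> I" "finite J" for J
    proof -
      have "D j \<in> Obj A" if "j \<in> J" for j using DO \<open>J \<subseteq> I\<close> that by blast
      then obtain Y \<kappa> where Y: "is_coproduct A J D Y \<kappa>"
        using A.ex_coproduct[OF univ cc small_finite[OF univ \<open>finite J\<close>]] by blast
      have "arr A (D j) X (\<iota> j)" if "j \<in> J" for j using \<iota> \<open>J \<subseteq> I\<close> that by blast
      then show ?thesis using A.coproduct_desc[OF Y XO, of \<iota>] Y by metis
    qed
    have WB: "Y \<in> B" if W: "(Y, w) \<in> W" for Y w
    proof -
      obtain J \<kappa> where "J \<subseteq> I" "is_coproduct A J D Y \<kappa>" using W by (auto simp: W_def)
      then show ?thesis using coproduct_B[of J D Y \<kappa>] DB by blast
    qed
    have fac: "\<exists>b. arr A Y Z b \<and> z \<diamondop> b = w"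
      if Y: "is_coproduct A J D Y \<kappa>" "arr A Y X w" "\<forall>j\<in>J. w \<diamondop> \<kappa> j = \<iota> j"
        and Z: "is_coproduct A J' D Z \<mu>" "arr A Z X z" "\<forall>j\<in>J'. z \<diamondop> \<mu> j = \<iota> j" and J: "J \<subseteq> J'" "J' \<subseteq> I"
      for Y Z z w J J' \<kappa> \<mu>
    proof -
      have dj: "D j \<in> Obj A" if "j \<in> J'" for j using DO J that by blast
      have \<mu>: "arr A (D j) Z (\<mu> j)" if "j \<in> J" for j using A.coproduct_arr[OF Z(1)] dj J that by blast
      obtain b where b: "arr A Y Z b" "\<And>j. j \<in> J \<Longrightarrow> b \<diamondop> \<kappa> j = \<mu> j"
        using A.coproduct_desc[OF Y(1) arrD(1)[OF Z(2)] \<mu>] by blast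
      have "z \<diamondop> b = w"
      proof (rule A.coproduct_ext[OF Y(1) A.arr_comp[OF b(1) Z(2)] Y(2)])
        fix j assume j: "j \<in> J"
        then show "D j \<in> Obj A" using dj J by blast
        then show "(z \<diamondop> b) \<diamondop> \<kappa> j = w \<diamondop> \<kappa> j"
          using A.assoc[OF A.coproduct_arr[OF Y(1) j] b(1) Z(2)] b(2)[OF j] Y(3) Z(3) j J by auto
      qed
      then show ?thesis using b by blast
    qed
    have dir: "\<exists>(Z, z)\<in>W. factors (full_subcategory A B) Y w Z z \<and> factors (full_subcategory A B) Y' w' Z z"
      if "(Y, w) \<in> W" "(Y', w') \<in> W" for Y w Y' w'
    proof -
      from that obtain J \<kappa> J' \<kappa>' where Y: "arr A Y X w" "is_coproduct A J D Y \<kappa>" "\<forall>j\<in>J. w \<diamondop> \<kappa> j = \<iota> j"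
        and Y': "arr A Y' X w'" "is_coproduct A J' D Y' \<kappa>'" "\<forall>j\<in>J'. w' \<diamondop> \<kappa>' j = \<iota> j"
        and J: "finite J" "J \<subseteq> I" "finite J'" "J' \<subseteq> I" by (auto simp: W_def)
      \<comment> \<open>Two finite subcoproducts both factor through the one over the union of their
        index sets.\<close>
      obtain Z z \<mu> where Z: "arr A Z X z" "is_coproduct A (J \<union> J') D Z \<mu>" "\<forall>j\<in>J \<union> J'. z \<diamondop> \<mu> j = \<iota> j"
        using ex[of "J \<union> J'"] J by auto
      have ZW: "(Z, z) \<in> W" using Z J unfolding W_def by blast
      have "Y \<in> B" "Y' \<in> B" "Z \<in> B" using WB \<open>(Y, w) \<in> W\<close> \<open>(Y', w') \<in> W\<close> ZW by blast+
      moreover have "\<exists>b. arr A Y Z b \<and> z \<diamondop> b = w"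
        by (rule fac[OF Y(2,1,3) Z(2,1,3)]) (use J in auto)
      moreover have "\<exists>b. arr A Y' Z b \<and> z \<diamondop> b = w'"
        by (rule fac[OF Y'(2,1,3) Z(2,1,3)]) (use J in auto)
      ultimately show ?thesis using ZW unfolding factors_def arr_full[OF B_Obj] Comp_full by blast
    qed
    have sink: "directed_sink (full_subcategory A B) X W"
      unfolding directed_sink_def
    proof (intro conjI)
      show "W \<noteq> {}" using ex[of "{}"] by (auto simp: W_def)
      show "\<forall>(Y, w)\<in>W. arr (full_subcategory A B) Y X w"
        using WB XB by (auto simp: arr_full[OF B_Obj] W_def)
    qed (use dir in blast)
    \<comment> \<open>Every injection of \<open>X\<close> factors through a one-element
      subcoproduct, so two morphisms that agree on \<open>W\<close> are equal.\<close>
    have "dominated (full_subcategory A B) X W a"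
      unfolding dominated_def arr_full[OF B_Obj] Comp_full
    proof (intro allI impI; elim conjE)
      fix L g g' assume g: "arr A X L g" "arr A X L g'" and eq: "\<forall>(Y, w)\<in>W. g \<diamondop> w = g' \<diamondop> w"
      have "g = g'"
      proof (rule A.coproduct_ext[OF cp g DO])
        fix i assume i: "i \<in> I"
        obtain Y w \<kappa> where Y: "arr A Y X w" "is_coproduct A {i} D Y \<kappa>" "w \<diamondop> \<kappa> i = \<iota> i"
          using ex[of "{i}"] i by auto
        have "(Y, w) \<in> W" using Y i unfolding W_def by blast
        then have "g \<diamondop> w = g' \<diamondop> w" using eq by blast
        moreover have "arr A (D i) Y (\<kappa> i)" using A.coproduct_arr[OF Y(2)] DO[OF i] by simp
        ultimately show "g \<diamondop> \<iota> i = g' \<diamondop> \<iota> i" using A.assoc[OF _ Y(1) g(1)] A.assoc[OF _ Y(1) g(2)] Y(3) by metis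
      qed
      then show "g \<diamondop> a = g' \<diamondop> a" by simp
    qed
    moreover have "arr (full_subcategory A B) U X a" unfolding arr_full[OF B_Obj] using UB XB a by blast
    ultimately have "\<exists>(Y, w)\<in>W. factors (full_subcategory A B) U a Y w"
      by (intro module_generatorsD(3)[OF gen sink U])
    then obtain Y w b where W: "(Y, w) \<in> W" and b: "arr A U Y b" "w \<diamondop> b = a"
      by (auto simp: factors_def arr_full[OF B_Obj])
    then obtain J \<kappa> where w: "arr A Y X w" and J: "finite J" "J \<subseteq> I" and Y: "is_coproduct A J D Y \<kappa>"
      and w\<kappa>: "\<forall>j\<in>J. w \<diamondop> \<kappa> j = \<iota> j" by (auto simp: W_def)
    have YO: "Y \<in> Obj A" using w by (rule arrD)
    have dj: "D j \<in> Obj A" if "j \<in> J" for j using DO J that by blast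
    have \<kappa>: "arr A (D j) Y (\<kappa> j)" if "j \<in> J" for j using A.coproduct_arr[OF Y that dj[OF that]] .
    have "\<forall>j. \<exists>\<pi>. j \<in> J \<longrightarrow> arr A Y (D j) \<pi> \<and> \<pi> \<diamondop> \<kappa> j = Ident A (D j) \<and>
        (\<forall>i. i \<in> J \<longrightarrow> i \<noteq> j \<longrightarrow> \<pi> \<diamondop> \<kappa> i = Zero A (D i) (D j))"
      using A.coproduct_proj[OF Y dj] by metis
    then obtain \<pi> where \<pi>: "\<And>j. j \<in> J \<Longrightarrow> arr A Y (D j) (\<pi> j)" "\<And>j. j \<in> J \<Longrightarrow> \<pi> j \<diamondop> \<kappa> j = Ident A (D j)"
      "\<And>j i. \<lbrakk>j \<in> J; i \<in> J; i \<noteq> j\<rbrakk> \<Longrightarrow> \<pi> j \<diamondop> \<kappa> i = Zero A (D i) (D j)" by metis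
    let ?E = "hom_group A Y Y"
    have Ec: "comm_group ?E" by (rule A.hom_comm_group[OF YO YO])
    have \<kappa>\<pi>: "arr A Y Y (\<kappa> j \<diamondop> \<pi> j)" if "j \<in> J" for j using A.arr_comp[OF \<pi>(1)[OF that] \<kappa>[OF that]] .
    have \<kappa>\<pi>c: "(\<lambda>j. \<kappa> j \<diamondop> \<pi> j) \<in> J \<rightarrow> carrier ?E" using \<kappa>\<pi> by (auto simp: arr_def)
    \<comment> \<open>The biproduct decomposition of the identity of the finite coproduct
      \<open>Y\<close>, verified on the injections.\<close>
    define e where "e = finprod ?E (\<lambda>j. \<kappa> j \<diamondop> \<pi> j) J"
    have ea: "arr A Y Y e"
      unfolding e_def using comm_monoid.finprod_closed[OF comm_group.axioms(1)[OF Ec] \<kappa>\<pi>c] YO by (simp add: arr_def)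
    have "e = Ident A Y"
    proof (rule A.coproduct_ext[OF Y ea A.arr_Ident[OF YO] dj])
      fix i assume i: "i \<in> J"
      let ?K = "hom_group A (D i) Y"
      interpret K: comm_group ?K by (rule A.hom_comm_group[OF dj[OF i] YO])
      have "e \<diamondop> \<kappa> i = finprod ?K (\<lambda>j. (\<kappa> j \<diamondop> \<pi> j) \<diamondop> \<kappa> i) J"
        unfolding e_def by (rule hom_finprod[OF Ec K.comm_group_axioms A.hom_comp[OF \<kappa>[OF i] YO] \<kappa>\<pi>c])
      also have "\<dots> = finprod ?K (\<lambda>j. if i = j then \<kappa> j else \<one>\<^bsub>?K\<^esub>) J"
      proof (rule K.finprod_cong'[OF refl])
        show "(\<lambda>j. if i = j then \<kappa> j else \<one>\<^bsub>?K\<^esub>) \<in> J \<rightarrow> carrier ?K"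
          using \<kappa>[OF i] arrD(3)[OF A.arr_Zero[OF dj[OF i] YO]] by (auto simp: arr_def)
        fix j assume j: "j \<in> J"
        show "(\<kappa> j \<diamondop> \<pi> j) \<diamondop> \<kappa> i = (if i = j then \<kappa> j else \<one>\<^bsub>?K\<^esub>)"
          using A.assoc[OF \<kappa>[OF i] \<pi>(1)[OF j] \<kappa>[OF j]] \<pi>(2)[OF j] \<pi>(3)[OF j i] \<kappa>[OF j] dj[OF i] by auto
      qed
      also have "\<dots> = \<kappa> i"
      proof -
        have eq: "finprod ?K (\<lambda>j. if i = j then \<kappa> j else \<one>\<^bsub>?K\<^esub>) J = finprod ?K (\<lambda>j. if i = j then \<kappa> i else \<one>\<^bsub>?K\<^esub>) J"
          by (rule arg_cong[of _ _ "\<lambda>f. finprod ?K f J"]) auto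
        show ?thesis
          unfolding eq using K.finprod_singleton[OF i J(1), of "\<lambda>_. \<kappa> i"] \<kappa>[OF i] by (simp add: arr_def Pi_iff)
      qed
      finally show "e \<diamondop> \<kappa> i = Ident A Y \<diamondop> \<kappa> i" using \<kappa>[OF i] by simp
    qed
    then have "b = e \<diamondop> b" using b by simp
    also have "\<dots> = finprod (hom_group A U Y) (\<lambda>j. (\<kappa> j \<diamondop> \<pi> j) \<diamondop> b) J"
      unfolding e_def by (rule hom_finprod[OF Ec A.hom_comm_group[OF UO YO] A.hom_comp[OF b(1) YO] \<kappa>\<pi>c])
    finally have bf: "b = finprod (hom_group A U Y) (\<lambda>j. (\<kappa> j \<diamondop> \<pi> j) \<diamondop> b) J" .
    have bc: "(\<lambda>j. (\<kappa> j \<diamondop> \<pi> j) \<diamondop> b) \<in> J \<rightarrow> carrier (hom_group A U Y)"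
      using A.arr_comp[OF b(1) \<kappa>\<pi>] by (auto simp: arr_def)
    have "a = w \<diamondop> finprod (hom_group A U Y) (\<lambda>j. (\<kappa> j \<diamondop> \<pi> j) \<diamondop> b) J" using b(2) bf by simp
    also have "\<dots> = finprod ?H (\<lambda>j. w \<diamondop> (\<kappa> j \<diamondop> \<pi> j) \<diamondop> b) J"
      by (rule hom_finprod[OF A.hom_comm_group[OF UO YO] H.comm_group_axioms A.comp_hom[OF w UO] bc])
    finally have af: "a = finprod ?H (\<lambda>j. w \<diamondop> (\<kappa> j \<diamondop> \<pi> j) \<diamondop> b) J" .
    \<comment> \<open>The coordinates of \<open>b\<close> in the finite coproduct, extended by zero
      outside \<open>J\<close>: a preimage of \<open>a\<close> under the canonical map.\<close>
    define x where "x = (\<lambda>i\<in>I. if i \<in> J then \<pi> i \<diamondop> b else Zero A U (D i))"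
    have \<pi>b: "arr A U (D j) (\<pi> j \<diamondop> b)" if "j \<in> J" for j using A.arr_comp[OF b(1) \<pi>(1)[OF that]] .
    have xS: "x \<in> carrier ?S"
      unfolding carS x_def using \<pi>b A.arr_Zero[OF UO DO] J
      by (auto simp: arr_def elim: rev_finite_subset split: if_splits)
    have "?c x = finprod ?H (\<lambda>i. \<iota> i \<diamondop> x i) J"
      by (rule comp[OF J]) (use \<pi>b J(2) in \<open>auto simp: x_def subset_iff\<close>)
    also have "\<dots> = finprod ?H (\<lambda>j. w \<diamondop> (\<kappa> j \<diamondop> \<pi> j) \<diamondop> b) J"
    proof (rule H.finprod_cong'[OF refl])
      show "(\<lambda>j. w \<diamondop> (\<kappa> j \<diamondop> \<pi> j) \<diamondop> b) \<in> J \<rightarrow> carrier ?H"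
        using A.arr_comp[OF A.arr_comp[OF b(1) \<kappa>\<pi>] w] by (auto simp: arr_def)
      fix j assume j: "j \<in> J"
      have "x j = \<pi> j \<diamondop> b" using j J by (auto simp: x_def)
      then show "\<iota> j \<diamondop> x j = w \<diamondop> (\<kappa> j \<diamondop> \<pi> j) \<diamondop> b"
        using w\<kappa> j A.assoc[OF b(1) \<pi>(1)[OF j] \<kappa>[OF j]] A.assoc[OF \<pi>b[OF j] \<kappa>[OF j] w] by simp
    qed
    finally have "?c x = a" unfolding af[symmetric] .
    then show "a \<in> ?c ` carrier ?S" using xS by (rule image_eqI[OF sym])
  qed
  moreover have "?c ` carrier ?S \<subseteq> carrier ?H" using hom by (auto simp: hom_def)
  ultimately have "bij_betw ?c (carrier ?S) (carrier ?H)" unfolding bij_betw_def by (intro conjI equalityI)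
  then show "?c \<in> iso ?S ?H" using hom unfolding iso_def by blast
qed

lemma presenting_set_generators: "presenting_set TYPE('u) A B \<U>"
  unfolding presenting_set_def
  using U_sub(2) sm generators_self_small B_eq_Pres trace_condition_generators by blast

end

subsection \<open>The module category of a presenting set\<close>

lemma finprod_mem:
  assumes G: "comm_monoid G" and S: "S \<subseteq> carrier G" "\<one>\<^bsub>G\<^esub> \<in> S" "\<And>x y. \<lbrakk>x \<in> S; y \<in> S\<rbrakk> \<Longrightarrow> x \<otimes>\<^bsub>G\<^esub> y \<in> S"
    and f: "\<And>i. i \<in> J \<Longrightarrow> f i \<in> S"
  shows "finprod G f J \<in> S"
proof -
  interpret comm_monoid G by fact
  show ?thesis
  proof (cases "finite J")
    case True
    then show ?thesis using f
    proof (induction J)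
      case (insert i J)
      have "f \<in> J \<rightarrow> carrier G" "f i \<in> carrier G" using insert.prems S(1) by auto
      then show ?case using insert S(3) by simp
    qed (simp add: S(2))
  qed (simp add: S(2))
qed

lemma gfinprod_single:
  assumes G: "comm_monoid G" and i: "i \<in> I" "f i \<in> carrier G" and z: "\<And>j. \<lbrakk>j \<in> I; j \<noteq> i\<rbrakk> \<Longrightarrow> f j = \<one>\<^bsub>G\<^esub>"
  shows "gfinprod G f I = f i"
proof -
  interpret comm_monoid G by fact
  have "f \<in> I \<rightarrow> carrier G" using i z by (metis Pi_I one_closed)
  then have "gfinprod G f I = gfinprod G f {i}"
    using i z by (intro gfinprod_mono_neutral_cong_right) auto
  also have "\<dots> = f i" using i by simp
  finally show ?thesis .
qed

section \<open>Morphisms from a presenting set into sums and presented objects\<close>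

context
  fixes A :: "('o, 'm) preadd" (structure) and \<U> :: "'o set"
  assumes univ: "universe TYPE('u)" and A: "abelian_category A" and ls: "locally_small TYPE('u) A"
    and cc: "cocomplete TYPE('u) A"
    and U: "\<U> \<subseteq> Obj A" and ss: "self_small TYPE('u) A \<U>" and tr: "trace_condition TYPE('u) A \<U>"
begin

interpretation A: abelian_category A by (rule A)

lemma self_small_iso:
  assumes I: "small TYPE('u) (I :: 'u set)" and D: "\<And>i. i \<in> I \<Longrightarrow> D i \<in> \<U>" and cp: "is_coproduct A I D X \<iota>"
    and V: "V \<in> \<U>"
  shows "(\<lambda>\<phi>. gfinprod (hom_group A V X) (\<lambda>i. \<iota> i \<diamondop> \<phi> i) I)
    \<in> iso (sum_group I (\<lambda>i. hom_group A V (D i))) (hom_group A V X)"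
  using ss I D cp V unfolding self_small_def by blast

text \<open>An induction principle for Hom(V, X): by self-smallness every morphism is a finite sum
  of morphisms through single injections.\<close>

lemma self_small_span:
  assumes I: "small TYPE('u) (I :: 'u set)" and D: "\<And>i. i \<in> I \<Longrightarrow> D i \<in> \<U>" and cp: "is_coproduct A I D X \<iota>"
    and V: "V \<in> \<U>" and a: "arr A V X a"
    and zero: "Q (Zero A V X)" and add: "\<And>a b. \<lbrakk>arr A V X a; arr A V X b; Q a; Q b\<rbrakk> \<Longrightarrow> Q (Add A a b)"
    and gen: "\<And>i \<phi>. \<lbrakk>i \<in> I; arr A V (D i) \<phi>\<rbrakk> \<Longrightarrow> Q (\<iota> i \<diamondop> \<phi>)"
  shows "Q a"
proof -
  let ?H = "hom_group A V X" and ?G = "\<lambda>i. hom_group A V (D i)"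
  have VO: "V \<in> Obj A" and XO: "X \<in> Obj A" using a by (auto dest: arrD)
  have DO: "D i \<in> Obj A" if "i \<in> I" for i using D U that by blast
  interpret H: comm_group ?H by (rule A.hom_comm_group[OF VO XO])
  have G: "group (?G i)" if "i \<in> I" for i
    using A.hom_comm_group[OF VO DO[OF that]] by (simp add: comm_group_def)
  have "a \<in> (\<lambda>\<phi>. gfinprod ?H (\<lambda>i. \<iota> i \<diamondop> \<phi> i) I) ` carrier (sum_group I ?G)"
    using self_small_iso[OF I D cp V] a by (simp add: iso_def bij_betw_def arr_def)
  then obtain \<phi> where \<phi>: "\<phi> \<in> carrier (sum_group I ?G)" "a = gfinprod ?H (\<lambda>i. \<iota> i \<diamondop> \<phi> i) I" by blast
  have \<phi>a: "arr A V (D i) (\<phi> i)" if "i \<in> I" for i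
    using \<phi>(1) that VO DO by (auto simp: carrier_sum_group[OF G] arr_def PiE_iff)
  let ?S = "{a. arr A V X a \<and> Q a}"
  have S: "x \<otimes>\<^bsub>?H\<^esub> y \<in> ?S" if "x \<in> ?S" "y \<in> ?S" for x y
    using that add A.arr_Add by simp
  have S1: "?S \<subseteq> carrier ?H" "\<one>\<^bsub>?H\<^esub> \<in> ?S" using zero VO XO by (auto simp: arr_def dest: arrD(3)[OF A.arr_Zero])
  have "gfinprod ?H (\<lambda>i. \<iota> i \<diamondop> \<phi> i) I \<in> ?S"
    unfolding gfinprod_def
  \<comment> \<open>On an infinite support \<open>gfinprod\<close> returns the neutral element; that
    case is covered by \<open>Q\<close> at zero.\<close>
  proof (split if_split, intro conjI impI S1(2))
    show "finprod ?H (\<lambda>i. \<iota> i \<diamondop> \<phi> i) {x \<in> I. \<iota> x \<diamondop> \<phi> x \<noteq> \<one>\<^bsub>?H\<^esub>} \<in> ?S"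
    proof (rule finprod_mem[OF H.comm_monoid_axioms S1 S])
      fix i assume "i \<in> {x \<in> I. \<iota> x \<diamondop> \<phi> x \<noteq> \<one>\<^bsub>?H\<^esub>}"
      then have i: "i \<in> I" by simp
      show "\<iota> i \<diamondop> \<phi> i \<in> ?S"
        using gen[OF i \<phi>a[OF i]] A.arr_comp[OF \<phi>a[OF i] A.coproduct_arr[OF cp i DO[OF i]]] by simp
    qed
  qed
  then show ?thesis using \<phi>(2) by simp
qed

text \<open>Hom(V, X) is the direct sum of the groups Hom(V, D i), so a homomorphism out of it is
  given by its components: \<open>ev\<close> is their sum after the inverse of the canonical
  isomorphism.\<close>

lemma self_small_extend:
  assumes I: "small TYPE('u) (I :: 'u set)" and D: "\<And>i. i \<in> I \<Longrightarrow> D i \<in> \<U>" and cp: "is_coproduct A I D X \<iota>"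
    and V: "V \<in> \<U>" and G: "comm_group G" and f: "\<And>i. i \<in> I \<Longrightarrow> f i \<in> hom (hom_group A V (D i)) G"
  obtains ev where "ev \<in> hom (hom_group A V X) G" "\<And>i \<phi>. \<lbrakk>i \<in> I; arr A V (D i) \<phi>\<rbrakk> \<Longrightarrow> ev (\<iota> i \<diamondop> \<phi>) = f i \<phi>"
proof -
  let ?H = "hom_group A V X" and ?G = "\<lambda>i. hom_group A V (D i)"
  let ?c = "\<lambda>\<phi>. gfinprod ?H (\<lambda>i. \<iota> i \<diamondop> \<phi> i) I"
  have VO: "V \<in> Obj A" and XO: "X \<in> Obj A" using V U A.coproduct_Obj[OF cp] by auto
  have DO: "D i \<in> Obj A" if "i \<in> I" for i using D U that by blast
  interpret H: comm_group ?H by (rule A.hom_comm_group[OF VO XO])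
  interpret G: comm_group G by fact
  have Gg: "group (?G i)" if "i \<in> I" for i
    using A.hom_comm_group[OF VO DO[OF that]] by (simp add: comm_group_def)
  note iso = self_small_iso[OF I D cp V]
  define g where "g = inv_into (carrier (sum_group I ?G)) ?c"
  have Sg: "group (sum_group I ?G)" using Gg by simp
  have g: "g \<in> hom ?H (sum_group I ?G)"
    using group.iso_set_sym[OF Sg iso] unfolding g_def by (simp add: iso_def)
  have F: "(\<lambda>x. gfinprod G (\<lambda>i. f i (x i)) I) \<in> hom (sum_group I ?G) G"
    by (rule G.hom_group_sum[OF f Gg])
  show thesis
  proof (rule that)
    show "(\<lambda>x. gfinprod G (\<lambda>i. f i (x i)) I) \<circ> g \<in> hom ?H G" using hom_compose[OF g F] .
    fix i \<phi> assume i: "i \<in> I" and \<phi>: "arr A V (D i) \<phi>"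
    \<comment> \<open>The family with the single entry \<phi> at \<open>i\<close>, which the
      canonical map sends to \<open>\<iota> i \<diamondop> \<phi>\<close>.\<close>
    define x where "x = (\<lambda>j\<in>I. if j = i then \<phi> else Zero A V (D j))"
    have x: "x \<in> carrier (sum_group I ?G)"
    proof -
      have "{j \<in> I. x j \<noteq> Zero A V (D j)} \<subseteq> {i}" by (auto simp: x_def)
      then have "finite {j \<in> I. x j \<noteq> Zero A V (D j)}" by (rule finite_subset) simp
      moreover have "x \<in> (\<Pi>\<^sub>E j\<in>I. Hom A V (D j))"
        using \<phi> arrD(3)[OF A.arr_Zero[OF VO DO]] by (auto simp: x_def arr_def)
      ultimately show ?thesis by (simp add: carrier_sum_group[OF Gg])
    qed
    have \<iota>: "arr A (D j) X (\<iota> j)" if "j \<in> I" for j by (rule A.coproduct_arr[OF cp that DO[OF that]])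
    have "?c x = \<iota> i \<diamondop> x i"
      by (rule gfinprod_single[OF H.comm_monoid_axioms i])
        (use i A.arr_comp[OF \<phi> \<iota>[OF i]] \<iota> VO in \<open>auto simp: x_def arr_def dest: A.comp_Zero\<close>)
    then have "?c x = \<iota> i \<diamondop> \<phi>" using i by (simp add: x_def)
    moreover have "g (?c x) = x"
    proof -
      have "inj_on ?c (carrier (sum_group I ?G))" using iso unfolding iso_def bij_betw_def by blast
      then show ?thesis unfolding g_def using x by (rule inv_into_f_f)
    qed
    ultimately have gx: "g (\<iota> i \<diamondop> \<phi>) = x" by simp
    have "gfinprod G (\<lambda>j. f j (x j)) I = f i (x i)"
    proof (rule gfinprod_single[OF G.comm_monoid_axioms i])
      show "f i (x i) \<in> carrier G" using hom_in_carrier[OF f[OF i]] \<phi> i by (simp add: x_def arr_def)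
      fix j assume j: "j \<in> I" "j \<noteq> i"
      show "f j (x j) = \<one>\<^bsub>G\<^esub>"
        using hom_one[OF f[OF j(1)] Gg[OF j(1)] G.group_axioms] j by (simp add: x_def)
    qed
    then show "((\<lambda>x. gfinprod G (\<lambda>i. f i (x i)) I) \<circ> g) (\<iota> i \<diamondop> \<phi>) = f i \<phi>"
      using gx i by (simp add: x_def)
  qed
qed

lemma presenting_lift:
  assumes S: "S \<in> Sum_class TYPE('u) A \<U>" and P: "P \<in> Pres_class TYPE('u) A \<U>" and Y: "Y \<in> Obj A"
    and m: "is_mono A Y P m" and p: "is_epi A S Y p" and V: "V \<in> \<U>" and a: "arr A V Y a"
  obtains b where "arr A V S b" "p \<diamondop> b = a"
proof -
  have "relative_epi A \<U> S Y p" using tr S P Y m p unfolding trace_condition_def by blast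
  then have "(\<lambda>f. p \<diamondop> f) ` Hom A V S = Hom A V Y" using V unfolding relative_epi_def by blast
  then have "a \<in> (\<lambda>f. p \<diamondop> f) ` Hom A V S" using arrD(3)[OF a] by simp
  then obtain b where "b \<in> Hom A V S" "p \<diamondop> b = a" by blast
  then show thesis using that A.Sum_class_Obj[OF S] arrD(1)[OF a] by (simp add: arr_def)
qed

text \<open>This is (b) with \<open>P\<close> as a subobject of itself: Hom(V, -) turns
  \<open>c\<close> into a surjection.\<close>

lemma presentation_lift:
  assumes S: "S \<in> Sum_class TYPE('u) A \<U>" and T: "T \<in> Sum_class TYPE('u) A \<U>" and f: "arr A S T f"
    and c: "is_cokernel A S T f P c" and V: "V \<in> \<U>" and a: "arr A V P a"
  obtains b where "arr A V T b" "c \<diamondop> b = a"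
proof -
  have PO: "P \<in> Obj A" using a by (rule arrD)
  have "is_mono A P P (Ident A P)" by (rule A.monoI) (use PO in auto)
  then show thesis
    using presenting_lift[OF T A.Pres_classI[OF S T f c] PO _ A.cokernel_epi[OF c f] V a] that by blast
qed

text \<open>The image \<open>Y\<close> of \<open>f\<close> is the kernel of \<open>c\<close>, since
  a monomorphism is the kernel of its cokernel; so \<open>b\<close> factors through
  \<open>Y\<close>. As \<open>Y\<close> is a subobject of the sum \<open>T\<close>, which counts as
  presented, (b) lifts it along the epimorphism from \<open>S\<close>.\<close>

lemma presentation_exact:
  assumes S: "S \<in> Sum_class TYPE('u) A \<U>" and T: "T \<in> Sum_class TYPE('u) A \<U>" and f: "arr A S T f"
    and c: "is_cokernel A S T f P c" and V: "V \<in> \<U>" and b: "arr A V T b" and cb: "c \<diamondop> b = Zero A V P"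
  obtains d where "arr A V S d" "f \<diamondop> d = b"
proof -
  obtain Y e m where Y: "Y \<in> Obj A" and e: "is_epi A S Y e" and m: "is_mono A Y T m" and me: "m \<diamondop> e = f"
    using A.image_factorization[OF f] .
  note ca = A.cokernelD[OF c f]
  have o: "S \<in> Obj A" "T \<in> Obj A" "P \<in> Obj A" using f ca by (auto dest: arrD)
  have ea: "arr A S Y e" and ma: "arr A Y T m" using e m Y o A.epi_arr A.mono_arr by auto
  have "is_cokernel A Y T m P c"
  proof (rule A.cokernelI[OF ma A.cokernel_epi[OF c f] o(3)])
    have "(c \<diamondop> m) \<diamondop> e = Zero A Y P \<diamondop> e" using A.assoc[OF ea ma ca(1)] ca me ea o by simp
    then show "c \<diamondop> m = Zero A Y P" using A.epiD[OF e A.arr_comp[OF ma ca(1)] A.arr_Zero[OF Y o(3)]] by blast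
    fix W g assume g: "arr A T W g" "g \<diamondop> m = Zero A Y W"
    have "g \<diamondop> f = Zero A S W" using A.assoc[OF ea ma g(1)] g me ea arrD(2)[OF g(1)] by simp
    then show "\<exists>h. arr A P W h \<and> h \<diamondop> c = g" using A.cokernel_desc[OF c g(1)] by blast
  qed
  then have k: "is_kernel A T P c Y m" by (rule A.mono_is_kernel_of_cokernel[OF m Y o(2)])
  obtain b' where b': "arr A V Y b'" "m \<diamondop> b' = b" using A.kernel_lift[OF k b cb] .
  obtain d where d: "arr A V S d" "e \<diamondop> d = b'"
    using presenting_lift[OF S A.Sum_subset_Pres[OF univ cc U T] Y m e V b'(1)] .
  have "f \<diamondop> d = b" using A.assoc[OF d(1) ea ma] me d b' by simp
  then show thesis using that d by blast
qed

text \<open>The composites of \<open>c\<close> with the injections of \<open>T\<close> are jointly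
  epimorphic and start at members of \<U>.\<close>

lemma presented_ext:
  assumes P: "P \<in> Pres_class TYPE('u) A \<U>" and g: "arr A P X g" "arr A P X g'"
    and eq: "\<And>V a. \<lbrakk>V \<in> \<U>; arr A V P a\<rbrakk> \<Longrightarrow> g \<diamondop> a = g' \<diamondop> a"
  shows "g = g'"
proof -
  obtain S T f c where T: "T \<in> Sum_class TYPE('u) A \<U>" and f: "arr A S T f" and c: "is_cokernel A S T f P c"
    using A.Pres_classE[OF P] .
  note ca = A.cokernelD[OF c f]
  obtain I :: "'u set" and D \<iota> where I: "small TYPE('u) I" "\<And>i. i \<in> I \<Longrightarrow> D i \<in> \<U>"
    and DO: "\<And>i. i \<in> I \<Longrightarrow> D i \<in> Obj A" and cp: "is_coproduct A I D T \<iota>"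
    using A.Sum_classE[OF T U] by metis
  have "g \<diamondop> c = g' \<diamondop> c"
  proof (rule A.coproduct_ext[OF cp A.arr_comp[OF ca(1) g(1)] A.arr_comp[OF ca(1) g(2)] DO])
    fix i assume i: "i \<in> I"
    note \<iota> = A.coproduct_arr[OF cp i DO[OF i]]
    show "(g \<diamondop> c) \<diamondop> \<iota> i = (g' \<diamondop> c) \<diamondop> \<iota> i"
      using A.assoc[OF \<iota> ca(1) g(1)] A.assoc[OF \<iota> ca(1) g(2)] eq[OF I(2)[OF i] A.arr_comp[OF \<iota> ca(1)]] by simp
  qed
  then show ?thesis by (rule A.epiD[OF A.cokernel_epi[OF c f] g])
qed

section \<open>The functor Hom(E -, X) to modules over a small copy of the generators\<close>

context
  fixes C :: "('c, 'k) preadd" and E :: "('c, 'k, 'o, 'm) ftor"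
  assumes C: "small_preadditive TYPE('u) C" and E_add: "is_additive_functor C A E"
    and E_ff: "fully_faithful C A E" and E_Obj: "ObjMap E ` Obj C = \<U>"
begin

interpretation C: preadditive_category C
  using C by (simp add: small_preadditive_def)

abbreviation (input) Mods :: "(('c, 'k, 'u) modl, ('c, 'k, 'u) modl_hom) category" where
  "Mods \<equiv> module_category TYPE('u) C"

interpretation Md: category Mods
  by (rule category_Md[OF univ C])

abbreviation (input) Eo :: "'c \<Rightarrow> 'o" where "Eo \<equiv> ObjMap E"
abbreviation (input) Ea :: "'k \<Rightarrow> 'm" where "Ea \<equiv> ArrMap E"

lemma E_fun: "is_functor C A E" using E_ff by (rule ff_functor)

lemma Eo_U: "d \<in> Obj C \<Longrightarrow> Eo d \<in> \<U>" unfolding E_Obj[symmetric] by (rule imageI)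

lemma U_E: "V \<in> \<U> \<Longrightarrow> \<exists>d. d \<in> Obj C \<and> Eo d = V" unfolding E_Obj[symmetric] by blast

lemma Eo_Obj: "d \<in> Obj C \<Longrightarrow> Eo d \<in> Obj A" using Eo_U U by blast

lemma E_iso:
  assumes "c \<in> Obj C" "d \<in> Obj C"
  shows "Ea \<in> iso (hom_group C c d) (hom_group A (Eo c) (Eo d))"
proof -
  have "bij_betw Ea (Hom C c d) (Hom A (Eo c) (Eo d))" using E_ff assms by (simp add: fully_faithful_def)
  moreover have "Ea (Add C f g) = Add A (Ea f) (Ea g)" if "f \<in> Hom C c d" "g \<in> Hom C c d" for f g
    using additive_functor_Add[OF E_add] that assms by (simp add: arr_def)
  ultimately show ?thesis by (auto simp: iso_def hom_def bij_betw_def)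
qed

text \<open>The values of \<phi> at the composites \<open>c \<diamondop> \<iota> i\<close> define
  \<open>g0\<close> on \<open>T\<close>. For morphisms into \<open>T\<close> through one summand,
  naturality makes \<open>g0\<close> agree with \<phi> after \<open>c\<close>, and additivity
  extends this to all of them (\<open>key\<close>). In particular \<open>g0\<close> kills
  \<open>f\<close> and descends to \<open>P\<close>.\<close>

lemma natural_family_extends:
  assumes P: "P \<in> Pres_class TYPE('u) A \<U>" and X: "X \<in> Obj A"
    and hom: "\<And>d. d \<in> Obj C \<Longrightarrow> \<phi> d \<in> hom (hom_group A (Eo d) P) (hom_group A (Eo d) X)"
    and nat: "\<And>d d' h a. \<lbrakk>arr C d d' h; arr A (Eo d') P a\<rbrakk> \<Longrightarrow> \<phi> d (a \<diamondop> Ea h) = \<phi> d' a \<diamondop> Ea h"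
  obtains g where "arr A P X g" "\<And>d a. \<lbrakk>d \<in> Obj C; arr A (Eo d) P a\<rbrakk> \<Longrightarrow> g \<diamondop> a = \<phi> d a"
proof -
  obtain S T f c where S: "S \<in> Sum_class TYPE('u) A \<U>" and T: "T \<in> Sum_class TYPE('u) A \<U>"
    and f: "arr A S T f" and c: "is_cokernel A S T f P c" using A.Pres_classE[OF P] .
  note ca = A.cokernelD[OF c f]
  have o: "S \<in> Obj A" "T \<in> Obj A" "P \<in> Obj A" using f ca by (auto dest: arrD)
  have \<phi>: "arr A (Eo d) X (\<phi> d a)" if "d \<in> Obj C" "arr A (Eo d) P a" for d a
    using hom_in_carrier[OF hom[OF that(1)]] that X by (simp add: arr_def)
  have \<phi>_Zero: "\<phi> d (Zero A (Eo d) P) = Zero A (Eo d) X" if "d \<in> Obj C" for d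
    using hom_one[OF hom[OF that]] A.hom_comm_group[OF Eo_Obj[OF that]] X o(3) by (simp add: comm_group_def)
  have \<phi>_Add: "\<phi> d (Add A a b) = Add A (\<phi> d a) (\<phi> d b)"
    if "d \<in> Obj C" "arr A (Eo d) P a" "arr A (Eo d) P b" for d a b
    using hom_mult[OF hom[OF that(1)]] that by (simp add: arr_def)
  obtain I :: "'u set" and D \<iota> where I: "small TYPE('u) I" "\<And>i. i \<in> I \<Longrightarrow> D i \<in> \<U>"
    and DO: "\<And>i. i \<in> I \<Longrightarrow> D i \<in> Obj A" and cp: "is_coproduct A I D T \<iota>"
    using A.Sum_classE[OF T U] by metis
  have "\<forall>i. \<exists>d. i \<in> I \<longrightarrow> d \<in> Obj C \<and> Eo d = D i" using U_E[OF I(2)] by blast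
  then obtain d where d: "\<And>i. i \<in> I \<Longrightarrow> d i \<in> Obj C" "\<And>i. i \<in> I \<Longrightarrow> Eo (d i) = D i" by metis
  have \<iota>: "arr A (Eo (d i)) T (\<iota> i)" if "i \<in> I" for i using A.coproduct_arr[OF cp that DO[OF that]] d(2)[OF that] by simp
  have c\<iota>: "arr A (Eo (d i)) P (c \<diamondop> \<iota> i)" if "i \<in> I" for i using A.arr_comp[OF \<iota>[OF that] ca(1)] .
  have "arr A (D i) X (\<phi> (d i) (c \<diamondop> \<iota> i))" if "i \<in> I" for i using \<phi>[OF d(1)[OF that] c\<iota>[OF that]] d(2)[OF that] by simp
  then obtain g0 where g0: "arr A T X g0" "\<And>i. i \<in> I \<Longrightarrow> g0 \<diamondop> \<iota> i = \<phi> (d i) (c \<diamondop> \<iota> i)"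
    using A.coproduct_desc[OF cp X, of "\<lambda>i. \<phi> (d i) (c \<diamondop> \<iota> i)"] by blast
  have key: "g0 \<diamondop> b = \<phi> d' (c \<diamondop> b)" if d': "d' \<in> Obj C" and b: "arr A (Eo d') T b" for d' b
  proof (rule self_small_span[OF I cp Eo_U[OF d'] b, where Q = "\<lambda>b. g0 \<diamondop> b = \<phi> d' (c \<diamondop> b)"])
    show "g0 \<diamondop> Zero A (Eo d') T = \<phi> d' (c \<diamondop> Zero A (Eo d') T)"
      using g0 ca Eo_Obj[OF d'] \<phi>_Zero[OF d'] by simp
  next
    fix a b assume a: "arr A (Eo d') T a" and b: "arr A (Eo d') T b"
      and eq: "g0 \<diamondop> a = \<phi> d' (c \<diamondop> a)" "g0 \<diamondop> b = \<phi> d' (c \<diamondop> b)"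
    have "c \<diamondop> Add A a b = Add A (c \<diamondop> a) (c \<diamondop> b)" "g0 \<diamondop> Add A a b = Add A (g0 \<diamondop> a) (g0 \<diamondop> b)"
      using A.comp_Add'[OF a b ca(1)] A.comp_Add'[OF a b g0(1)] .
    then show "g0 \<diamondop> Add A a b = \<phi> d' (c \<diamondop> Add A a b)"
      using eq \<phi>_Add[OF d' A.arr_comp[OF a ca(1)] A.arr_comp[OF b ca(1)]] by simp
  next
    fix i \<psi> assume i: "i \<in> I" and \<psi>: "arr A (Eo d') (D i) \<psi>"
    have "arr A (Eo d') (Eo (d i)) \<psi>" using \<psi> d(2)[OF i] by simp
    then obtain h where h: "arr C d' (d i) h" "Ea h = \<psi>" using ff_full[OF E_ff d' d(1)[OF i]] by blast
    have \<psi>': "arr A (Eo d') (Eo (d i)) \<psi>" using \<psi> d(2)[OF i] by simp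
    have "g0 \<diamondop> (\<iota> i \<diamondop> \<psi>) = \<phi> (d i) (c \<diamondop> \<iota> i) \<diamondop> Ea h" using A.assoc[OF \<psi>' \<iota>[OF i] g0(1)] g0(2)[OF i] h by simp
    also have "\<dots> = \<phi> d' ((c \<diamondop> \<iota> i) \<diamondop> Ea h)" using nat[OF h(1) c\<iota>[OF i]] by simp
    also have "\<dots> = \<phi> d' (c \<diamondop> (\<iota> i \<diamondop> \<psi>))" using A.assoc[OF \<psi>' \<iota>[OF i] ca(1)] h by simp
    finally show "g0 \<diamondop> (\<iota> i \<diamondop> \<psi>) = \<phi> d' (c \<diamondop> (\<iota> i \<diamondop> \<psi>))" .
  qed
  obtain I' :: "'u set" and D' \<iota>' where I': "\<And>i. i \<in> I' \<Longrightarrow> D' i \<in> \<U>"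
    and DO': "\<And>i. i \<in> I' \<Longrightarrow> D' i \<in> Obj A" and cp': "is_coproduct A I' D' S \<iota>'"
    using A.Sum_classE[OF S U] by metis
  have "g0 \<diamondop> f = Zero A S X"
  proof (rule A.coproduct_ext[OF cp' A.arr_comp[OF f g0(1)] A.arr_Zero[OF o(1) X] DO'])
    fix i assume i: "i \<in> I'"
    obtain d' where d': "d' \<in> Obj C" "Eo d' = D' i" using U_E[OF I'[OF i]] by blast
    have \<iota>': "arr A (Eo d') S (\<iota>' i)" using A.coproduct_arr[OF cp' i DO'[OF i]] d' by simp
    have "g0 \<diamondop> (f \<diamondop> \<iota>' i) = \<phi> d' (c \<diamondop> (f \<diamondop> \<iota>' i))" using key[OF d'(1) A.arr_comp[OF \<iota>' f]] .
    also have "\<dots> = \<phi> d' (Zero A S P \<diamondop> \<iota>' i)" using A.assoc[OF \<iota>' f ca(1)] ca by simp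
    also have "\<dots> = Zero A (Eo d') X" using \<iota>' o \<phi>_Zero[OF d'(1)] by simp
    finally show "(g0 \<diamondop> f) \<diamondop> \<iota>' i = Zero A S X \<diamondop> \<iota>' i" using A.assoc[OF \<iota>' f g0(1)] \<iota>' X by simp
  qed
  then obtain g where g: "arr A P X g" "g \<diamondop> c = g0" using A.cokernel_desc[OF c g0(1)] by blast
  show thesis
  proof (rule that[OF g(1)])
    fix d' a assume d': "d' \<in> Obj C" and a: "arr A (Eo d') P a"
    obtain b where b: "arr A (Eo d') T b" "c \<diamondop> b = a" using presentation_lift[OF S T f c Eo_U[OF d'] a] .
    show "g \<diamondop> a = \<phi> d' a" using A.assoc[OF b(1) ca(1) g(1)] key[OF d' b(1)] b g by simp
  qed
qed

text \<open>Hom(-, X) over the generators, pulled back along \<open>E\<close> and encoded in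
  \<open>'u\<close>; \<open>He\<close> and \<open>Hd\<close> pass between morphisms and their
  codes.\<close>

definition Hmod :: "'o \<Rightarrow> ('c, 'k, 'u) modl" where
  "Hmod X = mk_module TYPE('u) C (\<lambda>d. hom_group A (Eo d) X) (\<lambda>d d' h a. a \<diamondop> Ea h)"

definition He :: "'o \<Rightarrow> 'c \<Rightarrow> 'm \<Rightarrow> 'u" where
  "He X d = enc TYPE('u) (hom_group A (Eo d) X)"

definition Hd :: "'o \<Rightarrow> 'c \<Rightarrow> 'u \<Rightarrow> 'm" where
  "Hd X d = inv_into (Hom A (Eo d) X) (He X d)"

definition Hfun :: "('o, 'm, ('c, 'k, 'u) modl, ('c, 'k, 'u) modl_hom) ftor" where
  "Hfun = \<lparr>ObjMap = Hmod,
     ArrMap = (\<lambda>g. mk_mhom C (Hmod (dom_of A g)) (Hmod (cod_of A g))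
       (\<lambda>d y. He (cod_of A g) d (g \<diamondop> Hd (dom_of A g) d y)))\<rparr>"

lemma Hmod:
  assumes X: "X \<in> Obj A"
  shows "Hmod X \<in> Obj Mods"
    and "d \<in> Obj C \<Longrightarrow> He X d \<in> iso (hom_group A (Eo d) X) (mgrp (Hmod X) d)"
    and "\<lbrakk>arr C d d' h; arr A (Eo d') X a\<rbrakk> \<Longrightarrow> mact (Hmod X) h (He X d' a) = He X d (a \<diamondop> Ea h)"
proof -
  let ?G = "\<lambda>d. hom_group A (Eo d) X" and ?act = "\<lambda>d d' h a. a \<diamondop> Ea h"
  have grp: "comm_group (?G d)" if "d \<in> Obj C" for d by (rule A.hom_comm_group[OF Eo_Obj[OF that] X])
  have sm: "small TYPE('u) (carrier (?G d))" if "d \<in> Obj C" for d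
    using ls Eo_Obj[OF that] X by (simp add: locally_small_def)
  have ah: "?act d d' h \<in> hom (?G d') (?G d)" if "arr C d d' h" for d d' h
    by (rule A.hom_comp[OF functor_arr[OF E_fun that] X])
  have ac: "a \<diamondop> Ea (h' \<diamondop>\<^bsub>C\<^esub> h) = (a \<diamondop> Ea h') \<diamondop> Ea h"
    if "arr C x y h" "arr C y z h'" "a \<in> carrier (?G z)" for x y z h h' a
  proof -
    have "arr A (Eo z) X a" using that Eo_Obj X by (auto simp: arr_def)
    then show ?thesis
      using A.assoc[OF functor_arr[OF E_fun that(1)] functor_arr[OF E_fun that(2)]] functor_comp[OF E_fun that(1,2)] by simp
  qed
  have ai: "a \<diamondop> Ea (Ident C x) = a" if "x \<in> Obj C" "a \<in> carrier (?G x)" for x a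
    using functor_Ident[OF E_fun that(1)] A.comp_Ident[OF Eo_Obj[OF that(1)] X] that(2) by simp
  have aa: "a \<diamondop> Ea (Add C h h') = (a \<diamondop> Ea h) \<otimes>\<^bsub>?G x\<^esub> (a \<diamondop> Ea h')"
    if "arr C x y h" "arr C x y h'" "a \<in> carrier (?G y)" for x y h h' a
    using additive_functor_Add[OF E_add that(1,2)] functor_arr[OF E_fun that(1)] functor_arr[OF E_fun that(2)]
      A.comp_Add[of "Eo x" "Eo y" X "Ea h" "Ea h'" a] that(3) X by (simp add: arr_def)
  note mk = mk_module[where G = ?G and act = ?act, OF univ C grp sm ah ac ai aa, folded Hmod_def, folded He_def]
  show "Hmod X \<in> Obj Mods" by (rule mk(1))
  show "He X d \<in> iso (hom_group A (Eo d) X) (mgrp (Hmod X) d)" if "d \<in> Obj C"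
    by (rule mk(2); (assumption | rule that))
  show "mact (Hmod X) h (He X d' a) = He X d (a \<diamondop> Ea h)" if h: "arr C d d' h" and a: "arr A (Eo d') X a"
  proof -
    have a': "a \<in> carrier (?G d')" using a by (simp add: arr_def)
    show ?thesis by (rule mk(3); (assumption | rule h | rule a'))
  qed
qed

lemma He_bij:
  assumes "X \<in> Obj A" "d \<in> Obj C"
  shows "bij_betw (He X d) (Hom A (Eo d) X) (carrier (mgrp (Hmod X) d))"
  using Hmod(2)[OF assms] by (simp add: iso_def)

lemma He_carrier: "\<lbrakk>arr A (Eo d) X a; d \<in> Obj C\<rbrakk> \<Longrightarrow> He X d a \<in> carrier (mgrp (Hmod X) d)"
  using bij_betwE[OF He_bij] by (simp add: arr_def)

lemma Hd_He: "\<lbrakk>arr A (Eo d) X a; d \<in> Obj C\<rbrakk> \<Longrightarrow> Hd X d (He X d a) = a"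
  using bij_betw_inv_into_left[OF He_bij] by (simp add: arr_def Hd_def)

lemma He_inj: "\<lbrakk>He X d a = He X d b; arr A (Eo d) X a; arr A (Eo d) X b; d \<in> Obj C\<rbrakk> \<Longrightarrow> a = b"
  using Hd_He by metis

lemma He_surj:
  assumes "X \<in> Obj A" "d \<in> Obj C" "y \<in> carrier (mgrp (Hmod X) d)"
  obtains a where "arr A (Eo d) X a" "y = He X d a"
proof -
  have "y \<in> He X d ` Hom A (Eo d) X" using He_bij[OF assms(1,2)] assms(3) by (simp add: bij_betw_def)
  then show thesis using that assms Eo_Obj by (auto simp: arr_def)
qed

lemma He_mult:
  assumes "X \<in> Obj A" "d \<in> Obj C" "arr A (Eo d) X a" "arr A (Eo d) X b"
  shows "He X d a \<otimes>\<^bsub>mgrp (Hmod X) d\<^esub> He X d b = He X d (Add A a b)"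
proof -
  have "He X d \<in> hom (hom_group A (Eo d) X) (mgrp (Hmod X) d)" using Hmod(2)[OF assms(1,2)] by (simp add: iso_def)
  from hom_mult[OF this] show ?thesis using assms by (simp add: arr_def)
qed

lemma Hfun_arr:
  assumes g: "arr A X Y g"
  shows "arr Mods (Hmod X) (Hmod Y) (ArrMap Hfun g)"
    and "\<And>d a. \<lbrakk>d \<in> Obj C; arr A (Eo d) X a\<rbrakk> \<Longrightarrow> mapp (ArrMap Hfun g) d (He X d a) = He Y d (g \<diamondop> a)"
proof -
  have o: "X \<in> Obj A" "Y \<in> Obj A" using g by (auto dest: arrD)
  have eq: "ArrMap Hfun g = mk_mhom C (Hmod X) (Hmod Y) (\<lambda>d y. He Y d (g \<diamondop> Hd X d y))"
    using A.dom_cod_of[OF g] by (simp add: Hfun_def)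
  show "arr Mods (Hmod X) (Hmod Y) (ArrMap Hfun g)"
    unfolding eq
  proof (rule arr_mk_mhom[OF univ C Hmod(1)[OF o(1)] Hmod(1)[OF o(2)]])
    fix d assume d: "d \<in> Obj C"
    show "(\<lambda>y. He Y d (g \<diamondop> Hd X d y)) \<in> hom (mgrp (Hmod X) d) (mgrp (Hmod Y) d)"
    proof (rule homI)
      fix y assume "y \<in> carrier (mgrp (Hmod X) d)"
      then obtain a where a: "arr A (Eo d) X a" "y = He X d a" using He_surj[OF o(1) d] by blast
      show "He Y d (g \<diamondop> Hd X d y) \<in> carrier (mgrp (Hmod Y) d)"
        using a Hd_He[OF a(1) d] He_carrier[OF A.arr_comp[OF a(1) g] d] by simp
      fix z assume "z \<in> carrier (mgrp (Hmod X) d)"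
      then obtain b where b: "arr A (Eo d) X b" "z = He X d b" using He_surj[OF o(1) d] by blast
      have "g \<diamondop> Add A a b = Add A (g \<diamondop> a) (g \<diamondop> b)" by (rule A.comp_Add'[OF a(1) b(1) g])
      then show "He Y d (g \<diamondop> Hd X d (y \<otimes>\<^bsub>mgrp (Hmod X) d\<^esub> z)) =
          He Y d (g \<diamondop> Hd X d y) \<otimes>\<^bsub>mgrp (Hmod Y) d\<^esub> He Y d (g \<diamondop> Hd X d z)"
        using He_mult[OF o(1) d a(1) b(1)] He_mult[OF o(2) d A.arr_comp[OF a(1) g] A.arr_comp[OF b(1) g]]
          Hd_He[OF A.arr_Add[OF a(1) b(1)] d] Hd_He[OF a(1) d] Hd_He[OF b(1) d] a b by simp
    qed
  next
    fix d d' h y assume h: "arr C d d' h" and "y \<in> carrier (mgrp (Hmod X) d')"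
    then obtain a where a: "arr A (Eo d') X a" "y = He X d' a" using He_surj[OF o(1) arrD(2)[OF h]] by blast
    have d: "d \<in> Obj C" "d' \<in> Obj C" using h by (auto dest: arrD)
    note Eh = functor_arr[OF E_fun h]
    show "He Y d (g \<diamondop> Hd X d (mact (Hmod X) h y)) = mact (Hmod Y) h (He Y d' (g \<diamondop> Hd X d' y))"
      using Hmod(3)[OF o(1) h a(1)] Hmod(3)[OF o(2) h A.arr_comp[OF a(1) g]] Hd_He[OF a(1) d(2)]
        Hd_He[OF A.arr_comp[OF Eh a(1)] d(1)] a A.assoc[OF Eh a(1) g] by simp
  qed
  fix d a assume d: "d \<in> Obj C" and a: "arr A (Eo d) X a"
  show "mapp (ArrMap Hfun g) d (He X d a) = He Y d (g \<diamondop> a)"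
    unfolding eq using mapp_mk_mhom[OF univ C d He_carrier[OF a d]] Hd_He[OF a d] by simp
qed

lemma Hfun_Obj [simp]: "ObjMap Hfun X = Hmod X"
  by (simp add: Hfun_def)

lemma Hfun_functor: "is_functor A Mods Hfun"
  unfolding is_functor_def Hfun_Obj
proof (intro conjI ballI)
  fix X assume X: "X \<in> Obj A"
  show "Hmod X \<in> Obj Mods" by (rule Hmod(1)[OF X])
  note i = A.arr_Ident[OF X]
  show "ArrMap Hfun (Ident A X) = Ident Mods (Hmod X)"
  proof (rule mhom_ext[OF univ C Hfun_arr(1)[OF i] arr_Ident_Md[OF univ C Hmod(1)[OF X]]])
    fix d y assume d: "d \<in> Obj C" and y: "y \<in> carrier (mgrp (Hmod X) d)"
    then obtain a where a: "arr A (Eo d) X a" "y = He X d a" using He_surj[OF X d] by blast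
    show "mapp (ArrMap Hfun (Ident A X)) d y = mapp (Ident Mods (Hmod X)) d y"
      using Hfun_arr(2)[OF i d a(1)] a mapp_Ident[OF univ C d y] by simp
  qed
next
  fix X Y g assume "X \<in> Obj A" "Y \<in> Obj A" "g \<in> Hom A X Y"
  then show "ArrMap Hfun g \<in> Hom Mods (Hmod X) (Hmod Y)" using Hfun_arr(1)[of X Y g] by (simp add: arr_def)
next
  fix X Y Z f g assume "X \<in> Obj A" "Y \<in> Obj A" "Z \<in> Obj A" "f \<in> Hom A X Y" "g \<in> Hom A Y Z"
  then have f: "arr A X Y f" and g: "arr A Y Z g" and X: "X \<in> Obj A" by (simp_all add: arr_def)
  note Hf = Hfun_arr[OF f] and Hg = Hfun_arr[OF g] and Hgf = Hfun_arr[OF A.arr_comp[OF f g]]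
  show "ArrMap Hfun (g \<diamondop> f) = ArrMap Hfun g \<diamondop>\<^bsub>Mods\<^esub> ArrMap Hfun f"
  proof (rule mhom_ext[OF univ C Hgf(1) arr_Comp_Md[OF univ C Hf(1) Hg(1)]])
    fix d y assume d: "d \<in> Obj C" and y: "y \<in> carrier (mgrp (Hmod X) d)"
    then obtain a where a: "arr A (Eo d) X a" "y = He X d a" using He_surj[OF X d] by blast
    show "mapp (ArrMap Hfun (g \<diamondop> f)) d y = mapp (ArrMap Hfun g \<diamondop>\<^bsub>Mods\<^esub> ArrMap Hfun f) d y"
      using mapp_Comp[OF univ C Hf(1) Hg(1) d y] Hgf(2)[OF d a(1)] Hf(2)[OF d a(1)] Hg(2)[OF d A.arr_comp[OF a(1) f]]
        A.assoc[OF a(1) f g] a by simp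
  qed
qed

lemma Hfun_faithful:
  assumes P: "P \<in> Pres_class TYPE('u) A \<U>" and g: "arr A P X g" "arr A P X g'" and eq: "ArrMap Hfun g = ArrMap Hfun g'"
  shows "g = g'"
proof (rule presented_ext[OF P g])
  fix V a assume V: "V \<in> \<U>" and a: "arr A V P a"
  obtain d where d: "d \<in> Obj C" "V = Eo d" using U_E[OF V] by blast
  have a': "arr A (Eo d) P a" using a d by simp
  have "He X d (g \<diamondop> a) = He X d (g' \<diamondop> a)"
    using Hfun_arr(2)[OF g(1) d(1) a'] Hfun_arr(2)[OF g(2) d(1) a'] eq by simp
  then show "g \<diamondop> a = g' \<diamondop> a" using He_inj A.arr_comp[OF a' g(1)] A.arr_comp[OF a' g(2)] d(1) by blast
qed

text \<open>A module morphism, decoded componentwise, is a natural family of group homomorphisms, so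
  \<open>natural_family_extends\<close> applies. The target ranges over all objects, which the
  coreflection depends on.\<close>

lemma Hfun_full:
  assumes P: "P \<in> Pres_class TYPE('u) A \<U>" and X: "X \<in> Obj A" and \<eta>: "arr Mods (Hmod P) (Hmod X) \<eta>"
  obtains g where "arr A P X g" "ArrMap Hfun g = \<eta>"
proof -
  have PO: "P \<in> Obj A" using P by (rule A.Pres_class_Obj)
  define \<phi> where "\<phi> d a = Hd X d (mapp \<eta> d (He P d a))" for d a
  have \<phi>: "arr A (Eo d) X (\<phi> d a)" "He X d (\<phi> d a) = mapp \<eta> d (He P d a)"
    if d: "d \<in> Obj C" and a: "arr A (Eo d) P a" for d a
  proof -
    have "mapp \<eta> d (He P d a) \<in> carrier (mgrp (Hmod X) d)" using mapp_closed[OF univ C \<eta> d He_carrier[OF a d]] .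
    then obtain b where b: "arr A (Eo d) X b" "mapp \<eta> d (He P d a) = He X d b" using He_surj[OF X d] by blast
    then show "arr A (Eo d) X (\<phi> d a)" "He X d (\<phi> d a) = mapp \<eta> d (He P d a)"
      using Hd_He[OF b(1) d] by (simp_all add: \<phi>_def)
  qed
  have "\<phi> d \<in> hom (hom_group A (Eo d) P) (hom_group A (Eo d) X)" if d: "d \<in> Obj C" for d
  proof (rule homI; simp)
    have ar: "arr A (Eo d) P a" if "a \<in> Hom A (Eo d) P" for a using that PO Eo_Obj[OF d] by (simp add: arr_def)
    show "\<phi> d a \<in> Hom A (Eo d) X" if "a \<in> Hom A (Eo d) P" for a using \<phi>(1)[OF d ar[OF that]] by (rule arrD)
    fix a b assume "a \<in> Hom A (Eo d) P" "b \<in> Hom A (Eo d) P"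
    then have a: "arr A (Eo d) P a" and b: "arr A (Eo d) P b" by (simp_all add: ar)
    note ab = A.arr_Add[OF a b]
    have "He X d (\<phi> d (Add A a b)) = He X d (Add A (\<phi> d a) (\<phi> d b))"
      using \<phi>(2)[OF d ab] \<phi>(2)[OF d a] \<phi>(2)[OF d b] He_mult[OF PO d a b]
        He_mult[OF X d \<phi>(1)[OF d a] \<phi>(1)[OF d b]]
        hom_mult[OF mhom_comp_eq(2)[OF univ C \<eta> d] He_carrier[OF a d] He_carrier[OF b d]] by simp
    then show "\<phi> d (Add A a b) = Add A (\<phi> d a) (\<phi> d b)"
      using He_inj \<phi>(1)[OF d ab] A.arr_Add[OF \<phi>(1)[OF d a] \<phi>(1)[OF d b]] d by blast
  qed
  moreover have "\<phi> d (a \<diamondop> Ea h) = \<phi> d' a \<diamondop> Ea h" if h: "arr C d d' h" and a: "arr A (Eo d') P a" for d d' h a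
  proof -
    have d: "d \<in> Obj C" "d' \<in> Obj C" using h by (auto dest: arrD)
    note Eh = functor_arr[OF E_fun h]
    have "He X d (\<phi> d (a \<diamondop> Ea h)) = He X d (\<phi> d' a \<diamondop> Ea h)"
      using \<phi>(2)[OF d(1) A.arr_comp[OF Eh a]] Hmod(3)[OF PO h a] Hmod(3)[OF X h \<phi>(1)[OF d(2) a]]
        mapp_natural[OF univ C \<eta> h He_carrier[OF a d(2)]] \<phi>(2)[OF d(2) a] by simp
    then show ?thesis
      using He_inj \<phi>(1)[OF d(1) A.arr_comp[OF Eh a]] A.arr_comp[OF Eh \<phi>(1)[OF d(2) a]] d(1) by blast
  qed
  ultimately obtain g where g: "arr A P X g" "\<And>d a. \<lbrakk>d \<in> Obj C; arr A (Eo d) P a\<rbrakk> \<Longrightarrow> g \<diamondop> a = \<phi> d a"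
    using natural_family_extends[OF P X, of \<phi>] by blast
  have "ArrMap Hfun g = \<eta>"
  proof (rule mhom_ext[OF univ C Hfun_arr(1)[OF g(1)] \<eta>])
    fix d y assume d: "d \<in> Obj C" and y: "y \<in> carrier (mgrp (Hmod P) d)"
    then obtain a where a: "arr A (Eo d) P a" "y = He P d a" using He_surj[OF PO d] by blast
    show "mapp (ArrMap Hfun g) d y = mapp \<eta> d y"
      using Hfun_arr(2)[OF g(1) d a(1)] g(2)[OF d a(1)] \<phi>(2)[OF d a(1)] a by simp
  qed
  then show thesis using that g by blast
qed

text \<open>The universal property of a free module: by self-smallness Hom(E d, T) is the direct sum
  of the groups Hom(d, k i), so sending the \<open>i\<close>-th generator to \<open>x i\<close>
  determines a natural family of homomorphisms to \<open>M\<close>.\<close>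

lemma ev_family:
  assumes M: "M \<in> Obj Mods" and I: "small TYPE('u) (I :: 'u set)" and k: "\<And>i. i \<in> I \<Longrightarrow> k i \<in> Obj C"
    and x: "\<And>i. i \<in> I \<Longrightarrow> x i \<in> carrier (mgrp M (k i))" and cp: "is_coproduct A I (\<lambda>i. Eo (k i)) T \<iota>"
  obtains ev where "\<And>d. d \<in> Obj C \<Longrightarrow> ev d \<in> hom (hom_group A (Eo d) T) (mgrp M d)"
    "\<And>d i h. \<lbrakk>i \<in> I; arr C d (k i) h\<rbrakk> \<Longrightarrow> ev d (\<iota> i \<diamondop> Ea h) = mact M h (x i)"
    "\<And>d d' h b. \<lbrakk>arr C d d' h; arr A (Eo d') T b\<rbrakk> \<Longrightarrow> ev d (b \<diamondop> Ea h) = mact M h (ev d' b)"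
proof -
  have kU: "Eo (k i) \<in> \<U>" if "i \<in> I" for i using Eo_U k that by blast
  have TO: "T \<in> Obj A" using cp by (rule A.coproduct_Obj)
  have ex: "\<exists>e. e \<in> hom (hom_group A (Eo d) T) (mgrp M d) \<and>
     (\<forall>i h. i \<in> I \<longrightarrow> arr C d (k i) h \<longrightarrow> e (\<iota> i \<diamondop> Ea h) = mact M h (x i))" if d: "d \<in> Obj C" for d
  proof -
    \<comment> \<open>On the \<open>i\<close>-th summand a morphism \<open>Ea h\<close> is decoded
      to \<open>h\<close>, which then acts on \<open>x i\<close>.\<close>
    define f where "f i = (\<lambda>h. mact M h (x i)) \<circ> inv_into (Hom C d (k i)) Ea" for i
    have f: "f i \<in> hom (hom_group A (Eo d) (Eo (k i))) (mgrp M d)" if i: "i \<in> I" for i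
    proof -
      have "group (hom_group C d (k i))" using C.hom_comm_group[OF d k[OF i]] by (simp add: comm_group_def)
      from group.iso_set_sym[OF this E_iso[OF d k[OF i]]]
      have "inv_into (Hom C d (k i)) Ea \<in> hom (hom_group A (Eo d) (Eo (k i))) (hom_group C d (k i))" by (simp add: iso_def)
      then show ?thesis unfolding f_def by (rule hom_compose) (rule mact_hom_arg[OF univ C M d k[OF i] x[OF i]])
    qed
    obtain e where e: "e \<in> hom (hom_group A (Eo d) T) (mgrp M d)"
      "\<And>i \<psi>. \<lbrakk>i \<in> I; arr A (Eo d) (Eo (k i)) \<psi>\<rbrakk> \<Longrightarrow> e (\<iota> i \<diamondop> \<psi>) = f i \<psi>"
      using self_small_extend[OF I kU cp Eo_U[OF d] module_group(1)[OF univ C M d] f] by blast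
    have "e (\<iota> i \<diamondop> Ea h) = mact M h (x i)" if i: "i \<in> I" and h: "arr C d (k i) h" for i h
    proof -
      have "inv_into (Hom C d (k i)) Ea (Ea h) = h"
        using E_iso[OF d k[OF i]] h by (simp add: iso_def bij_betw_def arr_def inv_into_f_f)
      then show ?thesis using e(2)[OF i functor_arr[OF E_fun h]] by (simp add: f_def)
    qed
    then show ?thesis using e by blast
  qed
  have "\<forall>d. \<exists>e. d \<in> Obj C \<longrightarrow> e \<in> hom (hom_group A (Eo d) T) (mgrp M d) \<and>
     (\<forall>i h. i \<in> I \<longrightarrow> arr C d (k i) h \<longrightarrow> e (\<iota> i \<diamondop> Ea h) = mact M h (x i))" using ex by blast
  then obtain ev where ev: "\<And>d. d \<in> Obj C \<Longrightarrow> ev d \<in> hom (hom_group A (Eo d) T) (mgrp M d)"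
    and evi: "\<And>d i h. \<lbrakk>d \<in> Obj C; i \<in> I; arr C d (k i) h\<rbrakk> \<Longrightarrow> ev d (\<iota> i \<diamondop> Ea h) = mact M h (x i)"
    by metis
  have grp: "group (mgrp M d)" if "d \<in> Obj C" for d using module_group(1)[OF univ C M that] by (simp add: comm_group_def)
  have grpH: "group (hom_group A (Eo d) T)" if "d \<in> Obj C" for d
    using A.hom_comm_group[OF Eo_Obj[OF that] TO] by (simp add: comm_group_def)
  show thesis
  proof (rule that)
    show "ev d \<in> hom (hom_group A (Eo d) T) (mgrp M d)" if "d \<in> Obj C" for d by (rule ev[OF that])
    show "ev d (\<iota> i \<diamondop> Ea h) = mact M h (x i)" if "i \<in> I" "arr C d (k i) h" for d i h
      by (rule evi[OF arrD(1)[OF that(2)] that])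
    fix d d' h b assume h: "arr C d d' h" and b: "arr A (Eo d') T b"
    have d: "d \<in> Obj C" "d' \<in> Obj C" using h by (auto dest: arrD)
    note Eh = functor_arr[OF E_fun h] and mh = module_arr(2)[OF univ C M h]
    \<comment> \<open>Both sides are additive in \<open>b\<close>, so it suffices to treat morphisms
      through one summand, where the claim is that the action of \<open>M\<close> respects
      composition.\<close>
    show "ev d (b \<diamondop> Ea h) = mact M h (ev d' b)"
    proof (rule self_small_span[OF I kU cp Eo_U[OF d(2)] b, where Q = "\<lambda>b. ev d (b \<diamondop> Ea h) = mact M h (ev d' b)"])
      show "ev d (Zero A (Eo d') T \<diamondop> Ea h) = mact M h (ev d' (Zero A (Eo d') T))"
        using hom_one[OF ev[OF d(1)] grpH[OF d(1)] grp[OF d(1)]] hom_one[OF ev[OF d(2)] grpH[OF d(2)] grp[OF d(2)]]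
          hom_one[OF mh grp[OF d(2)] grp[OF d(1)]] Eh TO by simp
    next
      fix a b assume a: "arr A (Eo d') T a" and b: "arr A (Eo d') T b"
        and eq: "ev d (a \<diamondop> Ea h) = mact M h (ev d' a)" "ev d (b \<diamondop> Ea h) = mact M h (ev d' b)"
      have "Add A a b \<diamondop> Ea h = Add A (a \<diamondop> Ea h) (b \<diamondop> Ea h)" by (rule A.Add_comp'[OF Eh a b])
      then show "ev d (Add A a b \<diamondop> Ea h) = mact M h (ev d' (Add A a b))"
        using eq hom_mult[OF ev[OF d(1)], of "a \<diamondop> Ea h" "b \<diamondop> Ea h"] hom_mult[OF ev[OF d(2)], of a b]
          hom_mult[OF mh] hom_in_carrier[OF ev[OF d(2)]] a b A.arr_comp[OF Eh a] A.arr_comp[OF Eh b]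
        by (simp add: arr_def)
    next
      fix i \<psi> assume i: "i \<in> I" and \<psi>: "arr A (Eo d') (Eo (k i)) \<psi>"
      obtain h' where h': "arr C d' (k i) h'" "Ea h' = \<psi>" using ff_full[OF E_ff d(2) k[OF i] \<psi>] .
      have \<iota>: "arr A (Eo (k i)) T (\<iota> i)" using A.coproduct_arr[OF cp i] Eo_Obj k i by blast
      have "(\<iota> i \<diamondop> \<psi>) \<diamondop> Ea h = \<iota> i \<diamondop> Ea (h' \<diamondop>\<^bsub>C\<^esub> h)"
        using A.assoc[OF Eh \<psi> \<iota>] functor_comp[OF E_fun h h'(1)] h' by simp
      then show "ev d ((\<iota> i \<diamondop> \<psi>) \<diamondop> Ea h) = mact M h (ev d' (\<iota> i \<diamondop> \<psi>))"
        using evi[OF d(1) i C.arr_comp[OF h h'(1)]] evi[OF d(2) i h'(1)] mact_comp[OF univ C M h h'(1) x[OF i]] h' by simp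
    qed
  qed
qed

text \<open>Realises a module \<open>M\<close> as \<open>Hom(-, P)\<close>: \<open>T\<close> is the free object on the elements of \<open>M\<close>, \<open>ev\<close> its evaluation
  map, and \<open>P\<close> is the quotient of \<open>T\<close> by the image of the sum over all elements of the kernel of \<open>ev\<close>.\<close>

lemma Hfun_ess_surj:
  assumes M: "M \<in> Obj Mods"
  obtains P \<alpha> where "P \<in> Pres_class TYPE('u) A \<U>" "is_isomorphism Mods (Hmod P) M \<alpha>"
proof -
  have grp: "group (mgrp M d)" if "d \<in> Obj C" for d using module_group(1)[OF univ C M that] by (simp add: comm_group_def)
  have "small TYPE('u) (Sigma (Obj C) (\<lambda>d. carrier (mgrp M d)))"
    by (rule small_Sigma[OF univ small_Obj_C[OF univ C] module_group(2)[OF univ C M]])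
  then obtain I :: "'u set" and t where I: "small TYPE('u) I" and t: "bij_betw t I (Sigma (Obj C) (\<lambda>d. carrier (mgrp M d)))"
    using small_index by blast
  have ti: "fst (t i) \<in> Obj C" "snd (t i) \<in> carrier (mgrp M (fst (t i)))" if "i \<in> I" for i
    using bij_betwE[OF t] that by auto
  obtain T \<iota> where cpT: "is_coproduct A I (\<lambda>i. Eo (fst (t i))) T \<iota>"
    using A.ex_coproduct[OF univ cc I, of "\<lambda>i. Eo (fst (t i))"] Eo_Obj ti(1) by blast
  have T: "T \<in> Sum_class TYPE('u) A \<U>" by (rule A.Sum_classI[OF I _ U cpT]) (rule Eo_U[OF ti(1)])
  have TO: "T \<in> Obj A" using cpT by (rule A.coproduct_Obj)
  obtain ev where ev: "\<And>d. d \<in> Obj C \<Longrightarrow> ev d \<in> hom (hom_group A (Eo d) T) (mgrp M d)"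
    and evi: "\<And>d i h. \<lbrakk>i \<in> I; arr C d (fst (t i)) h\<rbrakk> \<Longrightarrow> ev d (\<iota> i \<diamondop> Ea h) = mact M h (snd (t i))"
    and evn: "\<And>d d' h b. \<lbrakk>arr C d d' h; arr A (Eo d') T b\<rbrakk> \<Longrightarrow> ev d (b \<diamondop> Ea h) = mact M h (ev d' b)"
    using ev_family[OF M I ti cpT] by metis
  have grpH: "group (hom_group A (Eo d) T)" if "d \<in> Obj C" for d
    using A.hom_comm_group[OF Eo_Obj[OF that] TO] by (simp add: comm_group_def)
  have ev_one: "ev d (Zero A (Eo d) T) = \<one>\<^bsub>mgrp M d\<^esub>" if "d \<in> Obj C" for d
    using hom_one[OF ev[OF that] grpH[OF that] grp[OF that]] by simp
  have ev_Add: "ev d (Add A a b) = ev d a \<otimes>\<^bsub>mgrp M d\<^esub> ev d b"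
    if "d \<in> Obj C" "arr A (Eo d) T a" "arr A (Eo d) T b" for d a b
    using hom_mult[OF ev[OF that(1)]] that by (simp add: arr_def)
  have ev_car: "ev d a \<in> carrier (mgrp M d)" if "d \<in> Obj C" "arr A (Eo d) T a" for d a
    using hom_in_carrier[OF ev[OF that(1)]] that by (simp add: arr_def)
  have ev_surj: "\<exists>b. arr A (Eo d) T b \<and> ev d b = x" if d: "d \<in> Obj C" and x: "x \<in> carrier (mgrp M d)" for d x
  proof -
    \<comment> \<open>\<open>x\<close> itself indexes a summand of \<open>T\<close>, and the
      injection of that summand is its preimage.\<close>
    have "(d, x) \<in> t ` I" using t d x by (simp add: bij_betw_def)
    then obtain i where i: "i \<in> I" "t i = (d, x)" by (metis imageE)
    have "arr A (Eo d) T (\<iota> i)" using A.coproduct_arr[OF cpT i(1)] i Eo_Obj[OF d] by simp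
    moreover have "ev d (\<iota> i \<diamondop> Ea (Ident C d)) = mact M (Ident C d) x" using evi[OF i(1), of d "Ident C d"] i d by simp
    ultimately show ?thesis using functor_Ident[OF E_fun d] mact_Ident[OF univ C M d x] by auto
  qed
  \<comment> \<open>\<open>S\<close> gets one summand for each morphism from a generator to
    \<open>T\<close> that \<open>ev\<close> kills, so that \<open>f\<close> reaches the whole
    kernel.\<close>
  let ?J = "Sigma (Obj C) (\<lambda>d. {b \<in> Hom A (Eo d) T. ev d b = \<one>\<^bsub>mgrp M d\<^esub>})"
  have "small TYPE('u) (Hom A (Eo d) T)" if "d \<in> Obj C" for d
    using ls Eo_Obj[OF that] TO by (simp add: locally_small_def)
  then have "small TYPE('u) ?J"
    by (intro small_Sigma[OF univ small_Obj_C[OF univ C]]) (rule small_subset, auto)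
  then obtain I' :: "'u set" and t' where I': "small TYPE('u) I'" and t': "bij_betw t' I' ?J"
    using small_index by blast
  have t'i: "fst (t' i) \<in> Obj C" "arr A (Eo (fst (t' i))) T (snd (t' i))"
    "ev (fst (t' i)) (snd (t' i)) = \<one>\<^bsub>mgrp M (fst (t' i))\<^esub>" if "i \<in> I'" for i
    using bij_betwE[OF t'] that Eo_Obj TO by (force simp: arr_def)+
  obtain S \<kappa> where cpS: "is_coproduct A I' (\<lambda>i. Eo (fst (t' i))) S \<kappa>"
    using A.ex_coproduct[OF univ cc I', of "\<lambda>i. Eo (fst (t' i))"] Eo_Obj t'i(1) by blast
  have S: "S \<in> Sum_class TYPE('u) A \<U>" by (rule A.Sum_classI[OF I' _ U cpS]) (rule Eo_U[OF t'i(1)])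
  obtain f where f: "arr A S T f" "\<And>i. i \<in> I' \<Longrightarrow> f \<diamondop> \<kappa> i = snd (t' i)"
    using A.coproduct_desc[OF cpS TO t'i(2)] by blast
  have SO: "S \<in> Obj A" using f(1) by (rule arrD)
  obtain P c where c: "is_cokernel A S T f P c" using A.ex_cokernel[OF SO TO arrD(3)[OF f(1)]] by blast
  note ca = A.cokernelD[OF c f(1)]
  have PO: "P \<in> Obj A" using ca by (auto dest: arrD)
  have P: "P \<in> Pres_class TYPE('u) A \<U>" by (rule A.Pres_classI[OF S T f(1) c])
  have \<kappa>: "arr A (Eo (fst (t' i))) S (\<kappa> i)" if "i \<in> I'" for i
    using A.coproduct_arr[OF cpS that] Eo_Obj t'i(1) that by blast
  \<comment> \<open>\<open>f\<close> carries each injection of \<open>S\<close> to an element of the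
    kernel of \<open>ev\<close>, and the kernel is closed under addition and the action.\<close>
  have ev_f: "ev d (f \<diamondop> s) = \<one>\<^bsub>mgrp M d\<^esub>" if d: "d \<in> Obj C" and s: "arr A (Eo d) S s" for d s
  proof (rule self_small_span[OF I' _ cpS Eo_U[OF d] s, where Q = "\<lambda>s. ev d (f \<diamondop> s) = \<one>\<^bsub>mgrp M d\<^esub>"])
    show "Eo (fst (t' i)) \<in> \<U>" if "i \<in> I'" for i by (rule Eo_U[OF t'i(1)[OF that]])
    show "ev d (f \<diamondop> Zero A (Eo d) S) = \<one>\<^bsub>mgrp M d\<^esub>" using f Eo_Obj[OF d] ev_one[OF d] by simp
  next
    fix a b assume a: "arr A (Eo d) S a" and b: "arr A (Eo d) S b"
      and eq: "ev d (f \<diamondop> a) = \<one>\<^bsub>mgrp M d\<^esub>" "ev d (f \<diamondop> b) = \<one>\<^bsub>mgrp M d\<^esub>"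
    have "f \<diamondop> Add A a b = Add A (f \<diamondop> a) (f \<diamondop> b)" by (rule A.comp_Add'[OF a b f(1)])
    then show "ev d (f \<diamondop> Add A a b) = \<one>\<^bsub>mgrp M d\<^esub>"
      using ev_Add[OF d A.arr_comp[OF a f(1)] A.arr_comp[OF b f(1)]] eq grp[OF d] by (simp add: group.is_monoid)
  next
    fix i \<psi> assume i: "i \<in> I'" and \<psi>: "arr A (Eo d) (Eo (fst (t' i))) \<psi>"
    obtain h where h: "arr C d (fst (t' i)) h" "Ea h = \<psi>" using ff_full[OF E_ff d t'i(1)[OF i] \<psi>] .
    have "ev d (f \<diamondop> (\<kappa> i \<diamondop> \<psi>)) = mact M h (ev (fst (t' i)) (snd (t' i)))"
      using A.assoc[OF \<psi> \<kappa>[OF i] f(1)] f(2)[OF i] h evn[OF h(1) t'i(2)[OF i]] by simp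
    then show "ev d (f \<diamondop> (\<kappa> i \<diamondop> \<psi>)) = \<one>\<^bsub>mgrp M d\<^esub>"
      using t'i(3)[OF i] hom_one[OF module_arr(2)[OF univ C M h(1)] grp[OF t'i(1)[OF i]] grp[OF d]] by simp
  qed
  \<comment> \<open>Exactness of the presentation identifies what \<open>c\<close> kills with what
    factors through \<open>f\<close>. This lies in the kernel of \<open>ev\<close> by
    \<open>ev_f\<close>, and conversely each element of the kernel is the restriction of
    \<open>f\<close> to a summand.\<close>
  have ker: "c \<diamondop> b = Zero A (Eo d) P \<longleftrightarrow> ev d b = \<one>\<^bsub>mgrp M d\<^esub>"
    if d: "d \<in> Obj C" and b: "arr A (Eo d) T b" for d b
  proof
    assume "c \<diamondop> b = Zero A (Eo d) P"
    then obtain s where "arr A (Eo d) S s" "f \<diamondop> s = b" using presentation_exact[OF S T f(1) c Eo_U[OF d] b] by blast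
    then show "ev d b = \<one>\<^bsub>mgrp M d\<^esub>" using ev_f[OF d] by blast
  next
    assume "ev d b = \<one>\<^bsub>mgrp M d\<^esub>"
    then have "(d, b) \<in> t' ` I'" using t' d b by (simp add: bij_betw_def arr_def)
    then obtain i where i: "i \<in> I'" "t' i = (d, b)" by (metis imageE)
    have "b = f \<diamondop> \<kappa> i" "arr A (Eo d) S (\<kappa> i)" using f(2)[OF i(1)] \<kappa>[OF i(1)] i by simp_all
    then show "c \<diamondop> b = Zero A (Eo d) P" using A.assoc[OF _ f(1) ca(1)] ca(2) PO by simp
  qed
  have eq_iff: "c \<diamondop> a = c \<diamondop> b \<longleftrightarrow> ev d a = ev d b"
    if d: "d \<in> Obj C" and a: "arr A (Eo d) T a" and b: "arr A (Eo d) T b" for d a b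
  proof -
    interpret Md: group "mgrp M d" by (rule grp[OF d])
    let ?s = "Sub A (Eo d) T a b"
    have s: "arr A (Eo d) T ?s" by (rule A.arr_Sub[OF a b])
    have "c \<diamondop> a = c \<diamondop> b \<longleftrightarrow> c \<diamondop> ?s = Zero A (Eo d) P"
      using A.comp_Sub[OF a b ca(1)] A.Sub_eq_Zero_iff[OF A.arr_comp[OF a ca(1)] A.arr_comp[OF b ca(1)]] by simp
    also have "\<dots> \<longleftrightarrow> ev d ?s = \<one>\<^bsub>mgrp M d\<^esub>" by (rule ker[OF d s])
    also have "\<dots> \<longleftrightarrow> ev d ?s \<otimes>\<^bsub>mgrp M d\<^esub> ev d b = ev d b"
      using ev_car[OF d s] ev_car[OF d b] by simp
    also have "ev d ?s \<otimes>\<^bsub>mgrp M d\<^esub> ev d b = ev d a"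
      using ev_Add[OF d s b] A.Add_Sub[OF a b] by simp
    finally show ?thesis .
  qed
  have lift: "\<exists>b. arr A (Eo d) T b \<and> y = He P d (c \<diamondop> b)"
    if d: "d \<in> Obj C" and y: "y \<in> carrier (mgrp (Hmod P) d)" for d y
  proof -
    obtain a where a: "arr A (Eo d) P a" "y = He P d a" using He_surj[OF PO d y] .
    obtain b where "arr A (Eo d) T b" "c \<diamondop> b = a" using presentation_lift[OF S T f(1) c Eo_U[OF d] a(1)] .
    then show ?thesis using a by blast
  qed
  \<comment> \<open>\<open>ev\<close> descends along \<open>c\<close> because both have the same
    kernel; by \<open>eq_iff\<close> the value does not depend on the chosen lift.\<close>
  define \<alpha> where "\<alpha> d y = ev d (SOME b. arr A (Eo d) T b \<and> y = He P d (c \<diamondop> b))" for d y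
  have cb: "arr A (Eo d) P (c \<diamondop> b)" if "arr A (Eo d) T b" for d b by (rule A.arr_comp[OF that ca(1)])
  have \<alpha>: "\<alpha> d (He P d (c \<diamondop> b)) = ev d b" if d: "d \<in> Obj C" and b: "arr A (Eo d) T b" for d b
  proof -
    let ?b = "SOME b'. arr A (Eo d) T b' \<and> He P d (c \<diamondop> b) = He P d (c \<diamondop> b')"
    have *: "arr A (Eo d) T ?b \<and> He P d (c \<diamondop> b) = He P d (c \<diamondop> ?b)"
      by (rule someI[of "\<lambda>b'. arr A (Eo d) T b' \<and> He P d (c \<diamondop> b) = He P d (c \<diamondop> b')" b]) (simp add: b)
    have "c \<diamondop> b = c \<diamondop> ?b" by (rule He_inj[OF conjunct2[OF *] cb[OF b] cb[OF conjunct1[OF *]] d])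
    then have "ev d b = ev d ?b" using eq_iff[OF d b conjunct1[OF *]] by simp
    then show ?thesis by (simp add: \<alpha>_def)
  qed
  have \<alpha>_arr: "arr Mods (Hmod P) M (mk_mhom C (Hmod P) M \<alpha>)"
  proof (rule arr_mk_mhom[OF univ C Hmod(1)[OF PO] M])
    fix d assume d: "d \<in> Obj C"
    show "\<alpha> d \<in> hom (mgrp (Hmod P) d) (mgrp M d)"
    proof (rule homI)
      fix y assume "y \<in> carrier (mgrp (Hmod P) d)"
      then obtain a where a: "arr A (Eo d) T a" "y = He P d (c \<diamondop> a)" using lift[OF d] by blast
      show "\<alpha> d y \<in> carrier (mgrp M d)" using \<alpha>[OF d a(1)] ev_car[OF d a(1)] a by simp
      fix z assume "z \<in> carrier (mgrp (Hmod P) d)"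
      then obtain b where b: "arr A (Eo d) T b" "z = He P d (c \<diamondop> b)" using lift[OF d] by blast
      have "c \<diamondop> Add A a b = Add A (c \<diamondop> a) (c \<diamondop> b)" by (rule A.comp_Add'[OF a(1) b(1) ca(1)])
      then have "y \<otimes>\<^bsub>mgrp (Hmod P) d\<^esub> z = He P d (c \<diamondop> Add A a b)" using He_mult[OF PO d cb[OF a(1)] cb[OF b(1)]] a b by simp
      then show "\<alpha> d (y \<otimes>\<^bsub>mgrp (Hmod P) d\<^esub> z) = \<alpha> d y \<otimes>\<^bsub>mgrp M d\<^esub> \<alpha> d z"
        using \<alpha>[OF d A.arr_Add[OF a(1) b(1)]] \<alpha>[OF d a(1)] \<alpha>[OF d b(1)] ev_Add[OF d a(1) b(1)] a b by simp
    qed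
  next
    fix d d' h y assume h: "arr C d d' h" and y: "y \<in> carrier (mgrp (Hmod P) d')"
    have d: "d \<in> Obj C" "d' \<in> Obj C" using h by (auto dest: arrD)
    obtain b where b: "arr A (Eo d') T b" "y = He P d' (c \<diamondop> b)" using lift[OF d(2) y] by blast
    note Eh = functor_arr[OF E_fun h]
    show "\<alpha> d (mact (Hmod P) h y) = mact M h (\<alpha> d' y)"
      using Hmod(3)[OF PO h cb[OF b(1)]] b A.assoc[OF Eh b(1) ca(1)] \<alpha>[OF d(1) A.arr_comp[OF Eh b(1)]]
        \<alpha>[OF d(2) b(1)] evn[OF h b(1)] by simp
  qed
  have "is_isomorphism Mods (Hmod P) M (mk_mhom C (Hmod P) M \<alpha>)"
  proof (rule mhom_isoI[OF univ C \<alpha>_arr])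
    fix d assume d: "d \<in> Obj C"
    have mk: "mapp (mk_mhom C (Hmod P) M \<alpha>) d (He P d (c \<diamondop> b)) = ev d b" if "arr A (Eo d) T b" for b
      using mapp_mk_mhom[OF univ C d He_carrier[OF cb[OF that] d]] \<alpha>[OF d that] by simp
    show "bij_betw (mapp (mk_mhom C (Hmod P) M \<alpha>) d) (carrier (mgrp (Hmod P) d)) (carrier (mgrp M d))"
      unfolding bij_betw_def
    proof
      show "inj_on (mapp (mk_mhom C (Hmod P) M \<alpha>) d) (carrier (mgrp (Hmod P) d))"
      proof (rule inj_onI)
        fix y z assume y: "y \<in> carrier (mgrp (Hmod P) d)" and z: "z \<in> carrier (mgrp (Hmod P) d)"
          and eq: "mapp (mk_mhom C (Hmod P) M \<alpha>) d y = mapp (mk_mhom C (Hmod P) M \<alpha>) d z"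
        obtain a where a: "arr A (Eo d) T a" "y = He P d (c \<diamondop> a)" using lift[OF d y] by blast
        obtain b where b: "arr A (Eo d) T b" "z = He P d (c \<diamondop> b)" using lift[OF d z] by blast
        show "y = z" using mk[OF a(1)] mk[OF b(1)] eq_iff[OF d a(1) b(1)] a b eq by simp
      qed
      show "mapp (mk_mhom C (Hmod P) M \<alpha>) d ` carrier (mgrp (Hmod P) d) = carrier (mgrp M d)"
      proof (intro equalityI subsetI)
        fix x assume "x \<in> mapp (mk_mhom C (Hmod P) M \<alpha>) d ` carrier (mgrp (Hmod P) d)"
        then show "x \<in> carrier (mgrp M d)" using mapp_closed[OF univ C \<alpha>_arr d] by blast
      next
        fix x assume "x \<in> carrier (mgrp M d)"
        then obtain b where b: "arr A (Eo d) T b" "ev d b = x" using ev_surj[OF d] by blast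
        then show "x \<in> mapp (mk_mhom C (Hmod P) M \<alpha>) d ` carrier (mgrp (Hmod P) d)"
          using mk[OF b(1)] He_carrier[OF cb[OF b(1)] d] by (intro image_eqI[of _ _ "He P d (c \<diamondop> b)"]) simp_all
      qed
    qed
  qed
  then show thesis using that P by blast
qed

section \<open>Equivalence with modules, and the coreflection\<close>

lemma Pres_sub_Obj: "Pres_class TYPE('u) A \<U> \<subseteq> Obj A"
  using A.Pres_class_Obj by blast

lemma Pres_equivalent: "equivalent_categories (full_subcategory A (Pres_class TYPE('u) A \<U>)) Mods"
proof (rule ff_imp_equivalence[OF category_full[OF A.category_axioms Pres_sub_Obj] Md.category_axioms])
  let ?B = "Pres_class TYPE('u) A \<U>"
  have F: "is_functor (full_subcategory A ?B) Mods Hfun"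
    by (rule functor_full[OF Hfun_functor Pres_sub_Obj])
  show "fully_faithful (full_subcategory A ?B) Mods Hfun"
    unfolding fully_faithful_def
  proof (intro conjI ballI F; simp)
    fix X Y assume X: "X \<in> ?B" and Y: "Y \<in> ?B"
    then have o: "X \<in> Obj A" "Y \<in> Obj A" using Pres_sub_Obj by auto
    show "bij_betw (ArrMap Hfun) (Hom A X Y) (Hom Mods (Hmod X) (Hmod Y))"
      unfolding bij_betw_def
    proof
      show "inj_on (ArrMap Hfun) (Hom A X Y)"
        by (rule inj_onI, rule Hfun_faithful[OF X]) (use o in \<open>simp_all add: arr_def\<close>)
      show "ArrMap Hfun ` Hom A X Y = Hom Mods (Hmod X) (Hmod Y)"
      proof (intro equalityI subsetI)
        fix \<eta> assume "\<eta> \<in> ArrMap Hfun ` Hom A X Y"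
        then show "\<eta> \<in> Hom Mods (Hmod X) (Hmod Y)" using Hfun_arr(1) o by (auto simp: arr_def)
      next
        fix \<eta> assume "\<eta> \<in> Hom Mods (Hmod X) (Hmod Y)"
        then have "arr Mods (Hmod X) (Hmod Y) \<eta>" using Hmod(1) o by (simp add: arr_def)
        from Hfun_full[OF X o(2) this] obtain g where "arr A X Y g" "ArrMap Hfun g = \<eta>" .
        then show "\<eta> \<in> ArrMap Hfun ` Hom A X Y" by (auto simp: arr_def)
      qed
    qed
  qed
  show "ess_surj (full_subcategory A ?B) Mods Hfun"
    unfolding ess_surj_def isomorphic_def Obj_full Hfun_Obj
  proof
    fix M assume "M \<in> Obj Mods"
    from Hfun_ess_surj[OF this] obtain P \<alpha> where "P \<in> ?B" "is_isomorphism Mods (Hmod P) M \<alpha>" .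
    then show "\<exists>X\<in>?B. \<exists>f. is_isomorphism Mods (Hmod X) M f" by blast
  qed
qed

text \<open>For presented \<open>Q\<close>, \<open>Hfun\<close> identifies Hom(Q, P) and Hom(Q, X)
  with the module morphisms from \<open>Hmod Q\<close> to \<open>Hmod P\<close> and to
  \<open>Hmod X\<close>, and \<alpha> is an isomorphism between these two targets.\<close>

lemma Pres_coreflective: "coreflective A (Pres_class TYPE('u) A \<U>)"
  unfolding coreflective_iff[OF A.category_axioms Pres_sub_Obj]
proof
  let ?B = "Pres_class TYPE('u) A \<U>"
  fix X assume X: "X \<in> Obj A"
  obtain P \<alpha> where P: "P \<in> ?B" and \<alpha>: "is_isomorphism Mods (Hmod P) (Hmod X) \<alpha>"
    using Hfun_ess_surj[OF Hmod(1)[OF X]] .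
  have PO: "P \<in> Obj A" using P by (rule A.Pres_class_Obj)
  obtain \<beta> where \<alpha>\<beta>: "arr Mods (Hmod P) (Hmod X) \<alpha>" "arr Mods (Hmod X) (Hmod P) \<beta>" "\<alpha> \<diamondop>\<^bsub>Mods\<^esub> \<beta> = Ident Mods (Hmod X)"
    using Md.isomorphismE[OF \<alpha> Hmod(1)[OF PO] Hmod(1)[OF X]] by blast
  obtain g where g: "arr A P X g" "ArrMap Hfun g = \<alpha>" using Hfun_full[OF P X \<alpha>\<beta>(1)] .
  have "bij_betw (\<lambda>a. g \<diamondop> a) (Hom A Q P) (Hom A Q X)" if Q: "Q \<in> ?B" for Q
  proof -
    have QO: "Q \<in> Obj A" using Q by (rule A.Pres_class_Obj)
    have Hg: "ArrMap Hfun (g \<diamondop> a) = \<alpha> \<diamondop>\<^bsub>Mods\<^esub> ArrMap Hfun a" if "arr A Q P a" for a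
      using functor_comp[OF Hfun_functor that g(1)] g(2) by simp
    show ?thesis
      unfolding bij_betw_def
    proof
      show "inj_on (\<lambda>a. g \<diamondop> a) (Hom A Q P)"
      proof (rule inj_onI)
        fix a b assume "a \<in> Hom A Q P" "b \<in> Hom A Q P" and eq: "g \<diamondop> a = g \<diamondop> b"
        then have a: "arr A Q P a" and b: "arr A Q P b" using QO PO by (simp_all add: arr_def)
        have "\<alpha> \<diamondop>\<^bsub>Mods\<^esub> ArrMap Hfun a = \<alpha> \<diamondop>\<^bsub>Mods\<^esub> ArrMap Hfun b" using Hg[OF a] Hg[OF b] eq by simp
        then have "ArrMap Hfun a = ArrMap Hfun b"
          using Md.iso_cancel_left[OF \<alpha> Hfun_arr(1)[OF a] Hfun_arr(1)[OF b] Hmod(1)[OF X]] by blast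
        then show "a = b" by (rule Hfun_faithful[OF Q a b])
      qed
      show "(\<lambda>a. g \<diamondop> a) ` Hom A Q P = Hom A Q X"
      proof (intro equalityI subsetI)
        fix b assume "b \<in> (\<lambda>a. g \<diamondop> a) ` Hom A Q P"
        then show "b \<in> Hom A Q X" using A.arr_comp[OF _ g(1)] QO PO unfolding arr_def by blast
      next
        fix b assume "b \<in> Hom A Q X"
        then have b: "arr A Q X b" using QO X by (simp add: arr_def)
        note Hb = Hfun_arr(1)[OF b]
        obtain a where a: "arr A Q P a" "ArrMap Hfun a = \<beta> \<diamondop>\<^bsub>Mods\<^esub> ArrMap Hfun b"
          using Hfun_full[OF Q PO Md.arr_comp[OF Hb \<alpha>\<beta>(2)]] .
        have "ArrMap Hfun (g \<diamondop> a) = (\<alpha> \<diamondop>\<^bsub>Mods\<^esub> \<beta>) \<diamondop>\<^bsub>Mods\<^esub> ArrMap Hfun b"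
          using Hg[OF a(1)] a(2) Md.assoc[OF Hb \<alpha>\<beta>(2,1)] by simp
        also have "\<dots> = ArrMap Hfun b" using \<alpha>\<beta>(3) Md.id_comp[OF Hb] by simp
        finally have "g \<diamondop> a = b" by (rule Hfun_faithful[OF Q A.arr_comp[OF a(1) g(1)] b])
        then show "b \<in> (\<lambda>a. g \<diamondop> a) ` Hom A Q P" using a(1) by (auto simp: arr_def)
      qed
    qed
  qed
  then show "\<exists>R e. coreflection A ?B X R e" unfolding coreflection_def using P g(1) by blast
qed

end

end

subsection \<open>Small copies of full subcategories\<close>

text \<open>\<open>k\<close> encodes arrows into the new type and \<open>k'\<close> decodes them.
  Decoding recovers the arrow, so hom sets that were disjoint stay disjoint.\<close>

definition copy_category ::
    "('o, 'm) preadd \<Rightarrow> 'c set \<Rightarrow> ('c \<Rightarrow> 'o) \<Rightarrow> ('m \<Rightarrow> 'k) \<Rightarrow> ('k \<Rightarrow> 'm) \<Rightarrow> ('c, 'k) preadd" where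
  "copy_category A K j k k' = \<lparr>
     Obj = K, Hom = (\<lambda>x y. k ` Hom A (j x) (j y)), Ident = (\<lambda>x. k (Ident A (j x))),
     Comp = (\<lambda>g f. k (k' g \<diamondop>\<^bsub>A\<^esub> k' f)), Add = (\<lambda>f g. k (Add A (k' f) (k' g))),
     Zero = (\<lambda>x y. k (Zero A (j x) (j y)))\<rparr>"

lemma copy_category:
  assumes A: "preadditive_category A" and j: "inj_on j K" "j ` K \<subseteq> Obj A"
    and k: "\<And>x y f. \<lbrakk>x \<in> K; y \<in> K; f \<in> Hom A (j x) (j y)\<rbrakk> \<Longrightarrow> k' (k f) = f"
  defines "C \<equiv> copy_category A K j k k'" and "E \<equiv> \<lparr>ObjMap = j, ArrMap = k'\<rparr>"
  shows "preadditive_category C" and "is_additive_functor C A E" and "fully_faithful C A E"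
proof -
  interpret A: preadditive_category A by fact
  have jO: "j x \<in> Obj A" if "x \<in> K" for x using j that by blast
  have C_simps: "Obj C = K" "Hom C = (\<lambda>x y. k ` Hom A (j x) (j y))" "Ident C = (\<lambda>x. k (Ident A (j x)))"
    "Comp C = (\<lambda>g f. k (k' g \<diamondop>\<^bsub>A\<^esub> k' f))" "Add C = (\<lambda>f g. k (Add A (k' f) (k' g)))"
    "Zero C = (\<lambda>x y. k (Zero A (j x) (j y)))"
    by (simp_all add: C_def copy_category_def)
  have k_comp: "k' (k (g \<diamondop>\<^bsub>A\<^esub> f)) = g \<diamondop>\<^bsub>A\<^esub> f" if "x \<in> K" "y \<in> K" "z \<in> K" "f \<in> Hom A (j x) (j y)" "g \<in> Hom A (j y) (j z)" for x y z f g
    using k[OF that(1,3)] A.comp_in_Hom that jO by blast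
  have AddH: "Add A f g \<in> Hom A (j x) (j y)" if "x \<in> K" "y \<in> K" "f \<in> Hom A (j x) (j y)" "g \<in> Hom A (j x) (j y)" for x y f g
    using A.arr_Add[of "j x" "j y" f g] that jO by (simp add: arr_def)
  have ZeroH: "Zero A (j x) (j y) \<in> Hom A (j x) (j y)" if "x \<in> K" "y \<in> K" for x y
    using A.arr_Zero[OF jO[OF that(1)] jO[OF that(2)]] by (rule arrD)
  have kH: "k' f \<in> Hom A (j X) (j Y)" if "X \<in> K" "Y \<in> K" "f \<in> k ` Hom A (j X) (j Y)" for X Y f
    using k that by auto
  have cat: "category C"
    unfolding category_def C_simps
  proof (intro conjI allI impI)
    fix X Y Z f g assume *: "X \<in> K" "Y \<in> K" "Z \<in> K" and "f \<in> k ` Hom A (j X) (j Y)" "g \<in> k ` Hom A (j Y) (j Z)"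
    then obtain f0 g0 where f: "f0 \<in> Hom A (j X) (j Y)" "f = k f0" and g: "g0 \<in> Hom A (j Y) (j Z)" "g = k g0" by blast
    show "k (k' g \<diamondop>\<^bsub>A\<^esub> k' f) \<in> k ` Hom A (j X) (j Z)"
      using f g k * A.comp_in_Hom[OF jO[OF *(1)] jO[OF *(2)] jO[OF *(3)] f(1) g(1)] by simp
  next
    fix W X Y Z f g h assume *: "W \<in> K" "X \<in> K" "Y \<in> K" "Z \<in> K" and "f \<in> k ` Hom A (j W) (j X)"
      "g \<in> k ` Hom A (j X) (j Y)" "h \<in> k ` Hom A (j Y) (j Z)"
    then obtain f0 g0 h0 where f: "f0 \<in> Hom A (j W) (j X)" "f = k f0" and g: "g0 \<in> Hom A (j X) (j Y)" "g = k g0"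
      and h: "h0 \<in> Hom A (j Y) (j Z)" "h = k h0" by blast
    show "k (k' (k (k' h \<diamondop>\<^bsub>A\<^esub> k' g)) \<diamondop>\<^bsub>A\<^esub> k' f) = k (k' h \<diamondop>\<^bsub>A\<^esub> k' (k (k' g \<diamondop>\<^bsub>A\<^esub> k' f)))"
      using f g h k[OF *(1,2) f(1)] k[OF *(2,3) g(1)] k[OF *(3,4) h(1)] k_comp[OF *(2,3,4) g(1) h(1)]
        k_comp[OF *(1,2,3) f(1) g(1)] A.comp_assoc[OF jO[OF *(1)] jO[OF *(2)] jO[OF *(3)] jO[OF *(4)] f(1) g(1) h(1)]
      by simp
  next
    fix X assume "X \<in> K"
    then show "k (Ident A (j X)) \<in> k ` Hom A (j X) (j X)" using A.Ident_in_Hom jO by simp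
  next
    fix X Y f assume *: "X \<in> K" "Y \<in> K" and "f \<in> k ` Hom A (j X) (j Y)"
    then obtain f0 where f: "f0 \<in> Hom A (j X) (j Y)" "f = k f0" by blast
    note i = k[OF *(1,1) A.Ident_in_Hom[OF jO[OF *(1)]]] k[OF *(2,2) A.Ident_in_Hom[OF jO[OF *(2)]]]
    show "k (k' f \<diamondop>\<^bsub>A\<^esub> k' (k (Ident A (j X)))) = f"
      using f k[OF * f(1)] i A.comp_Ident[OF jO[OF *(1)] jO[OF *(2)] f(1)] by simp
    show "k (k' (k (Ident A (j Y))) \<diamondop>\<^bsub>A\<^esub> k' f) = f"
      using f k[OF * f(1)] i A.Ident_comp[OF jO[OF *(1)] jO[OF *(2)] f(1)] by simp
  next
    fix X Y X' Y' f assume *: "X \<in> K" "Y \<in> K" "X' \<in> K" "Y' \<in> K"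
      and f: "f \<in> k ` Hom A (j X) (j Y)" "f \<in> k ` Hom A (j X') (j Y')"
    have "j X = j X' \<and> j Y = j Y'"
      using A.Hom_disjoint[OF _ _ _ _ kH[OF *(1,2) f(1)] kH[OF *(3,4) f(2)]] jO * by blast
    then show "X = X'" "Y = Y'" using j(1) * by (auto dest: inj_onD)
  qed
  have grp: "comm_group (hom_group C X Y)" if "X \<in> K" "Y \<in> K" for X Y
  proof -
    have G: "comm_group (hom_group A (j X) (j Y))" using A.hom_comm_group jO that by blast
    interpret G: comm_group "hom_group A (j X) (j Y)" by (rule G)
    have kk: "k' (k f) = f" if "f \<in> Hom A (j X) (j Y)" for f using k \<open>X \<in> K\<close> \<open>Y \<in> K\<close> that by blast
    show ?thesis
    proof (rule comm_groupI; simp add: C_simps; (elim imageE)?)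
      show "\<And>x y xa xb. \<lbrakk>x = k xa; xa \<in> Hom A (j X) (j Y); y = k xb; xb \<in> Hom A (j X) (j Y)\<rbrakk> \<Longrightarrow>
         k (Add A (k' x) (k' y)) \<in> k ` Hom A (j X) (j Y)"
        using kk AddH[OF that] by simp
      show "k (Zero A (j X) (j Y)) \<in> k ` Hom A (j X) (j Y)" using ZeroH[OF that] by simp
      show "\<And>x y z xa xb xc. \<lbrakk>x = k xa; xa \<in> Hom A (j X) (j Y); y = k xb; xb \<in> Hom A (j X) (j Y);
         z = k xc; xc \<in> Hom A (j X) (j Y)\<rbrakk> \<Longrightarrow>
         k (Add A (k' (k (Add A (k' x) (k' y)))) (k' z)) = k (Add A (k' x) (k' (k (Add A (k' y) (k' z)))))"
        using kk AddH[OF that] G.m_assoc by simp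
      show "\<And>x y xa xb. \<lbrakk>x = k xa; xa \<in> Hom A (j X) (j Y); y = k xb; xb \<in> Hom A (j X) (j Y)\<rbrakk> \<Longrightarrow>
         k (Add A (k' x) (k' y)) = k (Add A (k' y) (k' x))"
        using kk G.m_comm by simp
      show "\<And>x xa. \<lbrakk>x = k xa; xa \<in> Hom A (j X) (j Y)\<rbrakk> \<Longrightarrow> k (Add A (k' (k (Zero A (j X) (j Y)))) (k' x)) = x"
        using kk ZeroH[OF that] G.l_one by simp
      show "\<exists>y\<in>Hom A (j X) (j Y). k (Add A (k' (k y)) (k' x)) = k (Zero A (j X) (j Y))"
        if x: "x = k xa" "xa \<in> Hom A (j X) (j Y)" for x xa
      proof -
        obtain y where "y \<in> Hom A (j X) (j Y)" "Add A y xa = Zero A (j X) (j Y)"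
          using G.l_inv_ex[of xa] x(2) by auto
        then show ?thesis using kk x by (intro bexI[of _ y]) simp_all
      qed
    qed
  qed
  show pre: "preadditive_category C"
  proof (intro preadditive_category.intro cat preadditive_category_axioms.intro; unfold C_simps)
    show "comm_group (hom_group C X Y)" if "X \<in> K" "Y \<in> K" for X Y by (rule grp[OF that])
  next
    fix X Y Z f f' g assume *: "X \<in> K" "Y \<in> K" "Z \<in> K" and "f \<in> k ` Hom A (j X) (j Y)"
      "f' \<in> k ` Hom A (j X) (j Y)" "g \<in> k ` Hom A (j Y) (j Z)"
    then obtain f0 f0' g0 where f: "f0 \<in> Hom A (j X) (j Y)" "f = k f0" and f': "f0' \<in> Hom A (j X) (j Y)" "f' = k f0'"
      and g: "g0 \<in> Hom A (j Y) (j Z)" "g = k g0" by blast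
    show "k (k' g \<diamondop>\<^bsub>A\<^esub> k' (k (Add A (k' f) (k' f')))) = k (Add A (k' (k (k' g \<diamondop>\<^bsub>A\<^esub> k' f))) (k' (k (k' g \<diamondop>\<^bsub>A\<^esub> k' f'))))"
      using f f' g k[OF *(1,2) f(1)] k[OF *(1,2) f'(1)] k[OF *(2,3) g(1)] k[OF *(1,2) AddH[OF *(1,2) f(1) f'(1)]]
        k_comp[OF * f(1) g(1)] k_comp[OF * f'(1) g(1)]
        A.comp_Add[OF jO[OF *(1)] jO[OF *(2)] jO[OF *(3)] f(1) f'(1) g(1)] by simp
  next
    fix X Y Z f g g' assume *: "X \<in> K" "Y \<in> K" "Z \<in> K" and "f \<in> k ` Hom A (j X) (j Y)"
      "g \<in> k ` Hom A (j Y) (j Z)" "g' \<in> k ` Hom A (j Y) (j Z)"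
    then obtain f0 g0 g0' where f: "f0 \<in> Hom A (j X) (j Y)" "f = k f0" and g': "g0' \<in> Hom A (j Y) (j Z)" "g' = k g0'"
      and g: "g0 \<in> Hom A (j Y) (j Z)" "g = k g0" by blast
    show "k (k' (k (Add A (k' g) (k' g'))) \<diamondop>\<^bsub>A\<^esub> k' f) = k (Add A (k' (k (k' g \<diamondop>\<^bsub>A\<^esub> k' f))) (k' (k (k' g' \<diamondop>\<^bsub>A\<^esub> k' f))))"
      using f g g' k[OF *(1,2) f(1)] k[OF *(2,3) g'(1)] k[OF *(2,3) g(1)] k[OF *(2,3) AddH[OF *(2,3) g(1) g'(1)]]
        k_comp[OF * f(1) g(1)] k_comp[OF * f(1) g'(1)]
        A.Add_comp[OF jO[OF *(1)] jO[OF *(2)] jO[OF *(3)] f(1) g(1) g'(1)] by simp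
  qed
  have F: "is_functor C A E"
    unfolding is_functor_def C_simps E_def ftor.simps
  proof (intro conjI ballI)
    fix X assume X: "X \<in> K"
    show "j X \<in> Obj A" by (rule jO[OF X])
    show "k' (k (Ident A (j X))) = Ident A (j X)" using k[OF X X] A.Ident_in_Hom[OF jO[OF X]] by blast
  next
    fix X Y f assume "X \<in> K" "Y \<in> K" "f \<in> k ` Hom A (j X) (j Y)"
    then show "k' f \<in> Hom A (j X) (j Y)" by (rule kH)
  next
    fix X Y Z f g assume "X \<in> K" "Y \<in> K" "Z \<in> K" "f \<in> k ` Hom A (j X) (j Y)" "g \<in> k ` Hom A (j Y) (j Z)"
    then show "k' (k (k' g \<diamondop>\<^bsub>A\<^esub> k' f)) = k' g \<diamondop>\<^bsub>A\<^esub> k' f" by (intro k_comp kH)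
  qed
  show "is_additive_functor C A E"
    unfolding is_additive_functor_def
  proof (intro conjI ballI F)
    fix X Y f g assume "X \<in> Obj C" "Y \<in> Obj C" "f \<in> Hom C X Y" "g \<in> Hom C X Y"
    then have "X \<in> K" "Y \<in> K" "f \<in> k ` Hom A (j X) (j Y)" "g \<in> k ` Hom A (j X) (j Y)" by (simp_all add: C_simps)
    then show "ArrMap E (Add C f g) = Add A (ArrMap E f) (ArrMap E g)"
      unfolding C_simps E_def ftor.simps using k[OF _ _ AddH[OF _ _ kH kH]] by blast
  qed
  have "bij_betw k' (k ` Hom A (j X) (j Y)) (Hom A (j X) (j Y))" if "X \<in> K" "Y \<in> K" for X Y
    using k[OF that] by (intro bij_betwI[where g = k]) auto
  then show "fully_faithful C A E"
    unfolding fully_faithful_def using F by (simp add: C_simps E_def)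
qed

section \<open>Rings as preadditive categories with one object\<close>

lemma ring_category_simps [simp]:
  "Obj (ring_category R) = {()}" "Hom (ring_category R) x y = carrier R" "Ident (ring_category R) x = \<one>\<^bsub>R\<^esub>"
  "Comp (ring_category R) = mult R" "Add (ring_category R) = add R" "Zero (ring_category R) x y = \<zero>\<^bsub>R\<^esub>"
  by (simp_all add: ring_category_def)

lemma hom_group_ring_category: "hom_group (ring_category R) x y = add_monoid R"
  by (simp add: hom_group_def)

lemma preadditive_ring_category:
  assumes "ring R"
  shows "preadditive_category (ring_category R)"
proof -
  interpret ring R by fact
  have "category (ring_category R)" by unfold_locales (auto simp: m_assoc)
  then show ?thesis
    using a_comm_group
    by (intro preadditive_category.intro preadditive_category_axioms.intro)
      (simp_all add: hom_group_ring_category l_distr r_distr)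
qed

text \<open>Lets the axioms of an encoded endomorphism ring be read off from its one-object
  category.\<close>

lemma ring_of_preadditive:
  assumes "preadditive_category (ring_category R)"
  shows "ring R"
proof -
  interpret C: preadditive_category "ring_category R" by fact
  have g: "comm_group (add_monoid R)" using C.hom_comm_group[of "()" "()"] by (simp add: hom_group_ring_category)
  show ?thesis
  proof (rule ringI)
    show "abelian_group R"
      using g by (simp add: abelian_group_def abelian_group_axioms_def abelian_monoid_def comm_group_def)
    show "monoid R"
      by (rule monoidI)
        (use C.comp_in_Hom[of "()" "()" "()"] C.Ident_in_Hom[of "()"] C.comp_assoc[of "()" "()" "()" "()"]
          C.comp_Ident[of "()" "()"] C.Ident_comp[of "()" "()"] in simp_all)
  qed (use C.comp_Add[of "()" "()" "()"] C.Add_comp[of "()" "()" "()"] in simp_all)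
qed

lemma small_preadditive_ring_category:
  assumes univ: "universe TYPE('u)" and R: "ring R" "small TYPE('u) (carrier R)"
  shows "small_preadditive TYPE('u) (ring_category R)"
  using preadditive_ring_category[OF R(1)] R(2) small_finite[OF univ, of "{()}"]
  by (simp add: small_preadditive_def small_category_def locally_small_def preadditive_category.axioms(1))

subsection \<open>The theorem\<close>

text \<open>The generators correspond to the representable modules, one for each object of
  \<open>C\<close>. Writing them as an image of \<open>Obj C\<close> makes a one-object category
  yield a single generator.\<close>

lemma coreflective_module_category_imp_presenting_set:
  fixes A :: "('o, 'm) preadd" and C :: "('c, 'k) preadd"
  assumes univ: "universe TYPE('u)" and A: "abelian_category A" and ls: "locally_small TYPE('u) A"
    and cc: "cocomplete TYPE('u) A" and add: "additive_subcategory A B" and core: "coreflective A B"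
    and C: "small_preadditive TYPE('u) C"
    and eq: "equivalent_categories (full_subcategory A B) (module_category TYPE('u) C)"
  obtains u where "presenting_set TYPE('u) A B (u ` Obj C)"
proof -
  have BO: "B \<subseteq> Obj A" using add by (simp add: additive_subcategory_def)
  have cA: "category A" using A by (simp add: abelian_category_def preadditive_category_def)
  note cB = category_full[OF cA BO] and cM = category_Md[OF univ C]
  obtain F where F: "fully_faithful (full_subcategory A B) (module_category TYPE('u) C) F"
    "ess_surj (full_subcategory A B) (module_category TYPE('u) C) F"
    using equivalence_imp_ff[OF cB cM eq] .
  obtain h where h: "module_generators (full_subcategory A B) (h ` rep TYPE('u) C ` Obj C)"
    using module_generators_transfer[OF cB cM F module_generators_rep[OF univ C]] .
  have "small TYPE('u) (h ` rep TYPE('u) C ` Obj C)"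
    using small_Obj_C[OF univ C] by (intro small_image)
  then have "presenting_set TYPE('u) A B (h ` rep TYPE('u) C ` Obj C)"
    by (rule presenting_set_generators[OF univ A ls cc add core h])
  then show thesis using that[of "\<lambda>c. h (rep TYPE('u) C c)"] by (simp add: image_image)
qed

text \<open>\<open>C\<close> and \<open>E\<close> are left open so that the same argument serves a
  small copy of the full subcategory on \<U> and, for a singleton \<U>, the endomorphism ring of its
  member.\<close>

lemma presenting_set_imp_equivalence:
  fixes A :: "('o, 'm) preadd"
  assumes univ: "universe TYPE('u)" and A: "abelian_category A" and ls: "locally_small TYPE('u) A"
    and cc: "cocomplete TYPE('u) A" and ps: "presenting_set TYPE('u) A B \<U>"
    and C: "small_preadditive TYPE('u) C" and E: "is_additive_functor C A E" "fully_faithful C A E" "ObjMap E ` Obj C = \<U>"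
  shows "coreflective A B" "equivalent_categories (full_subcategory A B) (module_category TYPE('u) C)"
proof -
  have U: "\<U> \<subseteq> Obj A" "self_small TYPE('u) A \<U>" "trace_condition TYPE('u) A \<U>" and B: "B = Pres_class TYPE('u) A \<U>"
    using ps by (simp_all add: presenting_set_def)
  show "coreflective A B" unfolding B by (rule Pres_coreflective[OF univ A ls cc U C E])
  show "equivalent_categories (full_subcategory A B) (module_category TYPE('u) C)"
    unfolding B by (rule Pres_equivalent[OF univ A ls cc U C E])
qed

lemma presenting_set_imp_module_category:
  fixes A :: "('o, 'm) preadd"
  assumes univ: "universe TYPE('u)" and A: "abelian_category A" and ls: "locally_small TYPE('u) A"
    and cc: "cocomplete TYPE('u) A" and ps: "presenting_set TYPE('u) A B \<U>"
  shows "coreflective A B"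
    and "\<exists>C :: ('u, 'u) preadd. small_preadditive TYPE('u) C \<and>
      equivalent_categories (full_subcategory A B) (module_category TYPE('u) C)"
proof -
  have U: "\<U> \<subseteq> Obj A" "small TYPE('u) \<U>" using ps by (simp_all add: presenting_set_def)
  have pA: "preadditive_category A" using A by (simp add: abelian_category_def)
  let ?H = "\<Union>X\<in>\<U>. \<Union>Y\<in>\<U>. Hom A X Y"
  have "small TYPE('u) (Hom A X Y)" if "X \<in> \<U>" "Y \<in> \<U>" for X Y
    using ls that U(1) by (auto simp: locally_small_def)
  then have H: "small TYPE('u) ?H" by (intro small_UN[OF univ] U(2))
  \<comment> \<open>One encoding for all hom sets between members of \<U> together, since a single
    map has to decode the arrows of all of them.\<close>
  obtain k :: "'m \<Rightarrow> 'u" where k: "inj_on k ?H" using small_imp_inj[OF H] .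
  obtain K :: "'u set" and j where K: "small TYPE('u) K" "bij_betw j K \<U>" using small_index[OF U(2)] .
  define C where "C = copy_category A K j k (inv_into ?H k)"
  define E where "E = \<lparr>ObjMap = j, ArrMap = inv_into ?H k\<rparr>"
  have j: "inj_on j K" "j ` K = \<U>" "j ` K \<subseteq> Obj A" using K(2) U(1) by (simp_all add: bij_betw_def)
  have kk: "inv_into ?H k (k f) = f" if "x \<in> K" "y \<in> K" "f \<in> Hom A (j x) (j y)" for x y f
    by (rule inv_into_f_f[OF k]) (use that j(2) in blast)
  note cp = copy_category[where j = j and K = K and k = k and k' = "inv_into ?H k", OF pA j(1,3) kk, folded C_def E_def]
  have "preadditive_category C" by (rule cp(1))
  moreover have "small TYPE('u) (Hom C x y)" if "x \<in> Obj C" "y \<in> Obj C" for x y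
  proof -
    have "small TYPE('u) (Hom A (j x) (j y))"
      using that j(3) ls by (auto simp: C_def copy_category_def locally_small_def)
    then show ?thesis by (simp add: C_def copy_category_def small_image)
  qed
  ultimately have C: "small_preadditive TYPE('u) C"
    using K(1) by (simp add: small_preadditive_def small_category_def locally_small_def
        preadditive_category_def C_def copy_category_def)
  have E1: "is_additive_functor C A E" by (rule cp(2))
  have E2: "fully_faithful C A E" by (rule cp(3))
  have "ObjMap E ` Obj C = \<U>" using j(2) by (simp add: E_def C_def copy_category_def)
  note * = presenting_set_imp_equivalence[OF univ A ls cc ps C E1 E2 this]
  show "coreflective A B" by (rule *(1))
  show "\<exists>C :: ('u, 'u) preadd. small_preadditive TYPE('u) C \<and>
      equivalent_categories (full_subcategory A B) (module_category TYPE('u) C)"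
    using C *(2) by blast
qed

lemma presenting_singleton_imp_ring:
  fixes A :: "('o, 'm) preadd"
  assumes univ: "universe TYPE('u)" and A: "abelian_category A" and ls: "locally_small TYPE('u) A"
    and cc: "cocomplete TYPE('u) A" and ps: "presenting_set TYPE('u) A B {U}"
  shows "\<exists>R :: 'u ring. ring R \<and> small TYPE('u) (carrier R) \<and>
      equivalent_categories (full_subcategory A B) (module_category TYPE('u) (ring_category R))"
proof -
  have U: "U \<in> Obj A" using ps by (simp add: presenting_set_def)
  have pA: "preadditive_category A" using A by (simp add: abelian_category_def)
  have H: "small TYPE('u) (Hom A U U)" using ls U by (simp add: locally_small_def)
  obtain k :: "'m \<Rightarrow> 'u" where k: "inj_on k (Hom A U U)" using small_imp_inj[OF H] .
  define k' where "k' = inv_into (Hom A U U) k"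
  \<comment> \<open>The endomorphism ring of \<open>U\<close> on codes, with composition as product,
    so that its one-object category is a copy of the full subcategory on \<open>U\<close>.\<close>
  define R where "R = \<lparr>carrier = k ` Hom A U U, mult = (\<lambda>g f. k (k' g \<diamondop>\<^bsub>A\<^esub> k' f)), one = k (Ident A U),
    zero = k (Zero A U U), add = (\<lambda>f g. k (Add A (k' f) (k' g)))\<rparr>"
  define E where "E = \<lparr>ObjMap = (\<lambda>_ :: unit. U), ArrMap = k'\<rparr>"
  have RC: "ring_category R = copy_category A {()} (\<lambda>_. U) k k'"
    by (simp add: ring_category_def copy_category_def R_def)
  have j: "inj_on (\<lambda>_ :: unit. U) {()}" "(\<lambda>_ :: unit. U) ` {()} \<subseteq> Obj A" using U by auto
  have kk: "k' (k f) = f" if "f \<in> Hom A U U" for f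
    unfolding k'_def using k that by (rule inv_into_f_f)
  note cp = copy_category[where k = k and k' = k', OF pA j kk, folded RC E_def]
  have R: "ring R" by (rule ring_of_preadditive) (rule cp(1))
  have Rs: "small TYPE('u) (carrier R)" using small_image[OF H] by (simp add: R_def)
  have E1: "is_additive_functor (ring_category R) A E" by (rule cp(2))
  have E2: "fully_faithful (ring_category R) A E" by (rule cp(3))
  have "ObjMap E ` Obj (ring_category R) = {U}" by (simp add: E_def)
  from presenting_set_imp_equivalence(2)[OF univ A ls cc ps small_preadditive_ring_category[OF univ R Rs] E1 E2 this]
  show ?thesis using R Rs by blast
qed

theorem corollary9p5:
  fixes A :: "('o, 'm) preadd" and B :: "'o set"
  assumes "universe TYPE('u)"
    and "abelian_category A"
    and "locally_small TYPE('u) A"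
    and "cocomplete TYPE('u) A"
    and "additive_subcategory A B"
  shows
    "(coreflective A B \<and>
        (\<exists>C :: ('u, 'u) preadd. small_preadditive TYPE('u) C \<and>
           equivalent_categories (full_subcategory A B) (module_category TYPE('u) C))
      \<longleftrightarrow>
      closed_under_cokernels A B \<and> (\<exists>\<U>. presenting_set TYPE('u) A B \<U>))
     \<and>
     (closed_under_cokernels A B \<and> (\<exists>\<U>. presenting_set TYPE('u) A B \<U>) \<longrightarrow>
        ((\<exists>R :: 'u ring. ring R \<and> small TYPE('u) (carrier R) \<and>
            equivalent_categories (full_subcategory A B) (module_category TYPE('u) (ring_category R)))
         \<longleftrightarrow>
         (\<exists>U. presenting_set TYPE('u) A B {U})))"
proof (intro conjI iffI impI; elim conjE exE)
  note fwd = coreflective_module_category_imp_presenting_set[OF assms]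
  note bwd = presenting_set_imp_module_category[OF assms(1-4)]
  {
    fix C :: "('u, 'u) preadd"
    assume core: "coreflective A B" and "small_preadditive TYPE('u) C"
      "equivalent_categories (full_subcategory A B) (module_category TYPE('u) C)"
    then show "\<exists>\<U>. presenting_set TYPE('u) A B \<U>" using fwd by blast
    show "closed_under_cokernels A B"
      by (rule closed_under_cokernels_coreflective[OF assms(2,5) core])
  next
    fix \<U> assume ps: "presenting_set TYPE('u) A B \<U>"
    show "coreflective A B"
      "\<exists>C :: ('u, 'u) preadd. small_preadditive TYPE('u) C \<and>
        equivalent_categories (full_subcategory A B) (module_category TYPE('u) C)"
      using bwd[OF ps] by blast+
  next
    fix \<U> and R :: "'u ring"
    assume ps: "presenting_set TYPE('u) A B \<U>" and R: "ring R" "small TYPE('u) (carrier R)"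
      and eq: "equivalent_categories (full_subcategory A B) (module_category TYPE('u) (ring_category R))"
    \<comment> \<open>The ring category has one object, so the presenting set obtained from it is a
      singleton; coreflectivity comes from the presenting set already given.\<close>
    obtain u where "presenting_set TYPE('u) A B (u ` Obj (ring_category R))"
      using fwd[OF bwd(1)[OF ps] small_preadditive_ring_category[OF assms(1) R] eq] .
    then show "\<exists>U. presenting_set TYPE('u) A B {U}" by auto
  next
    fix U assume "presenting_set TYPE('u) A B {U}"
    then show "\<exists>R :: 'u ring. ring R \<and> small TYPE('u) (carrier R) \<and>
        equivalent_categories (full_subcategory A B) (module_category TYPE('u) (ring_category R))"
      by (rule presenting_singleton_imp_ring[OF assms(1-4)])
  }
qed

end
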